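(* If the sequence $(L_n)_{n\ge1}$ converges in distribution, then the sequence of processes $(\hat N_n)_{n\ge1}$ converges in distribution in Skorohod space to a Markov jump process $\hat N_\infty$ with values in $\{2,3,\dots\}$ and jump rates $\hat\rho_{ij}=\mu_j\rho_{ji}/\mu_i$ from $i$ to $j$ for $i<j$, where $\mu=(\mu_i)_{i\ge2}$ is the unique solution of (Q) (and $\hat N_\infty(0)$ has the limit distribution $P(\hat N_\infty(0)=i)=\mu_i\rho_{i1}$).
   Context: Let $\Lambda$ be a nonzero finite measure on $[0,1]$. For $n\ge 1$, the $\Lambda$-coalescent started with $n$ blocks, $(\Pi_n(t))_{t\ge0}$, is the continuous-time Markov chain on partitions of $\{1,\dots,n\}$, started from the partition into singletons, in which, whenever there are $b$ blocks, each particular collection of $k\ge2$ blocks merges into a single block at rate $\lambda_{b,k}=\int_{[0,1]}p^{k-2}(1-p)^{b-k}\,\Lambda(dp)$, and no other transitions occur. Let $N_n(t)$ be the number of blocks of $\Pi_n(t)$, $T_n=\inf\{t\ge0:N_n(t)=1\}$, and $L_n=N_n(T_n-)$. For $1\le j<i$ let $\rho_{ij}=\binom{i}{i-j+1}\lambda_{i,i-j+1}$ and $\rho_i=\sum_{j=1}^{i-1}\rho_{ij}$. Condition (Q) on a locally finite measure $\mu=(\mu_i)_{i\ge2}$ on $\{2,3,\dots\}$ is: $\sum_{j=i+1}^\infty\mu_j\rho_{ji}=\mu_i\rho_i$ for all $i\ge2$, and $\sum_{j=2}^\infty\mu_j\rho_{j1}=1$ (when $L_n$ converges in distribution, (Q)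 has a unique solution). The time reversal of the block-counting process is the càdlàg process $\hat N_n(t)=N_n((T_n-t)-)$ for $0\le t<T_n$ and $\hat N_n(t)=n$ for $t\ge T_n$; in particular $\hat N_n(0)=L_n$. *)

theory Defs
  imports "HOL-Probability.Probability"
begin

definition Lambda_measure :: "real measure \<Rightarrow> bool" where
  "Lambda_measure \<Lambda> \<longleftrightarrow> finite_measure \<Lambda> \<and> sets \<Lambda> = sets borel
     \<and> emeasure \<Lambda> (- {0..1}) = 0 \<and> emeasure \<Lambda> {0..1} > 0"

definition lam :: "real measure \<Rightarrow> nat \<Rightarrow> nat \<Rightarrow> real" where
  "lam \<Lambda> b k = (\<integral>p. p ^ (k - 2) * (1 - p) ^ (b - k) \<partial>\<Lambda>)"

definition rho :: "real measure \<Rightarrow> nat \<Rightarrow> nat \<Rightarrow> real" where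
  "rho \<Lambda> i j = (if 1 \<le> j \<and> j < i then real (i choose (i - j + 1)) * lam \<Lambda> i (i - j + 1) else 0)"

definition rho_tot :: "real measure \<Rightarrow> nat \<Rightarrow> real" where
  "rho_tot \<Lambda> i = (\<Sum>j = 1..<i. rho \<Lambda> i j)"

text \<open>Condition (Q) for a locally finite measure mu on {2,3,...} (mu i = 0 for i < 2).\<close>
definition condQ :: "real measure \<Rightarrow> (nat \<Rightarrow> real) \<Rightarrow> bool" where
  "condQ \<Lambda> \<mu> \<longleftrightarrow> (\<forall>i. 0 \<le> \<mu> i) \<and> (\<forall>i<2. \<mu> i = 0)
     \<and> (\<forall>i\<ge>2. ((\<lambda>j. \<mu> j * rho \<Lambda> j i) has_sum (\<mu> i * rho_tot \<Lambda> i)) {i+1..})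
     \<and> ((\<lambda>j. \<mu> j * rho \<Lambda> j 1) has_sum 1) {2..}"

definition total_rate :: "('s \<Rightarrow> 's \<Rightarrow> real) \<Rightarrow> 's \<Rightarrow> real" where
  "total_rate q y = infsum (\<lambda>y'. q y y') {y'. y' \<noteq> y}"

definition jump_prob :: "('s \<Rightarrow> 's \<Rightarrow> real) \<Rightarrow> 's \<Rightarrow> 's \<Rightarrow> real" where
  "jump_prob q y y' =
     (if total_rate q y = 0 then (if y' = y then 1 else 0)
      else if y' = y then 0 else q y y' / total_rate q y)"

text \<open>(Y, S) is the jump chain / holding time sequence of a Markov jump process with
  rates q (q y y' = rate of jumping from y to y' \<noteq> y) and initial distribution p0:
  the finite-dimensional laws of (Y,S) are the standard ones (an absorbing state has
  infinite holding time).\<close>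
definition mjp_jump_law :: "'a measure \<Rightarrow> ('s \<Rightarrow> 's \<Rightarrow> real) \<Rightarrow> ('s \<Rightarrow> real)
    \<Rightarrow> ('a \<Rightarrow> nat \<Rightarrow> 's) \<Rightarrow> ('a \<Rightarrow> nat \<Rightarrow> ennreal) \<Rightarrow> bool" where
  "mjp_jump_law M q p0 Y S \<longleftrightarrow> prob_space M
     \<and> (\<forall>k. (\<lambda>\<omega>. Y \<omega> k) \<in> measurable M (count_space UNIV))
     \<and> (\<forall>k. (\<lambda>\<omega>. S \<omega> k) \<in> borel_measurable M)
     \<and> (\<forall>m ys ss. (\<forall>k<m. 0 \<le> ss k) \<longrightarrow>
          measure M {\<omega> \<in> space M. (\<forall>k\<le>m. Y \<omega> k = ys k) \<and> (\<forall>k<m. ennreal (ss k) < S \<omega> k)}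
          = p0 (ys 0) * (\<Prod>k<m. jump_prob q (ys k) (ys (Suc k)) * exp (- total_rate q (ys k) * ss k)))"

text \<open>Jump times and the (minimal) path built from jump chain and holding times;
  None after explosion.\<close>
definition jump_time :: "(nat \<Rightarrow> ennreal) \<Rightarrow> nat \<Rightarrow> ennreal" where
  "jump_time S k = (\<Sum>i<k. S i)"

definition jump_path :: "(nat \<Rightarrow> 's) \<Rightarrow> (nat \<Rightarrow> ennreal) \<Rightarrow> real \<Rightarrow> 's option" where
  "jump_path Y S t =
     (if \<exists>k. jump_time S k \<le> ennreal t \<and> ennreal t < jump_time S (Suc k)
      then Some (Y (LEAST k. ennreal t < jump_time S (Suc k))) else None)"

definition coal_rate :: "real measure \<Rightarrow> nat set set \<Rightarrow> nat set set \<Rightarrow> real" where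
  "coal_rate \<Lambda> \<pi> \<pi>' =
     (\<Sum>B \<in> {B. B \<subseteq> \<pi> \<and> 2 \<le> card B \<and> \<pi>' = insert (\<Union>B) (\<pi> - B)}. lam \<Lambda> (card \<pi>) (card B))"

definition coal_init :: "nat \<Rightarrow> nat set set \<Rightarrow> real" where
  "coal_init n \<pi> = (if \<pi> = (\<lambda>i. {i}) ` {1..n} then 1 else 0)"

text \<open>left limit of a path with discrete values\<close>
definition left_lim :: "(real \<Rightarrow> 'b) \<Rightarrow> real \<Rightarrow> 'b" where
  "left_lim f s = (THE c. \<exists>e>0. \<forall>u. s - e < u \<and> u < s \<longrightarrow> f u = c)"

definition coal_N :: "(nat \<Rightarrow> nat set set) \<Rightarrow> (nat \<Rightarrow> ennreal) \<Rightarrow> real \<Rightarrow> nat" where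
  "coal_N Y S t = (case jump_path Y S t of Some \<pi> \<Rightarrow> card \<pi> | None \<Rightarrow> 0)"

definition coal_T :: "(nat \<Rightarrow> nat set set) \<Rightarrow> (nat \<Rightarrow> ennreal) \<Rightarrow> real" where
  "coal_T Y S = Inf {t. 0 \<le> t \<and> coal_N Y S t = 1}"

definition coal_L :: "(nat \<Rightarrow> nat set set) \<Rightarrow> (nat \<Rightarrow> ennreal) \<Rightarrow> nat" where
  "coal_L Y S = left_lim (coal_N Y S) (coal_T Y S)"

definition coal_Nhat :: "nat \<Rightarrow> (nat \<Rightarrow> nat set set) \<Rightarrow> (nat \<Rightarrow> ennreal) \<Rightarrow> real \<Rightarrow> enat" where
  "coal_Nhat n Y S t =
     (if t < coal_T Y S then enat (left_lim (coal_N Y S) (coal_T Y S - t)) else enat n)"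

definition hat_rate :: "real measure \<Rightarrow> (nat \<Rightarrow> real) \<Rightarrow> nat \<Rightarrow> nat \<Rightarrow> real" where
  "hat_rate \<Lambda> \<mu> i j = (if i < j then \<mu> j * rho \<Lambda> j i / \<mu> i else 0)"

definition hat_init :: "real measure \<Rightarrow> (nat \<Rightarrow> real) \<Rightarrow> nat \<Rightarrow> real" where
  "hat_init \<Lambda> \<mu> i = (if 2 \<le> i then \<mu> i * rho \<Lambda> i 1 else 0)"

definition nat_path :: "(nat \<Rightarrow> nat) \<Rightarrow> (nat \<Rightarrow> ennreal) \<Rightarrow> real \<Rightarrow> enat" where
  "nat_path Y S t = (case jump_path Y S t of Some i \<Rightarrow> enat i | None \<Rightarrow> \<infinity>)"

section \<open>Skorohod space over the one-point compactification of N\<close>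

definition phi :: "enat \<Rightarrow> real" where
  "phi x = (case x of enat k \<Rightarrow> 1 / (real k + 1) | \<infinity> \<Rightarrow> 0)"

definition cadlag :: "(real \<Rightarrow> enat) \<Rightarrow> bool" where
  "cadlag x \<longleftrightarrow> (\<forall>t\<ge>0. ((\<lambda>s. phi (x s)) \<longlongrightarrow> phi (x t)) (at_right t))
     \<and> (\<forall>t>0. \<exists>l. ((\<lambda>s. phi (x s)) \<longlongrightarrow> l) (at_left t))"

definition time_changes :: "(real \<Rightarrow> real) set" where
  "time_changes = {l. strict_mono_on {0..} l \<and> continuous_on {0..} l \<and> l ` {0..} = {0..}}"

text \<open>Skorohod (J1) convergence in D([0,\<infinity>), N-bar), Ethier--Kurtz Prop. 3.5.3(c)\<close>
definition skorohod_tendsto :: "(nat \<Rightarrow> real \<Rightarrow> enat) \<Rightarrow> (real \<Rightarrow> enat) \<Rightarrow> bool" where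
  "skorohod_tendsto xs x \<longleftrightarrow> (\<forall>T>0. \<exists>l. (\<forall>n. l n \<in> time_changes) \<and>
     (\<forall>e>0. eventually (\<lambda>n. \<forall>t\<in>{0..T}. \<bar>l n t - t\<bar> \<le> e \<and> \<bar>phi (xs n (l n t)) - phi (x t)\<bar> \<le> e)
        sequentially))"

definition skorohod_continuous :: "((real \<Rightarrow> enat) \<Rightarrow> real) \<Rightarrow> bool" where
  "skorohod_continuous F \<longleftrightarrow> (\<forall>x xs. cadlag x \<and> (\<forall>n. cadlag (xs n)) \<and> skorohod_tendsto xs x
      \<longrightarrow> (\<lambda>n. F (xs n)) \<longlonglongrightarrow> F x)"

definition path_space :: "(real \<Rightarrow> enat) measure" where
  "path_space = Pi\<^sub>M UNIV (\<lambda>_. count_space UNIV)"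

definition conv_dist_skorohod :: "(nat \<Rightarrow> 'a measure) \<Rightarrow> (nat \<Rightarrow> 'a \<Rightarrow> real \<Rightarrow> enat)
    \<Rightarrow> 'b measure \<Rightarrow> ('b \<Rightarrow> real \<Rightarrow> enat) \<Rightarrow> bool" where
  "conv_dist_skorohod Ms Xs M X \<longleftrightarrow>
     (\<forall>F. (\<exists>B. \<forall>x. \<bar>F x\<bar> \<le> B) \<and> F \<in> borel_measurable path_space \<and> skorohod_continuous F
        \<longrightarrow> (\<lambda>n. \<integral>\<omega>. F (Xs n \<omega>) \<partial>(Ms n)) \<longlonglongrightarrow> (\<integral>\<omega>. F (X \<omega>) \<partial>M))"

end

theory Submission
  imports Defs
begin

text \<open>Let \<open>G\<^sub>n(i)\<close> be the expected time that the block-counting process started from \<open>n\<close> spends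
  in \<open>i\<close>. Reversed at its absorption time, this process is again a Markov jump process, with initial
  law \<open>G\<^sub>n(i) \<rho>\<^sub>i\<^sub>1\<close> and rates \<open>G\<^sub>n(j) \<rho>\<^sub>j\<^sub>i / G\<^sub>n(i)\<close>, because the holding times are kept and the
  path weights telescope. In particular the law of \<open>L\<^sub>n\<close> is \<open>G\<^sub>n(i) \<rho>\<^sub>i\<^sub>1\<close>, so convergence of
  \<open>L\<^sub>n\<close> makes \<open>G\<^sub>n\<close> converge pointwise to some \<open>\<mu>\<close> (for Kingman's coalescent, where
  \<open>\<rho>\<^sub>i\<^sub>1 = 0\<close> for \<open>i > 2\<close>, \<open>G\<^sub>n(i) = 1 / \<rho>\<^sub>i\<close> is explicit).

  The block count decreases at a rate proportional to itself, so it spends a bounded expected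
  time on every dyadic scale, uniformly in \<open>n\<close>. This makes the inflow into each \<open>i \<ge> 2\<close> uniformly summable in \<open>n\<close>, and the balance
  equations of \<open>G\<^sub>n\<close> pass to the limit: \<open>\<mu>\<close> solves (Q). Conversely a solution of (Q) is, for every
  \<open>n\<close>, a mixture of \<open>G\<^sub>2, \<dots>, G\<^sub>n\<close> whose weights escape to infinity, hence equals \<open>\<mu>\<close>.

  Finally, the reversed processes are built on one probability space so that any finite number of
  initial jumps and holding times eventually agree with those of the limit. Since all chains increase,
  two paths sharing \<open>m\<close> jumps are uniformly within \<open>1 / (m + 1)\<close> in the one-point compactification,
  and almost sure Skorohod convergence follows.\<close>

section \<open>Rates and Green function of the block-counting process\<close>

locale lambda_coalescent =
  fixes \<Lambda> :: "real measure"
  assumes Lambda: "Lambda_measure \<Lambda>"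
begin

abbreviation "\<rho> \<equiv> rho \<Lambda>"
abbreviation "\<rho>_tot \<equiv> rho_tot \<Lambda>"

sublocale finite_measure \<Lambda>
  using Lambda by (simp add: Lambda_measure_def)

lemma sets_Lambda [measurable_cong, simp]: "sets \<Lambda> = sets borel"
  using Lambda by (simp add: Lambda_measure_def)

lemma space_Lambda [simp]: "space \<Lambda> = UNIV"
  using sets_eq_imp_space_eq[OF sets_Lambda] by simp

lemma AE_unit_interval: "AE p in \<Lambda>. 0 \<le> p \<and> p \<le> 1"
  by (rule AE_I[of _ _ "- {0..1}"]) (use Lambda in \<open>auto simp: Lambda_measure_def\<close>)

definition mass :: real where "mass = measure \<Lambda> UNIV"

lemma mass_pos: "0 < mass"
proof -
  have "0 < emeasure \<Lambda> {0..1}" using Lambda by (simp add: Lambda_measure_def)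
  also have "\<dots> \<le> emeasure \<Lambda> UNIV" by (rule emeasure_mono) auto
  finally show ?thesis by (simp add: mass_def emeasure_eq_measure)
qed

lemma integrable_bernstein [simp]: "integrable \<Lambda> (\<lambda>p. p ^ a * (1 - p) ^ b)"
proof (rule integrable_const_bound[where B = 1])
  show "AE p in \<Lambda>. norm (p ^ a * (1 - p) ^ b) \<le> 1"
    using AE_unit_interval
  proof eventually_elim
    case (elim p)
    then have "p ^ a \<le> 1" "(1 - p) ^ b \<le> 1" by (auto intro: power_le_one)
    with elim show ?case by (auto simp: abs_mult intro: mult_le_one)
  qed
qed simp

lemma lam_nonneg [simp]: "0 \<le> lam \<Lambda> b k"
  unfolding lam_def
  by (rule integral_nonneg_AE) (use AE_unit_interval in eventually_elim, auto)

lemma rho_nonneg [simp]: "0 \<le> \<rho> i j"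
  by (simp add: rho_def)

lemma sum_merger_sizes:
  fixes f :: "nat \<Rightarrow> real"
  shows "(\<Sum>j = 1..<i. f j) = (\<Sum>k = 2..i. f (i + 1 - k))"
  by (rule sum.reindex_bij_witness[of _ "\<lambda>k. i + 1 - k" "\<lambda>j. i + 1 - j"]) auto

lemma sum_lam_pair:
  assumes "2 \<le> i"
  shows "(\<Sum>k = 2..i. real (i - 2 choose (k - 2)) * lam \<Lambda> i k) = mass"
proof -
  have "(\<Sum>k = 2..i. real (i - 2 choose (k - 2)) * lam \<Lambda> i k) =
     (\<integral>p. (\<Sum>k = 2..i. real (i - 2 choose (k - 2)) * (p ^ (k - 2) * (1 - p) ^ (i - k))) \<partial>\<Lambda>)"
    by (subst Bochner_Integration.integral_sum) (auto simp: lam_def)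
  also have "\<dots> = (\<integral>p. 1 \<partial>\<Lambda>)"
  proof (rule Bochner_Integration.integral_cong[OF refl])
    fix p :: real
    have "(\<Sum>k = 2..i. real (i - 2 choose (k - 2)) * (p ^ (k - 2) * (1 - p) ^ (i - k)))
       = (\<Sum>l\<le>i - 2. real (i - 2 choose l) * p ^ l * (1 - p) ^ (i - 2 - l))"
    proof (rule sum.reindex_bij_witness[of _ "\<lambda>l. l + 2" "\<lambda>k. k - 2"])
      fix k assume "k \<in> {2..i}"
      then have "i - 2 - (k - 2) = i - k" by auto
      then show "real (i - 2 choose (k - 2)) * p ^ (k - 2) * (1 - p) ^ (i - 2 - (k - 2))
          = real (i - 2 choose (k - 2)) * (p ^ (k - 2) * (1 - p) ^ (i - k))" by simp
    qed (use assms in auto)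
    also have "\<dots> = (p + (1 - p)) ^ (i - 2)" by (rule binomial_ring[symmetric])
    finally show "(\<Sum>k = 2..i. real (i - 2 choose (k - 2)) * (p ^ (k - 2) * (1 - p) ^ (i - k))) = 1" by simp
  qed
  also have "\<dots> = mass" by (simp add: mass_def)
  finally show ?thesis .
qed

lemma rho_eq: "2 \<le> k \<Longrightarrow> k \<le> i \<Longrightarrow> \<rho> i (i + 1 - k) = real (i choose k) * lam \<Lambda> i k"
  by (auto simp: rho_def)

lemma binomial_pair_absorb:
  assumes "2 \<le> k" "k \<le> i"
  shows "k * (k - 1) * (i choose k) = i * (i - 1) * (i - 2 choose (k - 2))"
proof -
  obtain k' where k': "k = Suc (Suc k')" using assms(1) by (metis add_2_eq_Suc le_Suc_ex)
  obtain i' where i': "i = Suc (Suc i')" using assms by (metis add_2_eq_Suc le_Suc_ex le_trans)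
  have 1: "Suc (Suc k') * (Suc (Suc i') choose Suc (Suc k')) = Suc (Suc i') * (Suc i' choose Suc k')"
    by (rule Suc_times_binomial)
  have 2: "Suc k' * (Suc i' choose Suc k') = Suc i' * (i' choose k')"
    by (rule Suc_times_binomial)
  have "k * (k - 1) * (i choose k) = Suc k' * (Suc (Suc k') * (Suc (Suc i') choose Suc (Suc k')))"
    unfolding k' i' by (simp only: diff_Suc_1 ac_simps)
  also have "\<dots> = Suc (Suc i') * (Suc k' * (Suc i' choose Suc k'))"
    unfolding 1 by (simp only: ac_simps)
  also have "\<dots> = i * (i - 1) * (i - 2 choose (k - 2))"
    unfolding 2 k' i' by (simp add: algebra_simps del: binomial_Suc_Suc)
  finally show ?thesis .
qed

lemma rho_drift:
  assumes "2 \<le> i"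
  shows "mass / 2 * real i \<le> (\<Sum>j = 1..<i. \<rho> i j * (real i - real j))"
proof -
  have "mass / 2 * real i \<le> mass * real (i - 1)"
    using assms mass_pos by (simp add: field_simps of_nat_diff)
  also have "\<dots> = (\<Sum>k = 2..i. real (i - 1) * (real (i - 2 choose (k - 2)) * lam \<Lambda> i k))"
    unfolding sum_lam_pair[OF assms, symmetric] sum_distrib_right by (simp only: mult_ac)
  also have "\<dots> \<le> (\<Sum>k = 2..i. \<rho> i (i + 1 - k) * (real i - real (i + 1 - k)))"
  proof (rule sum_mono)
    fix k assume k: "k \<in> {2..i}"
    have "real k * (real (k - 1) * real (i choose k)) = real i * (real (i - 1) * real (i - 2 choose (k - 2)))"
      using arg_cong[OF binomial_pair_absorb, of k i real] k by (simp add: mult_ac)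
    also have "\<dots> \<ge> real k * (real (i - 1) * real (i - 2 choose (k - 2)))"
      using k by (intro mult_right_mono) auto
    finally have "real (i - 1) * real (i - 2 choose (k - 2)) \<le> real (k - 1) * real (i choose k)"
      using k by simp
    then have "real (i - 1) * real (i - 2 choose (k - 2)) * lam \<Lambda> i k \<le> real (k - 1) * real (i choose k) * lam \<Lambda> i k"
      by (rule mult_right_mono) simp
    moreover have "real i - real (i + 1 - k) = real (k - 1)" using k by (simp add: of_nat_diff)
    ultimately show "real (i - 1) * (real (i - 2 choose (k - 2)) * lam \<Lambda> i k)
        \<le> \<rho> i (i + 1 - k) * (real i - real (i + 1 - k))"
      using k by (simp only: rho_eq atLeastAtMost_iff mult_ac)
  qed
  also have "\<dots> = (\<Sum>j = 1..<i. \<rho> i j * (real i - real j))"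
    by (rule sum_merger_sizes[symmetric])
  finally show ?thesis .
qed

lemma rho_tot_pos:
  assumes "2 \<le> i"
  shows "0 < \<rho>_tot i"
proof -
  have "0 < mass / 2 * real i" using mass_pos assms by simp
  also note rho_drift[OF assms]
  also have "(\<Sum>j = 1..<i. \<rho> i j * (real i - real j)) \<le> (\<Sum>j = 1..<i. \<rho> i j * real i)"
    by (intro sum_mono mult_left_mono) auto
  also have "\<dots> = \<rho>_tot i * real i" by (simp add: rho_tot_def sum_distrib_right)
  finally show ?thesis using assms by (simp add: zero_less_mult_iff)
qed

lemma rho_tot_nonneg [simp]: "0 \<le> \<rho>_tot i"
  by (simp add: rho_tot_def sum_nonneg)

end

text \<open>\<open>green \<Lambda> n i\<close> is the expected time that the block-counting process started from \<open>n\<close>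
  blocks spends in state \<open>i\<close>.\<close>

function green :: "real measure \<Rightarrow> nat \<Rightarrow> nat \<Rightarrow> real" where
  "green \<Lambda> n i = (if i < 2 \<or> n < i then 0
     else ((if i = n then 1 else 0) + (\<Sum>j\<in>{i<..n}. green \<Lambda> n j * rho \<Lambda> j i)) / rho_tot \<Lambda> i)"
  by pat_completeness auto
termination by (relation "Wellfounded.measure (\<lambda>(\<Lambda>, n, i). n - i)") auto

declare green.simps [simp del]

context lambda_coalescent
begin

abbreviation "G \<equiv> green \<Lambda>"

lemma green_eq_0: "i < 2 \<or> n < i \<Longrightarrow> G n i = 0"
  by (subst green.simps) simp

lemma green_balance:
  assumes "2 \<le> i" "i \<le> n"
  shows "G n i * \<rho>_tot i = (if i = n then 1 else 0) + (\<Sum>j\<in>{i<..n}. G n j * \<rho> j i)"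
  using assms rho_tot_pos[of i] by (subst green.simps) auto

lemma green_nonneg [simp]: "0 \<le> G n i"
proof (induction "n - i" arbitrary: i rule: less_induct)
  case less
  have "0 \<le> G n j * \<rho> j i" if "j \<in> {i<..n}" for j
    using that by (intro mult_nonneg_nonneg less) auto
  then show ?case
    by (subst green.simps) (auto intro!: divide_nonneg_nonneg add_nonneg_nonneg sum_nonneg)
qed

lemma green_dynkin:
  assumes "2 \<le> n"
  shows "(\<Sum>i = 2..n. G n i * (\<Sum>j = 1..<i. \<rho> i j * (f i - f j))) = f n - f 1"
proof -
  define h where "h i = f i - f 1" for i :: nat
  have inner: "(\<Sum>j = 1..<i. \<rho> i j * (f i - f j)) =
      \<rho>_tot i * h i - (\<Sum>j = 2..<i. \<rho> i j * h j)" if "2 \<le> i" for i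
  proof -
    have "(\<Sum>j = 1..<i. \<rho> i j * (f i - f j)) = \<rho>_tot i * h i - (\<Sum>j = 1..<i. \<rho> i j * h j)"
      by (simp add: h_def rho_tot_def sum_distrib_right flip: sum_subtractf) (simp add: algebra_simps)
    also have "(\<Sum>j = 1..<i. \<rho> i j * h j) = (\<Sum>j = 2..<i. \<rho> i j * h j)"
      using that by (subst sum.atLeast_Suc_lessThan) (auto simp: h_def numeral_2_eq_2)
    finally show ?thesis .
  qed
  have "(\<Sum>i = 2..n. G n i * (\<Sum>j = 1..<i. \<rho> i j * (f i - f j)))
     = (\<Sum>i = 2..n. G n i * \<rho>_tot i * h i)
       - (\<Sum>i = 2..n. \<Sum>j = 2..<i. G n i * \<rho> i j * h j)"
  proof -
    have "G n i * (\<Sum>j = 1..<i. \<rho> i j * (f i - f j))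
       = G n i * \<rho>_tot i * h i - (\<Sum>j = 2..<i. G n i * \<rho> i j * h j)"
      if "i \<in> {2..n}" for i
      using that by (subst inner) (auto simp: right_diff_distrib sum_distrib_left mult.assoc)
    then show ?thesis by (simp add: sum_subtractf)
  qed
  also have "(\<Sum>i = 2..n. G n i * \<rho>_tot i * h i)
     = (\<Sum>i = 2..n. (if i = n then h n else 0)) + (\<Sum>i = 2..n. \<Sum>j\<in>{i<..n}. G n j * \<rho> j i * h i)"
    unfolding sum.distrib[symmetric]
  proof (rule sum.cong)
    fix i assume "i \<in> {2..n}"
    then have "G n i * \<rho>_tot i * h i
      = ((if i = n then 1 else 0) + (\<Sum>j\<in>{i<..n}. G n j * \<rho> j i)) * h i"
      by (subst green_balance) auto
    then show "G n i * \<rho>_tot i * h i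
      = (if i = n then h n else 0) + (\<Sum>j\<in>{i<..n}. G n j * \<rho> j i * h i)"
      by (simp add: distrib_right sum_distrib_right)
  qed simp
  also have "(\<Sum>i = 2..n. (if i = n then h n else 0)) = h n" using assms by simp
  also have "(\<Sum>i = 2..n. \<Sum>j\<in>{i<..n}. G n j * \<rho> j i * h i)
     = (\<Sum>i = 2..n. \<Sum>j = 2..<i. G n i * \<rho> i j * h j)"
    unfolding sum.Sigma[OF finite_atLeastAtMost, simplified]
    by (subst (1 2) sum.Sigma, simp, simp, simp, simp,
        rule sum.reindex_bij_witness[of _ "\<lambda>(i, j). (j, i)" "\<lambda>(i, j). (j, i)"]) auto
  finally show ?thesis by (simp add: h_def)
qed

lemma green_exit:
  assumes "2 \<le> n"
  shows "(\<Sum>i = 2..n. G n i * \<rho> i 1) = 1"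
proof -
  have "(\<Sum>j = 1..<i. \<rho> i j * ((if i = 1 then 0 else 1) - (if j = 1 then 0 else 1))) = \<rho> i 1"
    if "2 \<le> i" for i
  proof -
    have "(\<Sum>j = 1..<i. \<rho> i j * ((if i = 1 then 0 else 1) - (if j = 1 then 0 else 1)))
        = (\<Sum>j = 1..<i. if j = 1 then \<rho> i j else 0)"
      using that by (intro sum.cong) auto
    also have "\<dots> = \<rho> i 1" using that by simp
    finally show ?thesis .
  qed
  with green_dynkin[OF assms, of "\<lambda>i. if i = 1 then 0 else 1"] assms show ?thesis by simp
qed

lemma green_time_below:
  "(\<Sum>j = 2..y. real j * G n j) \<le> 2 / mass * real y"
proof (cases "2 \<le> n")
  case True
  let ?f = "\<lambda>i. real (min i y)"
  have *: "(if i \<le> y then mass / 2 * real i else 0) \<le> (\<Sum>j = 1..<i. \<rho> i j * (?f i - ?f j))" if "2 \<le> i" for i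
  proof (cases "i \<le> y")
    case True
    have "(\<Sum>j = 1..<i. \<rho> i j * (?f i - ?f j)) = (\<Sum>j = 1..<i. \<rho> i j * (real i - real j))"
      using True by (intro sum.cong) auto
    with True rho_drift[OF that] show ?thesis by simp
  next
    case False
    then show ?thesis by (auto intro!: sum_nonneg mult_nonneg_nonneg)
  qed
  have "mass / 2 * (\<Sum>j = 2..y. real j * G n j) = (\<Sum>j = 2..n + y. G n j * (if j \<le> y then mass / 2 * real j else 0))"
    unfolding sum_distrib_left by (rule sum.mono_neutral_cong_left) auto
  also have "\<dots> = (\<Sum>j = 2..n. G n j * (if j \<le> y then mass / 2 * real j else 0))"
    by (rule sum.mono_neutral_right) (auto simp: green_eq_0)
  also have "\<dots> \<le> (\<Sum>i = 2..n. G n i * (\<Sum>j = 1..<i. \<rho> i j * (?f i - ?f j)))"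
    by (intro sum_mono mult_left_mono *) auto
  also have "\<dots> = ?f n - ?f 1" by (rule green_dynkin[OF True])
  also have "\<dots> \<le> real y" by simp
  finally show ?thesis using mass_pos by (simp add: field_simps)
next
  case False
  then have "G n j = 0" for j by (intro green_eq_0) auto
  then show ?thesis using mass_pos by simp
qed

end

section \<open>Invariant measures as limits of Green functions\<close>

lemma bernstein_le_1:
  fixes q :: real
  assumes "0 \<le> q" "q \<le> 1" "k \<le> N"
  shows "real (N choose k) * q ^ (N - k) * (1 - q) ^ k \<le> 1"
proof -
  have "real (N choose k) * (1 - q) ^ k * q ^ (N - k) \<le> (\<Sum>k\<le>N. real (N choose k) * (1 - q) ^ k * q ^ (N - k))"
    by (rule member_le_sum[where f = "\<lambda>k. real (N choose k) * (1 - q) ^ k * q ^ (N - k)"]) (use assms in auto)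
  also have "\<dots> = ((1 - q) + q) ^ N" by (rule binomial_ring[symmetric])
  finally show ?thesis by (simp add: mult_ac)
qed

lemma binomial_Suc_le:
  assumes "s \<le> N"
  shows "Suc N choose s \<le> Suc s * (N choose s)"
proof -
  have "(Suc N - s) * (Suc N choose s) = Suc N * (N choose s)"
    using binomial_absorb_comp[of "Suc N" s] by simp
  also have "Suc N \<le> Suc s * (Suc N - s)"
  proof -
    obtain d where d: "N = s + d" using assms by (metis le_Suc_ex)
    show ?thesis unfolding d by simp
  qed
  then have "Suc N * (N choose s) \<le> Suc s * (Suc N - s) * (N choose s)" by (rule mult_le_mono1)
  finally have "(Suc N - s) * (Suc N choose s) \<le> (Suc N - s) * (Suc s * (N choose s))" by (simp only: mult_ac)
  then show ?thesis using assms by (subst (asm) mult_le_cancel1) auto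
qed

text \<open>Half of the power of \<open>p = q\<^sup>2\<close> absorbs the polynomial growth of the binomial coefficient.\<close>

lemma merger_kernel_le:
  fixes q :: real
  assumes q: "0 \<le> q" "q \<le> 1" and r: "1 \<le> r" and j: "r + 2 \<le> j"
  shows "real (j choose r) * (q\<^sup>2) ^ (j - r - 2) * (1 - q\<^sup>2) ^ r
    \<le> real (r * r) * 2 ^ r * (real j * (1 - q) * q ^ (j - r - 2))"
proof -
  obtain r' where r': "r = Suc r'" using r by (cases r) auto
  obtain j' where j': "j = Suc (Suc (Suc j'))" "r' \<le> j'"
    using j r' by (auto dest!: le_Suc_ex intro: that)
  have "j choose r \<le> r * (j choose r)" using r by simp
  also have "\<dots> = j * (Suc (Suc j') choose r')"
    unfolding r' j' by (rule Suc_times_binomial)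
  also have "Suc (Suc j') choose r' \<le> Suc r' * (Suc r' * (j' choose r'))"
    using binomial_Suc_le[of r' "Suc j'"] binomial_Suc_le[of r' j'] j'(2)
    by (meson le_SucI le_trans mult_le_mono2)
  finally have "j choose r \<le> r * r * j * (j' choose r')" by (simp add: r' algebra_simps)
  then have c: "real (j choose r) \<le> real (r * r) * real j * real (j' choose r')"
    by (metis of_nat_le_iff of_nat_mult)
  have e: "j - r - 2 = j' - r'" by (simp add: r' j')
  have f: "(1 - q\<^sup>2) ^ r = ((1 - q) ^ r' * (1 - q)) * (1 + q) ^ r"
  proof -
    have "1 - q\<^sup>2 = (1 - q) * (1 + q)" by (simp add: algebra_simps power2_eq_square)
    then have "(1 - q\<^sup>2) ^ r = (1 - q) ^ r * (1 + q) ^ r" by (simp only: power_mult_distrib)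
    then show ?thesis by (simp only: r' power_Suc2)
  qed
  have g: "(1 + q) ^ r \<le> 2 ^ r" using q by (intro power_mono) auto
  have nn: "0 \<le> (q\<^sup>2) ^ (j - r - 2) * (1 - q\<^sup>2) ^ r"
    using q by (simp add: power_le_one)
  have "real (j choose r) * (q\<^sup>2) ^ (j - r - 2) * (1 - q\<^sup>2) ^ r
     \<le> real (r * r) * real j * real (j' choose r') * ((q\<^sup>2) ^ (j - r - 2) * (1 - q\<^sup>2) ^ r)"
    using mult_right_mono[OF c nn] by (simp add: mult_ac)
  also have "\<dots> = (real (j' choose r') * q ^ (j' - r') * (1 - q) ^ r') *
      (real (r * r) * real j * (1 - q) * q ^ (j' - r') * (1 + q) ^ r)"
  proof -
    have "(q\<^sup>2) ^ (j' - r') = q ^ (j' - r') * q ^ (j' - r')"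
      by (simp only: power2_eq_square power_mult_distrib)
    then show ?thesis by (simp only: e f mult_ac)
  qed
  also have "\<dots> \<le> 1 * (real (r * r) * real j * (1 - q) * q ^ (j' - r') * (1 + q) ^ r)"
    using q j' by (intro mult_right_mono bernstein_le_1) auto
  also have "\<dots> \<le> 1 * (real (r * r) * real j * (1 - q) * q ^ (j' - r') * 2 ^ r)"
    using q by (intro mult_left_mono g) auto
  finally show ?thesis by (simp only: e mult_ac mult_1_left)
qed

lemma abel_sum_le:
  fixes a w :: "nat \<Rightarrow> real"
  assumes sums: "\<And>y. (\<Sum>j = 2..y. a j) \<le> B * real y"
    and a: "\<And>j. 0 \<le> a j"
    and w: "\<And>j. J \<le> j \<Longrightarrow> w (Suc j) \<le> w j" "\<And>j. 0 \<le> w j"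
    and J: "2 \<le> J" and n: "J \<le> n"
  shows "(\<Sum>j = J..n. a j * w j) \<le> B * (real J * w J + (\<Sum>j = Suc J..n. w j))"
proof -
  have "(\<Sum>j = J..n. a j * w j) + w n * (B * real n - (\<Sum>j = 2..n. a j))
      \<le> B * (real J * w J + (\<Sum>j = Suc J..n. w j))"
    using n
  proof (induction n rule: nat_induct_at_least)
    case base
    obtain K where K: "J = Suc K" using J by (cases J) auto
    have "(\<Sum>j = 2..J. a j) = (\<Sum>j = 2..K. a j) + a J" using J by (simp add: K)
    moreover have "0 \<le> w J * (\<Sum>j = 2..K. a j)" using w a by (simp add: sum_nonneg)
    ultimately show ?case by (simp add: algebra_simps)
  next
    case (Suc n)
    have "(\<Sum>j = J..Suc n. a j * w j) + w (Suc n) * (B * real (Suc n) - (\<Sum>j = 2..Suc n. a j))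
       = (\<Sum>j = J..n. a j * w j) + w (Suc n) * B + w (Suc n) * (B * real n - (\<Sum>j = 2..n. a j))"
      using Suc.hyps J by (simp add: algebra_simps)
    also have "\<dots> \<le> (\<Sum>j = J..n. a j * w j) + w (Suc n) * B + w n * (B * real n - (\<Sum>j = 2..n. a j))"
      using sums[of n] w(1)[OF Suc.hyps] by (intro add_left_mono mult_right_mono) auto
    also have "\<dots> \<le> w (Suc n) * B + B * (real J * w J + (\<Sum>j = Suc J..n. w j))"
      using Suc.IH by simp
    also have "\<dots> = B * (real J * w J + (\<Sum>j = Suc J..Suc n. w j))"
      using Suc.hyps by (simp add: algebra_simps)
    finally show ?case .
  qed
  moreover have "0 \<le> w n * (B * real n - (\<Sum>j = 2..n. a j))" using sums[of n] w by simp
  ultimately show ?thesis by simp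
qed

lemma geometric_tail_le:
  fixes q :: real
  assumes "0 \<le> q" "q \<le> 1"
  shows "(1 - q) * (\<Sum>j = Suc (s + N)..n. q ^ (j - s)) \<le> q ^ N"
proof (cases "s + N \<le> n")
  case True
  have "(1 - q) * (\<Sum>j = Suc (s + N)..n. q ^ (j - s)) = q ^ Suc N - q ^ (Suc n - s)"
    using True
  proof (induction n rule: nat_induct_at_least)
    case (Suc n)
    have "(1 - q) * (\<Sum>j = Suc (s + N)..Suc n. q ^ (j - s))
        = (1 - q) * (\<Sum>j = Suc (s + N)..n. q ^ (j - s)) + (1 - q) * q ^ (Suc n - s)"
      using Suc.hyps by (simp add: distrib_left)
    also have "\<dots> = q ^ Suc N - q ^ (Suc n - s) + (1 - q) * q ^ (Suc n - s)" by (simp only: Suc.IH)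
    also have "\<dots> = q ^ Suc N - q ^ Suc (Suc n - s)" by (simp add: algebra_simps)
    also have "Suc (Suc n - s) = Suc (Suc n) - s" using Suc.hyps by simp
    finally show ?case .
  qed (simp add: Suc_diff_le)
  also have "\<dots> \<le> q ^ Suc N" using assms by simp
  also have "\<dots> \<le> q ^ N" using assms by (intro power_decreasing) auto
  finally show ?thesis .
qed (use assms in auto)

lemma has_sum_nonnegI:
  fixes f :: "nat \<Rightarrow> real"
  assumes f: "\<And>j. 0 \<le> f j" and le: "\<And>N. (\<Sum>j = a..N. f j) \<le> S"
    and approx: "\<And>e. 0 < e \<Longrightarrow> \<exists>N. S - e \<le> (\<Sum>j = a..N. f j)"
  shows "(f has_sum S) {a..}"
proof -
  define g where "g j = (if a \<le> j then f j else 0)" for j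
  have part: "(\<Sum>j<N. g j) = (\<Sum>j\<in>{a..<N}. f j)" for N
    by (rule sum.mono_neutral_cong_right) (auto simp: g_def)
  have "g sums S"
    unfolding sums_def
  proof (rule LIMSEQ_I)
    fix e :: real assume e: "0 < e"
    then obtain N where N: "S - e / 2 \<le> (\<Sum>j = a..N. f j)" using approx[of "e / 2"] by auto
    show "\<exists>no. \<forall>n\<ge>no. norm ((\<Sum>j<n. g j) - S) < e"
    proof (intro exI allI impI)
      fix n assume n: "Suc N \<le> n"
      have "(\<Sum>j = a..N. f j) \<le> (\<Sum>j\<in>{a..<n}. f j)"
        using n f by (intro sum_mono2) auto
      moreover have "(\<Sum>j\<in>{a..<n}. f j) \<le> S" using le[of "n - 1"] n
        by (cases n) (auto simp: atLeastLessThanSuc_atLeastAtMost)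
      ultimately show "norm ((\<Sum>j<n. g j) - S) < e" using N e by (simp add: part)
    qed
  qed
  then have "(g has_sum S) UNIV"
    by (intro sums_nonneg_imp_has_sum) (auto simp: g_def f)
  then show ?thesis
    by (subst (asm) has_sum_cong_neutral[where T = "{a..}" and g = f]) (auto simp: g_def)
qed

lemma has_sum_nat_LIMSEQ:
  fixes f :: "nat \<Rightarrow> real"
  assumes "(f has_sum S) {a..}"
  shows "(\<lambda>n. \<Sum>j = a..n. f j) \<longlonglongrightarrow> S"
proof -
  define g where "g j = (if a \<le> j then f j else 0)" for j
  have "(g has_sum S) UNIV"
    using assms by (subst has_sum_cong_neutral[where T = "{a..}" and g = f]) (auto simp: g_def)
  then have "g sums S" by (rule has_sum_imp_sums)
  then have "(\<lambda>n. \<Sum>j<Suc n. g j) \<longlonglongrightarrow> S" unfolding sums_def by (rule LIMSEQ_Suc)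
  moreover have "(\<Sum>j<Suc n. g j) = (\<Sum>j = a..n. f j)" for n
    by (rule sum.mono_neutral_cong_right) (auto simp: g_def)
  ultimately show ?thesis by simp
qed

lemma toeplitz_average:
  fixes e :: "nat \<Rightarrow> nat \<Rightarrow> real" and g :: "nat \<Rightarrow> real"
  assumes e: "\<And>n m. m \<in> {a..n} \<Longrightarrow> 0 \<le> e n m" "\<And>m. a \<le> m \<Longrightarrow> (\<lambda>n. e n m) \<longlonglongrightarrow> 0"
      "(\<lambda>n. \<Sum>m = a..n. e n m) \<longlonglongrightarrow> 1"
    and g: "g \<longlonglongrightarrow> \<gamma>"
  shows "(\<lambda>n. \<Sum>m = a..n. e n m * g m) \<longlonglongrightarrow> \<gamma>"
proof -
  have "(\<lambda>n. \<Sum>m = a..n. e n m * (g m - \<gamma>)) \<longlonglongrightarrow> 0"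
  proof (rule LIMSEQ_I)
    fix r :: real assume r: "0 < r"
    obtain K where K: "\<And>m. K \<le> m \<Longrightarrow> \<bar>g m - \<gamma>\<bar> < r / 4"
      using LIMSEQ_D[OF g, of "r / 4"] r by auto
    have "(\<lambda>n. \<Sum>m\<in>{a..<K}. e n m * \<bar>g m - \<gamma>\<bar>) \<longlonglongrightarrow> (\<Sum>m\<in>{a..<K}. 0 * \<bar>g m - \<gamma>\<bar>)"
      by (intro tendsto_intros e(2)) auto
    then have "eventually (\<lambda>n. (\<Sum>m\<in>{a..<K}. e n m * \<bar>g m - \<gamma>\<bar>) < r / 4) sequentially"
      using r by (intro order_tendstoD) auto
    moreover have "eventually (\<lambda>n. (\<Sum>m = a..n. e n m) < 2) sequentially"
      using e(3) by (rule order_tendstoD) auto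
    ultimately have "eventually (\<lambda>n. norm ((\<Sum>m = a..n. e n m * (g m - \<gamma>)) - 0) < r) sequentially"
      using eventually_ge_at_top[of K]
    proof eventually_elim
      case (elim n)
      have "\<bar>\<Sum>m = a..n. e n m * (g m - \<gamma>)\<bar> \<le> (\<Sum>m = a..n. e n m * \<bar>g m - \<gamma>\<bar>)"
        by (rule order_trans[OF sum_abs]) (auto intro!: sum_mono simp: abs_mult e(1))
      also have "\<dots> \<le> (\<Sum>m = a..n. (if m \<in> {a..<K} then e n m * \<bar>g m - \<gamma>\<bar> else 0) + e n m * (r / 4))"
      proof (rule sum_mono)
        fix m assume m: "m \<in> {a..n}"
        show "e n m * \<bar>g m - \<gamma>\<bar> \<le> (if m \<in> {a..<K} then e n m * \<bar>g m - \<gamma>\<bar> else 0) + e n m * (r / 4)"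
          using m e(1)[OF m] K[of m] r by (cases "m < K") (auto intro!: mult_left_mono simp del: times_divide_eq_right)
      qed
      also have "\<dots> = (\<Sum>m\<in>{a..<K}. e n m * \<bar>g m - \<gamma>\<bar>) + (\<Sum>m = a..n. e n m) * (r / 4)"
      proof -
        have "(\<Sum>m = a..n. (if m \<in> {a..<K} then e n m * \<bar>g m - \<gamma>\<bar> else 0)) = (\<Sum>m\<in>{a..<K}. e n m * \<bar>g m - \<gamma>\<bar>)"
          using elim by (intro sum.mono_neutral_cong_right) auto
        then show ?thesis by (simp add: sum.distrib sum_distrib_right)
      qed
      also have "\<dots> < r / 4 + 2 * (r / 4)"
        using elim r by (intro add_strict_mono mult_strict_right_mono) auto
      finally show ?case using r by simp
    qed
    then show "\<exists>no. \<forall>n\<ge>no. norm ((\<Sum>m = a..n. e n m * (g m - \<gamma>)) - 0) < r"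
      by (simp add: eventually_sequentially)
  qed
  then have "(\<lambda>n. (\<Sum>m = a..n. e n m * (g m - \<gamma>)) + (\<Sum>m = a..n. e n m) * \<gamma>) \<longlonglongrightarrow> 0 + 1 * \<gamma>"
    by (intro tendsto_add tendsto_mult e(3) tendsto_const)
  then show ?thesis by (simp add: right_diff_distrib sum_subtractf sum_distrib_right)
qed

context lambda_coalescent
begin

lemma rho_integral:
  assumes "1 \<le> i" "i < j"
  shows "\<rho> j i = (\<integral>p. real (j choose (i - 1)) * p ^ (j - (i - 1) - 2) * (1 - p) ^ (i - 1) \<partial>\<Lambda>)"
proof -
  have a: "j choose (j - i + 1) = j choose (i - 1)"
    using assms binomial_symmetric[of "i - 1" j] by (simp add: Suc_diff_le)
  have b: "j - i + 1 - 2 = j - (i - 1) - 2" "j - (j - i + 1) = i - 1"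
    using assms by auto
  have "\<rho> j i = real (j choose (i - 1)) * (\<integral>p. p ^ (j - (i - 1) - 2) * (1 - p) ^ (i - 1) \<partial>\<Lambda>)"
    unfolding rho_def lam_def a b using assms by simp
  then show ?thesis by (simp add: mult.assoc)
qed

lemma green_kernel_le:
  assumes i: "2 \<le> i" and p: "0 \<le> p" "p \<le> 1"
  shows "(\<Sum>j = i + 1 + N..n. G n j * (real (j choose (i - 1)) * p ^ (j - (i - 1) - 2) * (1 - p) ^ (i - 1)))
    \<le> real ((i - 1) * (i - 1)) * 2 ^ (i - 1) * (2 / mass) *
        ((real (i + 1 + N) * (1 - sqrt p) * sqrt p ^ N + sqrt p ^ N) * indicator {..<1} p)"
    (is "?lhs \<le> ?K * (2 / mass) * _")
proof (cases "p < 1 \<and> i + 1 + N \<le> n")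
  case True
  define q where "q = sqrt p"
  have q: "0 \<le> q" "q \<le> 1" "p = q\<^sup>2" using p by (auto simp: q_def)
  have "?lhs \<le> (\<Sum>j = i + 1 + N..n. G n j * (?K * (real j * (1 - q) * q ^ (j - (i - 1) - 2))))"
    unfolding q(3) by (intro sum_mono mult_left_mono merger_kernel_le) (use i q in auto)
  also have "\<dots> = ?K * (1 - q) * (\<Sum>j = i + 1 + N..n. real j * G n j * q ^ (j - (i + 1)))"
    unfolding sum_distrib_left
  proof (rule sum.cong)
    fix j
    have "j - (i - 1) - 2 = j - (i + 1)" using i by simp
    then show "G n j * (?K * (real j * (1 - q) * q ^ (j - (i - 1) - 2)))
      = ?K * (1 - q) * (real j * G n j * q ^ (j - (i + 1)))" by (simp only: mult_ac)
  qed simp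
  also have "\<dots> \<le> ?K * (1 - q) * (2 / mass * (real (i + 1 + N) * q ^ (i + 1 + N - (i + 1))
      + (\<Sum>j = Suc (i + 1 + N)..n. q ^ (j - (i + 1)))))"
  proof (intro mult_left_mono abel_sum_le)
    show "\<And>y. (\<Sum>j = 2..y. real j * G n j) \<le> 2 / mass * real y" by (rule green_time_below)
    show "0 \<le> ?K * (1 - q)" using q by simp
    show "q ^ (Suc j - (i + 1)) \<le> q ^ (j - (i + 1))" for j
      using q by (intro power_decreasing) auto
  qed (use True q i in auto)
  also have "\<dots> = ?K * (2 / mass) * (real (i + 1 + N) * (1 - q) * q ^ N
      + (1 - q) * (\<Sum>j = Suc (i + 1 + N)..n. q ^ (j - (i + 1))))"
    by (simp only: distrib_left mult_ac diff_add_inverse)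
  also have "\<dots> \<le> ?K * (2 / mass) * (real (i + 1 + N) * (1 - q) * q ^ N + q ^ N)"
    using mass_pos q by (intro mult_left_mono add_left_mono geometric_tail_le) auto
  finally show ?thesis using True by (simp add: q_def)
next
  case False
  then show ?thesis
  proof (cases "p < 1")
    case True
    with False have "{i + 1 + N..n} = {}" by auto
    moreover have "0 \<le> (real (i + 1 + N) * (1 - sqrt p) * sqrt p ^ N + sqrt p ^ N) * indicator {..<1} p"
      using p by (intro mult_nonneg_nonneg add_nonneg_nonneg) auto
    ultimately show ?thesis using mass_pos p by (auto intro!: mult_nonneg_nonneg)
  next
    case False
    with p have "p = 1" by simp
    then show ?thesis using i by (simp add: zero_power)
  qed
qed

text \<open>Jumps into a fixed state \<open>i \<ge> 2\<close> come from bounded states, uniformly in the starting state: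
  mergers that skip exactly \<open>i - 1\<close> blocks need \<open>1 - p\<close> of the order of the inverse of the current
  number of blocks, and at such a scale only a bounded expected time is spent.\<close>

lemma green_inflow_tail:
  assumes i: "2 \<le> i" and e: "0 < e"
  shows "\<exists>J>i. \<forall>n. (\<Sum>j = J..n. G n j * \<rho> j i) \<le> e"
proof -
  define K where "K = real ((i - 1) * (i - 1)) * 2 ^ (i - 1) * (2 / mass)"
  define b where "b N p = K * ((real (i + 1 + N) * (1 - sqrt p) * sqrt p ^ N + sqrt p ^ N) * indicator {..<1} p)"
    for N and p :: real
  have K: "0 \<le> K" using mass_pos by (simp add: K_def)
  have b_meas [measurable]: "b N \<in> borel_measurable borel" for N
    unfolding b_def by measurable
  have b_bound: "AE p in \<Lambda>. norm (b N p) \<le> K * (real (i + 1) + 2)" for N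
    using AE_unit_interval
  proof eventually_elim
    case (elim p)
    define q where "q = sqrt p"
    have q: "0 \<le> q" "q \<le> 1" using elim by (auto simp: q_def)
    have "real (Suc N choose 1) * q ^ (Suc N - 1) * (1 - q) ^ 1 \<le> 1"
      by (rule bernstein_le_1) (use q in auto)
    moreover have "real N * (1 - q) * q ^ N \<le> real (Suc N) * (1 - q) * q ^ N"
      using q by (intro mult_right_mono) auto
    ultimately have 1: "real N * (1 - q) * q ^ N \<le> 1" by (simp add: mult_ac)
    have 2: "q ^ N \<le> 1" using q by (simp add: power_le_one)
    have 3: "real (i + 1) * ((1 - q) * q ^ N) \<le> real (i + 1) * 1"
      using q 2 by (intro mult_left_mono mult_le_one) auto
    have "real (i + 1 + N) * (1 - q) * q ^ N + q ^ N \<le> real (i + 1) + 2"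
      using 1 2 3 by (simp add: algebra_simps)
    moreover have "0 \<le> real (i + 1 + N) * (1 - q) * q ^ N + q ^ N" using q by auto
    ultimately show ?case
      using K by (auto simp: b_def q_def[symmetric] abs_mult indicator_def intro!: mult_left_mono)
  qed
  have b_lim: "AE p in \<Lambda>. (\<lambda>N. b N p) \<longlonglongrightarrow> 0"
    using AE_unit_interval
  proof eventually_elim
    case (elim p)
    show ?case
    proof (cases "p < 1")
      case True
      define q where "q = sqrt p"
      have q: "0 \<le> q" "q < 1" using elim True by (auto simp: q_def)
      have l1: "(\<lambda>N. q ^ N) \<longlonglongrightarrow> 0" using q by (intro LIMSEQ_realpow_zero) auto
      have l2: "(\<lambda>N. real N * q ^ N) \<longlonglongrightarrow> 0" using q by (intro powser_times_n_limit_0) auto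
      have "(\<lambda>N. K * ((1 - q) * (real (i + 1) * q ^ N) + (1 - q) * (real N * q ^ N) + q ^ N))
          \<longlonglongrightarrow> K * ((1 - q) * (real (i + 1) * 0) + (1 - q) * 0 + 0)"
        by (intro tendsto_intros l1 l2)
      then show ?thesis using True by (simp add: b_def q_def[symmetric] algebra_simps)
    qed (simp add: b_def)
  qed
  have "(\<lambda>N. integral\<^sup>L \<Lambda> (b N)) \<longlonglongrightarrow> integral\<^sup>L \<Lambda> (\<lambda>_. 0)"
    by (rule integral_dominated_convergence[where w = "\<lambda>_. K * (real (i + 1) + 2)"])
       (use b_lim b_bound in auto)
  then have "eventually (\<lambda>N. integral\<^sup>L \<Lambda> (b N) < e) sequentially"
    using e by (intro order_tendstoD) auto
  then obtain N where N: "integral\<^sup>L \<Lambda> (b N) < e" by (auto simp: eventually_sequentially)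
  have int_b: "integrable \<Lambda> (b N)"
    by (rule integrable_const_bound[OF b_bound]) simp
  have "(\<Sum>j = i + 1 + N..n. G n j * \<rho> j i) \<le> e" for n
  proof -
    let ?k = "\<lambda>j p. real (j choose (i - 1)) * p ^ (j - (i - 1) - 2) * (1 - p) ^ (i - 1)"
    have ik: "integrable \<Lambda> (?k j)" for j by (simp add: mult.assoc)
    have "(\<Sum>j = i + 1 + N..n. G n j * \<rho> j i)
        = (\<integral>p. (\<Sum>j = i + 1 + N..n. G n j * ?k j p) \<partial>\<Lambda>)"
      using i ik by (subst Bochner_Integration.integral_sum) (auto simp: rho_integral)
    also have "\<dots> \<le> integral\<^sup>L \<Lambda> (b N)"
    proof (rule integral_mono_AE)
      show "AE p in \<Lambda>. (\<Sum>j = i + 1 + N..n. G n j * ?k j p) \<le> b N p"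
        using AE_unit_interval
        by eventually_elim (unfold b_def K_def, rule green_kernel_le, use i in auto)
    qed (use ik int_b in auto)
    finally show ?thesis using N by simp
  qed
  then show ?thesis by (intro exI[of _ "i + 1 + N"]) auto
qed

lemma limit_balance:
  assumes lim: "\<And>i. (\<lambda>n. G n i) \<longlonglongrightarrow> \<mu> i" and i: "2 \<le> i"
  shows "((\<lambda>j. \<mu> j * \<rho> j i) has_sum (\<mu> i * \<rho>_tot i)) {i + 1..}"
proof (rule has_sum_nonnegI)
  have nn: "0 \<le> \<mu> j" for j by (rule LIMSEQ_le_const[OF lim]) auto
  then show "0 \<le> \<mu> j * \<rho> j i" for j by simp
  have split: "{i<..n} = {i + 1..n}" for n by auto
  show "(\<Sum>j = i + 1..N. \<mu> j * \<rho> j i) \<le> \<mu> i * \<rho>_tot i" for N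
  proof (rule LIMSEQ_le)
    show "(\<lambda>n. \<Sum>j = i + 1..N. G n j * \<rho> j i) \<longlonglongrightarrow> (\<Sum>j = i + 1..N. \<mu> j * \<rho> j i)"
      by (intro tendsto_intros lim)
    show "(\<lambda>n. G n i * \<rho>_tot i) \<longlonglongrightarrow> \<mu> i * \<rho>_tot i"
      by (intro tendsto_intros lim)
    show "\<exists>n0. \<forall>n\<ge>n0. (\<Sum>j = i + 1..N. G n j * \<rho> j i) \<le> G n i * \<rho>_tot i"
    proof (intro exI allI impI)
      fix n assume n: "i + N \<le> n"
      have "(\<Sum>j = i + 1..N. G n j * \<rho> j i) \<le> (\<Sum>j = i + 1..n. G n j * \<rho> j i)"
        using n by (intro sum_mono2) auto
      also have "\<dots> \<le> G n i * \<rho>_tot i" using i n by (subst green_balance) (auto simp: split)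
      finally show "(\<Sum>j = i + 1..N. G n j * \<rho> j i) \<le> G n i * \<rho>_tot i" .
    qed
  qed
  show "\<exists>N. \<mu> i * \<rho>_tot i - e \<le> (\<Sum>j = i + 1..N. \<mu> j * \<rho> j i)" if e: "0 < e" for e
  proof -
    obtain J where J: "i < J" "\<And>n. (\<Sum>j = J..n. G n j * \<rho> j i) \<le> e"
      using green_inflow_tail[OF i e] by auto
    have "\<mu> i * \<rho>_tot i - e \<le> (\<Sum>j = i + 1..J. \<mu> j * \<rho> j i)"
    proof (rule LIMSEQ_le)
      show "(\<lambda>n. G n i * \<rho>_tot i - e) \<longlonglongrightarrow> \<mu> i * \<rho>_tot i - e"
        by (intro tendsto_intros lim)
      show "(\<lambda>n. \<Sum>j = i + 1..J. G n j * \<rho> j i) \<longlonglongrightarrow> (\<Sum>j = i + 1..J. \<mu> j * \<rho> j i)"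
        by (intro tendsto_intros lim)
      show "\<exists>n0. \<forall>n\<ge>n0. G n i * \<rho>_tot i - e \<le> (\<Sum>j = i + 1..J. G n j * \<rho> j i)"
      proof (intro exI allI impI)
        fix n assume n: "i + J + 1 \<le> n"
        have "G n i * \<rho>_tot i = (\<Sum>j = i + 1..n. G n j * \<rho> j i)"
          using i n by (subst green_balance) (auto simp: split)
        also have "\<dots> \<le> (\<Sum>j\<in>{i + 1..J} \<union> {J..n}. G n j * \<rho> j i)"
          by (intro sum_mono2) auto
        also have "\<dots> \<le> (\<Sum>j = i + 1..J. G n j * \<rho> j i) + (\<Sum>j = J..n. G n j * \<rho> j i)"
          by (subst sum_Un) (auto intro!: sum_nonneg)
        finally show "G n i * \<rho>_tot i - e \<le> (\<Sum>j = i + 1..J. G n j * \<rho> j i)"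
          using J(2)[of n] by simp
      qed
    qed
    then show ?thesis by blast
  qed
qed

lemma condQ_eq_limit:
  assumes lim: "\<And>i. (\<lambda>n. G n i) \<longlonglongrightarrow> \<mu> i" and Q: "condQ \<Lambda> \<nu>"
  shows "\<nu> = \<mu>"
proof
  fix i
  show "\<nu> i = \<mu> i"
  proof (cases "2 \<le> i")
    case False
    then have "\<mu> i = 0" by (intro LIMSEQ_unique[OF lim]) (simp add: green_eq_0)
    then show ?thesis using False Q by (simp add: condQ_def)
  next
    case True
    have Q0: "0 \<le> \<nu> j" for j using Q by (simp add: condQ_def)
    have Q1: "(\<lambda>n. \<Sum>j = m + 1..n. \<nu> j * \<rho> j m) \<longlonglongrightarrow> \<nu> m * \<rho>_tot m" if "2 \<le> m" for m
      using Q that by (intro has_sum_nat_LIMSEQ) (simp add: condQ_def)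
    have Q2: "(\<lambda>n. \<Sum>j = 2..n. \<nu> j * \<rho> j 1) \<longlonglongrightarrow> 1"
      using Q by (intro has_sum_nat_LIMSEQ) (simp add: condQ_def)
    \<comment> \<open>the rate at which the stationary flow enters \<open>{2..n}\<close> from above at \<open>m\<close>\<close>
    define e where "e n m = \<nu> m * \<rho>_tot m - (\<Sum>j\<in>{m<..n}. \<nu> j * \<rho> j m)" for n m
    have split: "{m<..n} = {m + 1..n}" for m n :: nat by auto
    have e_nn: "0 \<le> e n m" if "2 \<le> m" for n m
    proof -
      have "(\<Sum>j = m + 1..n. \<nu> j * \<rho> j m) \<le> \<nu> m * \<rho>_tot m"
        by (rule incseq_le[OF _ Q1[OF that]]) (auto intro!: incseq_SucI simp: Q0)
      then show ?thesis by (simp add: e_def split)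
    qed
    have e_lim: "(\<lambda>n. e n m) \<longlonglongrightarrow> 0" if "2 \<le> m" for m
    proof -
      have "(\<lambda>n. e n m) \<longlonglongrightarrow> \<nu> m * \<rho>_tot m - \<nu> m * \<rho>_tot m"
        unfolding e_def split by (intro tendsto_intros Q1 that)
      then show ?thesis by simp
    qed
    have e_mass: "(\<Sum>m = 2..n. e n m) = (\<Sum>j = 2..n. \<nu> j * \<rho> j 1)" for n
    proof -
      have "(\<Sum>m = 2..n. \<Sum>j\<in>{m<..n}. \<nu> j * \<rho> j m) = (\<Sum>j = 2..n. \<Sum>m = 2..<j. \<nu> j * \<rho> j m)"
        by (subst (1 2) sum.Sigma, simp, simp, simp, simp,
            rule sum.reindex_bij_witness[of _ "\<lambda>(i, j). (j, i)" "\<lambda>(i, j). (j, i)"]) auto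
      moreover have "\<nu> j * \<rho>_tot j = \<nu> j * \<rho> j 1 + (\<Sum>m = 2..<j. \<nu> j * \<rho> j m)" if "2 \<le> j" for j
        using that unfolding rho_tot_def
        by (subst sum.atLeast_Suc_lessThan) (auto simp: distrib_left sum_distrib_left numeral_2_eq_2)
      ultimately show ?thesis by (simp add: e_def sum_subtractf sum.distrib)
    qed
    have repr: "\<nu> k = (\<Sum>m = 2..n. e n m * G m k)" if "2 \<le> k" "k \<le> n" for k n
      using that
    proof (induction "n - k" arbitrary: k rule: less_induct)
      case less
      have "\<nu> k * \<rho>_tot k = e n k + (\<Sum>j\<in>{k<..n}. \<nu> j * \<rho> j k)" by (simp add: e_def)
      also have "(\<Sum>j\<in>{k<..n}. \<nu> j * \<rho> j k) = (\<Sum>j\<in>{k<..n}. \<Sum>m = 2..n. e n m * G m j * \<rho> j k)"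
        using less by (intro sum.cong) (auto simp: sum_distrib_right)
      also have "\<dots> = (\<Sum>m = 2..n. \<Sum>j\<in>{k<..n}. e n m * G m j * \<rho> j k)" by (rule sum.swap)
      also have "e n k = (\<Sum>m = 2..n. e n m * (if k = m then 1 else 0))"
        using less.prems by (simp add: if_distrib cong: if_cong)
      also have "(\<Sum>m = 2..n. e n m * (if k = m then 1 else 0)) + (\<Sum>m = 2..n. \<Sum>j\<in>{k<..n}. e n m * G m j * \<rho> j k)
          = (\<Sum>m = 2..n. e n m * ((if k = m then 1 else 0) + (\<Sum>j\<in>{k<..n}. G m j * \<rho> j k)))"
        by (simp add: distrib_left sum.distrib sum_distrib_left mult.assoc)
      also have "\<dots> = (\<Sum>m = 2..n. e n m * (G m k * \<rho>_tot k))"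
      proof (intro sum.cong refl arg_cong2[of _ _ _ _ "(*)"])
        fix m assume m: "m \<in> {2..n}"
        have eq: "(\<Sum>j\<in>{k<..n}. G m j * \<rho> j k) = (\<Sum>j\<in>{k<..m}. G m j * \<rho> j k)"
          using m by (intro sum.mono_neutral_right) (auto simp: green_eq_0)
        show "(if k = m then 1 else 0) + (\<Sum>j\<in>{k<..n}. G m j * \<rho> j k) = G m k * \<rho>_tot k"
        proof (cases "k \<le> m")
          case True
          then show ?thesis using less.prems by (simp add: eq green_balance)
        next
          case False
          then show ?thesis by (simp add: eq green_eq_0)
        qed
      qed
      finally have "\<nu> k * \<rho>_tot k = (\<Sum>m = 2..n. e n m * G m k) * \<rho>_tot k"
        by (simp add: sum_distrib_right mult.assoc)
      then show ?case using rho_tot_pos[OF less.prems(1)] by simp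
    qed
    have "(\<lambda>n. \<Sum>m = 2..n. e n m * G m i) \<longlonglongrightarrow> \<mu> i"
      by (rule toeplitz_average) (use e_nn e_lim Q2 lim in \<open>auto simp: e_mass\<close>)
    moreover have "eventually (\<lambda>n. (\<Sum>m = 2..n. e n m * G m i) = \<nu> i) sequentially"
      using eventually_ge_at_top[of i] by eventually_elim (use repr True in auto)
    then have "(\<lambda>n. \<Sum>m = 2..n. e n m * G m i) \<longlonglongrightarrow> \<nu> i"
      by (rule tendsto_eventually)
    ultimately show ?thesis by (rule LIMSEQ_unique[symmetric])
  qed
qed

lemma condQ_limit:
  assumes lim: "\<And>i. (\<lambda>n. G n i) \<longlonglongrightarrow> \<mu> i"
    and exit_lim: "\<And>i. 2 \<le> i \<Longrightarrow> (\<lambda>n. \<Sum>j = 2..i. G n j * \<rho> j 1) \<longlonglongrightarrow> f i"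
    and f: "f \<longlonglongrightarrow> 1"
  shows "condQ \<Lambda> \<mu>"
  unfolding condQ_def
proof (intro conjI allI impI)
  show nn: "0 \<le> \<mu> i" for i by (rule LIMSEQ_le_const[OF lim]) auto
  show "\<mu> i = 0" if "i < 2" for i
    using that by (intro LIMSEQ_unique[OF lim]) (simp add: green_eq_0)
  show "((\<lambda>j. \<mu> j * \<rho> j i) has_sum (\<mu> i * \<rho>_tot i)) {i + 1..}" if "2 \<le> i" for i
    by (rule limit_balance[OF lim that])
  have f_eq: "f i = (\<Sum>j = 2..i. \<mu> j * \<rho> j 1)" if "2 \<le> i" for i
    by (rule LIMSEQ_unique[OF exit_lim[OF that]]) (intro tendsto_intros lim)
  have lim1: "(\<lambda>i. \<Sum>j = 2..i. \<mu> j * \<rho> j 1) \<longlonglongrightarrow> 1"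
    by (rule Lim_transform_eventually[OF f])
       (use eventually_ge_at_top[of 2] in eventually_elim, rule f_eq)
  show "((\<lambda>j. \<mu> j * \<rho> j 1) has_sum 1) {2..}"
  proof (rule has_sum_nonnegI)
    show "(\<Sum>j = 2..N. \<mu> j * \<rho> j 1) \<le> 1" for N
      by (rule incseq_le[OF _ lim1]) (auto intro!: incseq_SucI simp: nn)
    show "\<exists>N. 1 - e \<le> (\<Sum>j = 2..N. \<mu> j * \<rho> j 1)" if "0 < e" for e
      using order_tendstoD(1)[OF lim1, of "1 - e"] that
      by (auto simp: eventually_sequentially intro: less_imp_le)
  qed (simp add: nn)
qed

lemma green_kingman:
  assumes zero: "AE p in \<Lambda>. p = 0" and i: "2 \<le> i" "i \<le> n"
  shows "G n i * \<rho>_tot i = 1"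
proof -
  have lam0: "lam \<Lambda> b k = 0" if "2 < k" for b k
  proof -
    have "lam \<Lambda> b k = (\<integral>p. 0 \<partial>\<Lambda>)"
      unfolding lam_def
      by (rule integral_cong_AE) (use zero that in \<open>auto simp: zero_power elim!: eventually_mono\<close>)
    then show ?thesis by simp
  qed
  have rho0: "\<rho> j i = 0" if "Suc i < j" for i j
    using that by (auto simp: rho_def intro!: lam0)
  show ?thesis using i
  proof (induction "n - i" arbitrary: i rule: less_induct)
    case less
    show ?case
    proof (cases "i = n")
      case True
      then show ?thesis using less.prems by (simp add: green_balance)
    next
      case False
      with less.prems have lt: "Suc i \<le> n" by simp
      have "G n i * \<rho>_tot i = (\<Sum>j\<in>{i<..n}. G n j * \<rho> j i)"
        using less.prems False by (simp add: green_balance)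
      also have "\<dots> = (\<Sum>j\<in>{Suc i}. G n j * \<rho> j i)"
        using lt by (intro sum.mono_neutral_right) (auto intro: rho0)
      also have "\<dots> = G n (Suc i) * \<rho> (Suc i) i" by simp
      also have "\<rho> (Suc i) i = (\<Sum>j\<in>{i}. \<rho> (Suc i) j)" by simp
      also have "\<dots> = \<rho>_tot (Suc i)"
        unfolding rho_tot_def using less.prems by (intro sum.mono_neutral_left) (auto intro: rho0)
      also have "G n (Suc i) * \<rho>_tot (Suc i) = 1"
        using less.hyps[of "Suc i"] lt less.prems by simp
      finally show ?thesis .
    qed
  qed
qed

lemma green_convergent:
  assumes exit_lim: "\<And>i. 2 \<le> i \<Longrightarrow> (\<lambda>n. \<Sum>j = 2..i. G n j * \<rho> j 1) \<longlonglongrightarrow> f i"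
  shows "convergent (\<lambda>n. G n i)"
proof (cases "2 \<le> i")
  case False
  then have "G n i = 0" for n by (intro green_eq_0) auto
  then show ?thesis by (simp add: convergent_const)
next
  case True
  show ?thesis
  proof (cases "AE p in \<Lambda>. p = 0")
    case zero: True
    have "eventually (\<lambda>n. G n i = 1 / \<rho>_tot i) sequentially"
      using eventually_ge_at_top[of i]
      by eventually_elim (use green_kingman[OF zero True] rho_tot_pos[OF True] in \<open>simp add: field_simps\<close>)
    then have "(\<lambda>n. G n i) \<longlonglongrightarrow> 1 / \<rho>_tot i" by (rule tendsto_eventually)
    then show ?thesis by (rule convergentI)
  next
    case nonzero: False
    have "\<rho> i 1 \<noteq> 0"
    proof
      assume "\<rho> i 1 = 0"
      then have int0: "(\<integral>p. p ^ (i - 2) \<partial>\<Lambda>) = 0" using True by (simp add: rho_def lam_def)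
      have "integrable \<Lambda> (\<lambda>p. p ^ (i - 2))" using integrable_bernstein[of "i - 2" 0] by simp
      moreover have "AE p in \<Lambda>. 0 \<le> p ^ (i - 2)"
        using AE_unit_interval by eventually_elim auto
      ultimately have *: "AE p in \<Lambda>. p ^ (i - 2) = 0"
        using int0 integral_nonneg_eq_0_iff_AE[of \<Lambda> "\<lambda>p. p ^ (i - 2)"] by blast
      then have "AE p in \<Lambda>. p = 0" by eventually_elim simp
      with nonzero show False by simp
    qed
    define f' where "f' k = (if k < 2 then 0 else f k)" for k
    have lim': "(\<lambda>n. \<Sum>j = 2..k. G n j * \<rho> j 1) \<longlonglongrightarrow> f' k" for k
      using exit_lim[of k] by (auto simp: f'_def)
    have "(\<lambda>n. ((\<Sum>j = 2..i. G n j * \<rho> j 1) - (\<Sum>j = 2..i - 1. G n j * \<rho> j 1)) / \<rho> i 1)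
      \<longlonglongrightarrow> (f' i - f' (i - 1)) / \<rho> i 1"
      using \<open>\<rho> i 1 \<noteq> 0\<close> by (intro tendsto_intros lim')
    moreover have "(\<Sum>j = 2..i. G n j * \<rho> j 1) = (\<Sum>j = 2..i - 1. G n j * \<rho> j 1) + G n i * \<rho> i 1" for n
      using True by (cases i) auto
    ultimately show ?thesis using \<open>\<rho> i 1 \<noteq> 0\<close> by (auto simp: convergent_def)
  qed
qed

end

section \<open>Jump paths\<close>

lemma jump_time_0 [simp]: "jump_time S 0 = 0"
  by (simp add: jump_time_def)

lemma jump_time_Suc [simp]: "jump_time S (Suc k) = jump_time S k + S k"
  by (simp add: jump_time_def)

lemma jump_time_mono: "k \<le> l \<Longrightarrow> jump_time S k \<le> jump_time S l"
  unfolding jump_time_def by (intro sum_mono2) auto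

lemma jump_path_cases:
  obtains (alive) k where "jump_time S k \<le> ennreal t" "ennreal t < jump_time S (Suc k)"
  | (exploded) "\<And>k. jump_time S k \<le> ennreal t"
proof (cases "\<exists>k. ennreal t < jump_time S k")
  case True
  define k where "k = (LEAST k. ennreal t < jump_time S k)"
  have k: "ennreal t < jump_time S k" unfolding k_def using True by (rule LeastI_ex)
  then have "k \<noteq> 0" by (intro notI) simp
  then obtain l where l: "k = Suc l" by (cases k) auto
  have "\<not> ennreal t < jump_time S l" by (rule not_less_Least) (simp add: l flip: k_def)
  with k l show ?thesis by (intro alive[of l]) auto
next
  case False
  then show ?thesis by (intro exploded) (auto simp: not_less)
qed

lemma jump_path_eq_Some:
  assumes "jump_time S k \<le> ennreal t" "ennreal t < jump_time S (Suc k)"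
  shows "jump_path Y S t = Some (Y k)"
proof -
  have "(LEAST k. ennreal t < jump_time S (Suc k)) = k"
  proof (rule Least_equality)
    fix j assume "ennreal t < jump_time S (Suc j)"
    then show "k \<le> j" using assms(1) jump_time_mono[of "Suc j" k S]
      by (metis not_less not_less_eq_eq order.trans)
  qed fact
  then show ?thesis using assms unfolding jump_path_def by auto
qed

lemma jump_path_eq_None: "(\<And>k. jump_time S k \<le> ennreal t) \<Longrightarrow> jump_path Y S t = None"
  unfolding jump_path_def by (auto simp: not_less simp del: jump_time_Suc)

lemma jump_path_right_constant:
  "\<exists>e>0. \<forall>s. t \<le> s \<and> s < t + e \<longrightarrow> jump_path Y S s = jump_path Y S t"
proof (cases rule: jump_path_cases[of S t])
  case (alive k)
  have "\<exists>e>0. \<forall>s. t \<le> s \<and> s < t + e \<longrightarrow> ennreal s < jump_time S (Suc k)"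
  proof (cases "jump_time S (Suc k)")
    case (real r)
    have "t < r" using alive(2) real by (metis ennreal_leI not_le)
    moreover have "0 < r" using alive(2) real by (cases "r = 0") auto
    ultimately show ?thesis
      unfolding real(2) by (intro exI[of _ "r - t"]) (auto intro!: ennreal_lessI)
  next
    case top
    then show ?thesis by (auto intro!: exI[of _ 1] simp del: jump_time_Suc)
  qed
  then obtain e where e: "0 < e" "\<And>s. t \<le> s \<Longrightarrow> s < t + e \<Longrightarrow> ennreal s < jump_time S (Suc k)" by blast
  show ?thesis
  proof (intro exI conjI allI impI)
    fix s assume s: "t \<le> s \<and> s < t + e"
    have "jump_time S k \<le> ennreal s" using alive(1) s by (meson ennreal_leI order_trans)
    then show "jump_path Y S s = jump_path Y S t"
      using e(2)[of s] s alive by (simp add: jump_path_eq_Some del: jump_time_Suc)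
  qed (fact e)
next
  case exploded
  show ?thesis
  proof (intro exI[of _ 1] conjI allI impI)
    fix s assume "t \<le> s \<and> s < t + 1"
    then have "jump_time S k \<le> ennreal s" for k using exploded[of k] by (meson ennreal_leI order_trans)
    then show "jump_path Y S s = jump_path Y S t" using exploded by (simp add: jump_path_eq_None)
  qed simp
qed

lemma jump_path_left_constant:
  assumes "jump_time S k < ennreal t" "ennreal t \<le> jump_time S (Suc k)"
  shows "\<exists>e>0. \<forall>s. t - e < s \<and> s < t \<longrightarrow> jump_path Y S s = Some (Y k)"
proof -
  obtain a where a: "jump_time S k = ennreal a" "0 \<le> a"
    using assms(1) by (cases "jump_time S k") auto
  have "a < t" using assms(1) a by (metis ennreal_leI not_le)
  show ?thesis
  proof (intro exI[of _ "t - a"] conjI allI impI)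
    fix s assume s: "t - (t - a) < s \<and> s < t"
    have "jump_time S k \<le> ennreal s" using s by (simp add: a ennreal_leI)
    moreover have "ennreal s < ennreal t" using s a \<open>a < t\<close> by (intro ennreal_lessI) auto
    ultimately show "jump_path Y S s = Some (Y k)"
      using assms(2) by (intro jump_path_eq_Some) auto
  qed (use \<open>a < t\<close> in simp)
qed

lemma nat_path_ge:
  assumes "mono Y" "jump_time S K \<le> ennreal t"
  shows "enat (Y K) \<le> nat_path Y S t"
proof (cases rule: jump_path_cases[of S t])
  case (alive k)
  have "K \<le> k"
    using assms(2) alive(2) jump_time_mono[of "Suc k" K S]
    by (metis not_less not_less_eq_eq order.trans)
  then show ?thesis using alive assms(1) by (simp add: nat_path_def jump_path_eq_Some monoD)
qed (simp add: nat_path_def jump_path_eq_None)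

lemma nat_path_cong:
  assumes eq: "\<And>k. k < m \<Longrightarrow> Y k = Y' k" "\<And>k. k < m \<Longrightarrow> S k = S' k"
    and t: "ennreal t < jump_time S m"
  shows "nat_path Y S t = nat_path Y' S' t"
proof (cases rule: jump_path_cases[of S t])
  case (alive k)
  have jt: "jump_time S' l = jump_time S l" if "l \<le> m" for l
    unfolding jump_time_def using that eq(2) by (intro sum.cong) auto
  have "k < m"
    using alive(1) t jump_time_mono[of m k S] by (metis not_less order.strict_trans1 less_le_not_le)
  then have "jump_time S' k = jump_time S k" "jump_time S' (Suc k) = jump_time S (Suc k)"
    by (auto intro: jt simp del: jump_time_Suc)
  then have "jump_path Y S t = Some (Y k)" "jump_path Y' S' t = Some (Y' k)"
    using alive by (auto intro!: jump_path_eq_Some simp del: jump_time_Suc)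
  then show ?thesis using eq(1)[OF \<open>k < m\<close>] by (simp add: nat_path_def)
next
  case exploded
  then show ?thesis using t by (metis not_less)
qed

lemma nat_path_nonneg_part: "nat_path Y S (max t 0) = nat_path Y S t"
  by (cases "0 \<le> t") (auto simp: nat_path_def jump_path_def ennreal_neg max_def)

lemma phi_nonneg: "0 \<le> phi x"
  by (cases x) (auto simp: phi_def)

lemma phi_antimono: "x \<le> y \<Longrightarrow> phi y \<le> phi x"
  by (cases x; cases y) (auto simp: phi_def intro!: divide_left_mono)

lemma phi_nat_path_diff:
  assumes mono: "mono Y" "mono Y'"
    and eq: "\<And>k. k \<le> m \<Longrightarrow> Y k = Y' k" "\<And>k. k < m \<Longrightarrow> S k = S' k"
  shows "\<bar>phi (nat_path Y S t) - phi (nat_path Y' S' t)\<bar> \<le> 1 / (real (Y m) + 1)"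
proof (cases "ennreal t < jump_time S m")
  case True
  then have "nat_path Y S t = nat_path Y' S' t" by (rule nat_path_cong[rotated 2]) (use eq in auto)
  then show ?thesis by simp
next
  case False
  have "jump_time S' m = jump_time S m" unfolding jump_time_def using eq(2) by (intro sum.cong) auto
  with False have "phi (nat_path Y S t) \<le> phi (enat (Y m))" "phi (nat_path Y' S' t) \<le> phi (enat (Y m))"
    using nat_path_ge[OF mono(1), of S m t] nat_path_ge[OF mono(2), of S' m t] eq(1)[of m]
    by (auto intro!: phi_antimono)
  moreover have "phi (enat (Y m)) = 1 / (real (Y m) + 1)" by (simp add: phi_def)
  ultimately show ?thesis
    using phi_nonneg[of "nat_path Y S t"] phi_nonneg[of "nat_path Y' S' t"] by linarith
qed

lemma cadlag_nat_path:
  assumes mono: "mono Y" and grow: "(\<forall>B. \<exists>k. B \<le> Y k) \<or> (\<exists>k. S k = \<infinity>)"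
  shows "cadlag (nat_path Y S)"
  unfolding cadlag_def
proof (intro conjI allI impI)
  fix t :: real
  obtain e where e: "0 < e" "\<And>s. t \<le> s \<Longrightarrow> s < t + e \<Longrightarrow> jump_path Y S s = jump_path Y S t"
    using jump_path_right_constant[of t Y S] by blast
  have "eventually (\<lambda>s. phi (nat_path Y S s) = phi (nat_path Y S t)) (at_right t)"
    unfolding eventually_at_right_field
  proof (intro exI[of _ "t + e"] conjI allI impI)
    fix s assume "t < s" "s < t + e"
    then have "jump_path Y S s = jump_path Y S t" by (intro e(2)) auto
    then show "phi (nat_path Y S s) = phi (nat_path Y S t)" by (simp only: nat_path_def)
  qed (use e in simp)
  then show "((\<lambda>s. phi (nat_path Y S s)) \<longlongrightarrow> phi (nat_path Y S t)) (at_right t)"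
    by (rule tendsto_eventually)
next
  fix t :: real assume t: "0 < t"
  show "\<exists>l. ((\<lambda>s. phi (nat_path Y S s)) \<longlongrightarrow> l) (at_left t)"
  proof (cases "\<exists>k. ennreal t \<le> jump_time S k")
    case True
    define k where "k = (LEAST k. ennreal t \<le> jump_time S k)"
    have k: "ennreal t \<le> jump_time S k" unfolding k_def using True by (rule LeastI_ex)
    then have "k \<noteq> 0" using t by (intro notI) (simp add: ennreal_eq_0_iff)
    then obtain l where l: "k = Suc l" by (cases k) auto
    have "\<not> ennreal t \<le> jump_time S l" by (rule not_less_Least) (simp add: l flip: k_def)
    then obtain e where e: "0 < e" "\<And>s. t - e < s \<Longrightarrow> s < t \<Longrightarrow> jump_path Y S s = Some (Y l)"
      using jump_path_left_constant[of S l t Y] k l by (auto simp: not_le simp del: jump_time_Suc)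
    have "eventually (\<lambda>s. phi (nat_path Y S s) = phi (enat (Y l))) (at_left t)"
      unfolding eventually_at_left_field using e by (intro exI[of _ "t - e"]) (auto simp: nat_path_def)
    then show ?thesis by (blast intro: tendsto_eventually)
  next
    case False
    then have lt: "jump_time S k < ennreal t" for k by (auto simp: not_le)
    have "S k \<noteq> \<infinity>" for k using lt[of "Suc k"] by auto
    then have unbounded: "\<And>B. \<exists>k. B \<le> Y k" using grow by auto
    have "((\<lambda>s. phi (nat_path Y S s)) \<longlongrightarrow> 0) (at_left t)"
    proof (rule tendstoI)
      fix e :: real assume e: "0 < e"
      obtain B :: nat where B: "1 / e < real B" using reals_Archimedean2 by blast
      obtain K where K: "B \<le> Y K" using unbounded by blast
      obtain a where a: "jump_time S K = ennreal a" "0 \<le> a"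
        using lt[of K] by (cases "jump_time S K") auto
      have "a < t" using lt[of K] a by (metis ennreal_leI not_le)
      have "dist (phi (nat_path Y S s)) 0 < e" if "a < s" for s
      proof -
        have "phi (nat_path Y S s) \<le> phi (enat (Y K))"
          using that by (intro phi_antimono nat_path_ge mono) (simp add: a ennreal_leI)
        also have "\<dots> \<le> 1 / (real B + 1)" using K by (auto simp: phi_def intro!: divide_left_mono)
        also have "\<dots> < e" using B e by (simp add: field_simps)
        finally show ?thesis using phi_nonneg by (simp add: dist_real_def)
      qed
      then show "eventually (\<lambda>s. dist (phi (nat_path Y S s)) 0 < e) (at_left t)"
        unfolding eventually_at_left_field using \<open>a < t\<close> by (intro exI[of _ a]) auto
    qed
    then show ?thesis by blast
  qed
qed

lemma cadlag_cong:
  assumes "\<And>t. 0 \<le> t \<Longrightarrow> x t = y t" "cadlag y"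
  shows "cadlag x"
  unfolding cadlag_def
proof (intro conjI allI impI)
  fix t :: real assume t: "0 \<le> t"
  have "eventually (\<lambda>s. phi (y s) = phi (x s)) (at_right t)"
    unfolding eventually_at_right_field using t assms(1) by (intro exI[of _ "t + 1"]) auto
  then show "((\<lambda>s. phi (x s)) \<longlongrightarrow> phi (x t)) (at_right t)"
    using assms(2) t unfolding cadlag_def assms(1)[OF t] by (blast intro: Lim_transform_eventually)
next
  fix t :: real assume t: "0 < t"
  then obtain l where "((\<lambda>s. phi (y s)) \<longlongrightarrow> l) (at_left t)"
    using assms(2) unfolding cadlag_def by blast
  moreover have "eventually (\<lambda>s. phi (y s) = phi (x s)) (at_left t)"
    unfolding eventually_at_left_field using t assms(1) by (intro exI[of _ 0]) auto
  ultimately show "\<exists>l. ((\<lambda>s. phi (x s)) \<longlongrightarrow> l) (at_left t)"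
    by (blast intro: Lim_transform_eventually)
qed

lemma skorohod_tendsto_uniform:
  assumes "\<And>e. 0 < e \<Longrightarrow> eventually (\<lambda>n. \<forall>t\<ge>0. \<bar>phi (xs n t) - phi (x t)\<bar> \<le> e) sequentially"
  shows "skorohod_tendsto xs x"
  unfolding skorohod_tendsto_def
proof (intro allI impI exI[of _ "\<lambda>n t. t"] conjI)
  show "(\<lambda>t. t) \<in> time_changes"
    by (auto simp: time_changes_def strict_mono_on_def)
  fix T e :: real assume "0 < e"
  from assms[OF this] show "eventually (\<lambda>n. \<forall>t\<in>{0..T}. \<bar>t - t\<bar> \<le> e \<and> \<bar>phi (xs n t) - phi (x t)\<bar> \<le> e) sequentially"
    by eventually_elim (use \<open>0 < e\<close> in auto)
qed

lemma skorohod_continuous_cong: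
  assumes F: "skorohod_continuous F" and "cadlag x" "cadlag y" "\<And>t. 0 \<le> t \<Longrightarrow> x t = y t"
  shows "F x = F y"
proof -
  have "skorohod_tendsto (\<lambda>_. x) y"
    by (rule skorohod_tendsto_uniform) (use assms(4) in auto)
  then have "(\<lambda>n. F x) \<longlonglongrightarrow> F y"
    using F[unfolded skorohod_continuous_def, rule_format, of y "\<lambda>_. x"] assms(2,3) by simp
  then show ?thesis by (simp add: LIMSEQ_const_iff)
qed

lemma measurable_jump_time:
  assumes "\<And>k. (\<lambda>\<omega>. S \<omega> k) \<in> borel_measurable M"
  shows "(\<lambda>\<omega>. jump_time (S \<omega>) k) \<in> borel_measurable M"
  unfolding jump_time_def by (intro borel_measurable_sum assms)

lemma measurable_jump_path:
  assumes Y: "\<And>k. (\<lambda>\<omega>. Y \<omega> k) \<in> measurable M (count_space UNIV)"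
    and S: "\<And>k. (\<lambda>\<omega>. S \<omega> k) \<in> borel_measurable M"
  shows "(\<lambda>\<omega>. jump_path (Y \<omega>) (S \<omega>) t) \<in> measurable M (count_space UNIV)"
proof -
  note [measurable] = Y S measurable_jump_time[of S, OF S]
  have L: "(\<lambda>\<omega>. LEAST k. ennreal t < jump_time (S \<omega>) (Suc k)) \<in> measurable M (count_space UNIV)"
    by measurable
  have "(\<lambda>\<omega>. Y \<omega> (LEAST k. ennreal t < jump_time (S \<omega>) (Suc k))) \<in> measurable M (count_space UNIV)"
    by (rule measurable_compose_countable[where f = "\<lambda>k \<omega>. Y \<omega> k", OF Y L])
  then have "(\<lambda>\<omega>. Some (Y \<omega> (LEAST k. ennreal t < jump_time (S \<omega>) (Suc k)))) \<in> measurable M (count_space UNIV)"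
    by (rule measurable_compose) simp
  moreover have "{\<omega> \<in> space M. \<exists>k. jump_time (S \<omega>) k \<le> ennreal t \<and> ennreal t < jump_time (S \<omega>) (Suc k)} \<in> sets M"
    by measurable
  ultimately show ?thesis
    unfolding jump_path_def by (intro measurable_If) simp_all
qed

lemma measurable_nat_path:
  assumes "\<And>k. (\<lambda>\<omega>. Y \<omega> k) \<in> measurable M (count_space UNIV)"
    and "\<And>k. (\<lambda>\<omega>. S \<omega> k) \<in> borel_measurable M"
  shows "(\<lambda>\<omega>. nat_path (Y \<omega>) (S \<omega>)) \<in> measurable M path_space"
  unfolding path_space_def
proof (rule measurable_PiM_single')
  show "(\<lambda>\<omega>. nat_path (Y \<omega>) (S \<omega>) t) \<in> measurable M (count_space UNIV)" for t
    unfolding nat_path_def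
    by (rule measurable_compose[OF measurable_jump_path[OF assms]]) simp
qed auto

lemma left_limI:
  assumes "0 < e" "\<And>u. s - e < u \<Longrightarrow> u < s \<Longrightarrow> f u = c"
  shows "left_lim f s = c"
  unfolding left_lim_def
proof (rule the_equality)
  show "\<exists>e>0. \<forall>u. s - e < u \<and> u < s \<longrightarrow> f u = c" using assms by blast
  fix d assume "\<exists>e>0. \<forall>u. s - e < u \<and> u < s \<longrightarrow> f u = d"
  then obtain e' where e': "0 < e'" "\<And>u. s - e' < u \<Longrightarrow> u < s \<Longrightarrow> f u = d" by blast
  have "f (s - min e e' / 2) = c" "f (s - min e e' / 2) = d"
    using assms(1) e'(1) by (auto intro!: assms(2) e'(2))
  then show "d = c" by simp
qed

lemma measurable_left_lim:
  fixes f :: "'a \<Rightarrow> real \<Rightarrow> nat"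
  assumes f [measurable]: "\<And>u. (\<lambda>\<omega>. f \<omega> u) \<in> measurable M (count_space UNIV)"
    and right: "\<And>\<omega> t. \<exists>e>0. \<forall>s. t \<le> s \<and> s < t + e \<longrightarrow> f \<omega> s = f \<omega> t"
    and [measurable]: "\<tau> \<in> borel_measurable M"
  shows "(\<lambda>\<omega>. left_lim (f \<omega>) (\<tau> \<omega>)) \<in> measurable M (count_space UNIV)"
proof -
  define P where "P \<omega> c \<longleftrightarrow> (\<exists>N::nat. \<forall>q::rat. \<tau> \<omega> - 1 / (real N + 1) < of_rat q \<and> of_rat q < \<tau> \<omega> \<longrightarrow> f \<omega> (of_rat q) = c)" for \<omega> c
  have [measurable]: "Measurable.pred M (\<lambda>\<omega>. P \<omega> c)" for c
    unfolding P_def by measurable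
  have P_iff: "P \<omega> c \<longleftrightarrow> (\<exists>e>0. \<forall>u. \<tau> \<omega> - e < u \<and> u < \<tau> \<omega> \<longrightarrow> f \<omega> u = c)" for \<omega> c
  proof
    assume "P \<omega> c"
    then obtain N :: nat where N: "\<And>q. \<tau> \<omega> - 1 / (real N + 1) < of_rat q \<Longrightarrow> of_rat q < \<tau> \<omega> \<Longrightarrow> f \<omega> (of_rat q) = c"
      unfolding P_def by blast
    have "f \<omega> u = c" if u: "\<tau> \<omega> - 1 / (real N + 1) < u" "u < \<tau> \<omega>" for u
    proof -
      obtain e where e: "0 < e" "\<And>s. u \<le> s \<Longrightarrow> s < u + e \<Longrightarrow> f \<omega> s = f \<omega> u" using right by blast
      have "u < min (u + e) (\<tau> \<omega>)" using e u by simp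
      then obtain q where "u < of_rat q" "of_rat q < min (u + e) (\<tau> \<omega>)" using of_rat_dense by blast
      then show ?thesis using N[of q] e(2)[of "of_rat q"] u by simp
    qed
    then show "\<exists>e>0. \<forall>u. \<tau> \<omega> - e < u \<and> u < \<tau> \<omega> \<longrightarrow> f \<omega> u = c"
      by (intro exI[of _ "1 / (real N + 1)"]) auto
  next
    assume "\<exists>e>0. \<forall>u. \<tau> \<omega> - e < u \<and> u < \<tau> \<omega> \<longrightarrow> f \<omega> u = c"
    then obtain e where e: "0 < e" "\<And>u. \<tau> \<omega> - e < u \<Longrightarrow> u < \<tau> \<omega> \<Longrightarrow> f \<omega> u = c" by blast
    obtain N :: nat where "1 / e < real N" using reals_Archimedean2 by blast
    then have "1 / (real N + 1) < e" using e by (simp add: field_simps)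
    then show "P \<omega> c" unfolding P_def by (intro exI[of _ N]) (auto intro!: e(2))
  qed
  have "left_lim (f \<omega>) (\<tau> \<omega>) = (if \<exists>c. P \<omega> c then LEAST c. P \<omega> c else THE c. False)" for \<omega>
  proof (cases "\<exists>c. P \<omega> c")
    case True
    then have "P \<omega> (LEAST c. P \<omega> c)" by (rule LeastI_ex)
    then have "left_lim (f \<omega>) (\<tau> \<omega>) = (LEAST c. P \<omega> c)" unfolding P_iff by (auto intro: left_limI)
    then show ?thesis using True by simp
  next
    case False
    then show ?thesis by (simp add: left_lim_def flip: P_iff)
  qed
  then show ?thesis by simp
qed

lemma coal_N_right_constant: "\<exists>e>0. \<forall>s. t \<le> s \<and> s < t + e \<longrightarrow> coal_N Y S s = coal_N Y S t"
proof -
  obtain e where e: "0 < e" "\<And>s. t \<le> s \<Longrightarrow> s < t + e \<Longrightarrow> jump_path Y S s = jump_path Y S t"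
    using jump_path_right_constant[of t Y S] by blast
  have "coal_N Y S s = coal_N Y S t" if "t \<le> s" "s < t + e" for s
    unfolding coal_N_def e(2)[OF that] ..
  with e(1) show ?thesis by blast
qed

context
  fixes M :: "'a measure" and Y :: "'a \<Rightarrow> nat \<Rightarrow> nat set set" and S :: "'a \<Rightarrow> nat \<Rightarrow> ennreal"
  assumes Y: "\<And>k. (\<lambda>\<omega>. Y \<omega> k) \<in> measurable M (count_space UNIV)"
    and S: "\<And>k. (\<lambda>\<omega>. S \<omega> k) \<in> borel_measurable M"
begin

lemma measurable_coal_N: "(\<lambda>\<omega>. coal_N (Y \<omega>) (S \<omega>) t) \<in> measurable M (count_space UNIV)"
  unfolding coal_N_def by (rule measurable_compose[OF measurable_jump_path[OF Y S]]) simp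

lemma measurable_coal_T: "(\<lambda>\<omega>. coal_T (Y \<omega>) (S \<omega>)) \<in> borel_measurable M"
proof (rule borel_measurableI_less)
  fix y :: real
  note [measurable] = measurable_coal_N
  define R where "R a \<omega> \<longleftrightarrow> (\<exists>q::rat. 0 \<le> (of_rat q :: real) \<and> of_rat q < a \<and> coal_N (Y \<omega>) (S \<omega>) (of_rat q) = 1)"
    for a :: real and \<omega>
  define R' where "R' \<omega> \<longleftrightarrow> (\<exists>q::rat. 0 \<le> (of_rat q :: real) \<and> coal_N (Y \<omega>) (S \<omega>) (of_rat q) = 1)" for \<omega>
  have [measurable]: "Measurable.pred M (R y)" "Measurable.pred M R'" unfolding R_def R'_def by measurable
  have dense: "\<exists>q::rat. t \<le> of_rat q \<and> of_rat q < t + e \<and> coal_N (Y \<omega>) (S \<omega>) (of_rat q) = 1"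
    if one: "coal_N (Y \<omega>) (S \<omega>) t = 1" and "0 < e" for \<omega> t e
  proof -
    obtain d where d: "0 < d" "\<And>s. t \<le> s \<Longrightarrow> s < t + d \<Longrightarrow> coal_N (Y \<omega>) (S \<omega>) s = coal_N (Y \<omega>) (S \<omega>) t"
      using coal_N_right_constant by blast
    obtain q where "t < of_rat q" "of_rat q < t + min d e"
      using of_rat_dense[of t "t + min d e"] d(1) \<open>0 < e\<close> by auto
    then show ?thesis using d(2)[of "of_rat q"] one by (intro exI[of _ q]) auto
  qed
  have "coal_T (Y \<omega>) (S \<omega>) < y \<longleftrightarrow> (if R' \<omega> then R y \<omega> else Inf {} < y)" for \<omega>
  proof (cases "R' \<omega>")
    case True
    then have ne: "{t. 0 \<le> t \<and> coal_N (Y \<omega>) (S \<omega>) t = 1} \<noteq> {}" unfolding R'_def by blast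
    have "coal_T (Y \<omega>) (S \<omega>) < y \<longleftrightarrow> (\<exists>t. 0 \<le> t \<and> coal_N (Y \<omega>) (S \<omega>) t = 1 \<and> t < y)"
      unfolding coal_T_def by (subst cInf_less_iff[OF ne]) (auto intro: bdd_belowI[of _ 0])
    also have "\<dots> \<longleftrightarrow> R y \<omega>"
    proof
      assume "\<exists>t. 0 \<le> t \<and> coal_N (Y \<omega>) (S \<omega>) t = 1 \<and> t < y"
      then obtain t where t: "0 \<le> t" "coal_N (Y \<omega>) (S \<omega>) t = 1" "t < y" by blast
      then obtain q where "t \<le> of_rat q" "of_rat q < t + (y - t)" "coal_N (Y \<omega>) (S \<omega>) (of_rat q) = 1"
        using dense[of \<omega> t "y - t"] by auto
      with t show "R y \<omega>" unfolding R_def by (intro exI[of _ q] conjI; linarith)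
    qed (unfold R_def, blast)
    finally show ?thesis using True by simp
  next
    case False
    have "\<not> (0 \<le> t \<and> coal_N (Y \<omega>) (S \<omega>) t = 1)" for t
    proof
      assume t: "0 \<le> t \<and> coal_N (Y \<omega>) (S \<omega>) t = 1"
      then obtain q where "t \<le> of_rat q" "coal_N (Y \<omega>) (S \<omega>) (of_rat q) = 1"
        using dense[of \<omega> t 1] by auto
      then have "R' \<omega>" unfolding R'_def using t by (intro exI[of _ q] conjI; linarith)
      with False show False by simp
    qed
    then have "coal_T (Y \<omega>) (S \<omega>) = Inf {}" unfolding coal_T_def by (metis (mono_tags, lifting) Collect_empty_eq)
    then show ?thesis using False by simp
  qed
  then show "{\<omega> \<in> space M. coal_T (Y \<omega>) (S \<omega>) < y} \<in> sets M" by simp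
qed

lemma measurable_coal_left_lim:
  "(\<lambda>\<omega>. left_lim (coal_N (Y \<omega>) (S \<omega>)) (coal_T (Y \<omega>) (S \<omega>) - t)) \<in> measurable M (count_space UNIV)"
  by (rule measurable_left_lim[where f = "\<lambda>\<omega>. coal_N (Y \<omega>) (S \<omega>)", OF measurable_coal_N coal_N_right_constant])
     (intro borel_measurable_diff measurable_coal_T borel_measurable_const)

lemma measurable_coal_L: "(\<lambda>\<omega>. coal_L (Y \<omega>) (S \<omega>)) \<in> measurable M (count_space UNIV)"
  using measurable_coal_left_lim[of 0] by (simp add: coal_L_def)

lemma measurable_coal_Nhat: "(\<lambda>\<omega>. coal_Nhat n (Y \<omega>) (S \<omega>)) \<in> measurable M path_space"
  unfolding path_space_def
proof (rule measurable_PiM_single')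
  note [measurable] = measurable_coal_left_lim measurable_coal_T
  show "(\<lambda>\<omega>. coal_Nhat n (Y \<omega>) (S \<omega>) t) \<in> measurable M (count_space UNIV)" for t
    unfolding coal_Nhat_def by measurable
qed auto

lemma measurable_coal_Nhat_nonneg: "(\<lambda>\<omega> t. coal_Nhat n (Y \<omega>) (S \<omega>) (max t 0)) \<in> measurable M path_space"
  unfolding path_space_def
proof (rule measurable_PiM_single')
  show "(\<lambda>\<omega>. coal_Nhat n (Y \<omega>) (S \<omega>) (max t 0)) \<in> measurable M (count_space UNIV)" for t
    using measurable_compose[OF measurable_coal_Nhat[unfolded path_space_def]
        measurable_component_singleton[of "max t 0" UNIV "\<lambda>_. count_space UNIV"]] by simp
qed auto

end

lemma partial_sums_cover_right:
  fixes \<tau> :: "nat \<Rightarrow> real"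
  assumes "\<tau> 0 \<le> u" "u < \<tau> m"
  shows "\<exists>k<m. \<tau> k \<le> u \<and> u < \<tau> (Suc k)"
  using assms
proof (induction m)
  case (Suc m)
  then show ?case by (cases "u < \<tau> m") (auto intro: less_SucI)
qed simp

lemma partial_sums_cover_left:
  fixes \<tau> :: "nat \<Rightarrow> real"
  assumes "\<tau> 0 < u" "u \<le> \<tau> m"
  shows "\<exists>k<m. \<tau> k < u \<and> u \<le> \<tau> (Suc k)"
  using assms
proof (induction m)
  case (Suc m)
  then show ?case by (cases "u \<le> \<tau> m") (auto intro: less_SucI)
qed simp

context
  fixes Y :: "nat \<Rightarrow> nat set set" and S :: "nat \<Rightarrow> ennreal" and v :: "nat \<Rightarrow> real" and zs :: "nat list" and m :: nat
  assumes m: "m = length zs" "0 < m"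
    and card_Y: "\<And>k. k < m \<Longrightarrow> card (Y k) = zs ! (m - 1 - k)" "card (Y m) = 1"
    and zs: "\<And>k. k < m \<Longrightarrow> zs ! k \<noteq> 1"
    and S: "\<And>k. k < m \<Longrightarrow> S k = ennreal (v k)" "\<And>k. k < m \<Longrightarrow> 0 < v k" "0 < S m"
begin

private definition \<tau> :: "nat \<Rightarrow> real" where "\<tau> k = (\<Sum>i<k. v i)"

private lemma jump_time_eq: "k \<le> m \<Longrightarrow> jump_time S k = ennreal (\<tau> k)"
  unfolding jump_time_def \<tau>_def using S by (subst sum_ennreal[symmetric]) (auto intro: less_imp_le)

private lemma \<tau>_nonneg: "k \<le> m \<Longrightarrow> 0 \<le> \<tau> k"
  unfolding \<tau>_def using S(2) by (intro sum_nonneg) (auto intro!: less_imp_le)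

private lemma coal_N_eq:
  assumes "k < m" "\<tau> k \<le> u" "u < \<tau> (Suc k)"
  shows "coal_N Y S u = zs ! (m - 1 - k)"
proof -
  have "jump_time S k \<le> ennreal u" using assms by (simp add: jump_time_eq ennreal_leI)
  moreover have "ennreal u < jump_time S (Suc k)"
    using assms \<tau>_nonneg[of k] by (subst jump_time_eq) (auto intro!: ennreal_lessI)
  ultimately show ?thesis using assms(1) by (simp add: coal_N_def jump_path_eq_Some card_Y)
qed

lemma coal_T_eq: "coal_T Y S = \<tau> m"
  unfolding coal_T_def
proof (rule cInf_eq_minimum)
  have "jump_path Y S (\<tau> m) = Some (Y m)"
    using S(3) ennreal_add_left_cancel_less[of "ennreal (\<tau> m)" 0 "S m"]
    by (intro jump_path_eq_Some) (auto simp: jump_time_eq)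
  then show "\<tau> m \<in> {t. 0 \<le> t \<and> coal_N Y S t = 1}" by (simp add: \<tau>_nonneg coal_N_def card_Y)
  fix u assume u: "u \<in> {t. 0 \<le> t \<and> coal_N Y S t = 1}"
  show "\<tau> m \<le> u"
  proof (rule ccontr)
    assume "\<not> \<tau> m \<le> u"
    then obtain k where k: "k < m" "\<tau> k \<le> u" "u < \<tau> (Suc k)"
      using partial_sums_cover_right[of \<tau> u m] u by (auto simp: \<tau>_def not_le)
    then show False using coal_N_eq[OF k] zs[of "m - 1 - k"] u by auto
  qed
qed

lemma coal_T_pos: "0 < coal_T Y S"
  unfolding coal_T_eq \<tau>_def using S(2) m by (intro sum_pos) auto

private lemma left_lim_coal_N:
  assumes "k < m" "\<tau> k < s" "s \<le> \<tau> (Suc k)"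
  shows "left_lim (coal_N Y S) s = zs ! (m - 1 - k)"
proof (rule left_limI[of "s - \<tau> k"])
  show "coal_N Y S u = zs ! (m - 1 - k)" if "s - (s - \<tau> k) < u" "u < s" for u
    using assms that by (intro coal_N_eq) auto
qed (use assms in simp)

private definition S' :: "nat \<Rightarrow> ennreal" where
  "S' j = (if j < m - 1 then ennreal (v (m - 1 - j)) else \<infinity>)"

private lemma jump_time_reversed: "j \<le> m - 1 \<Longrightarrow> jump_time S' j = ennreal (\<tau> m - \<tau> (m - j))"
proof (induction j)
  case (Suc j)
  have Suc_eq: "m - j = Suc (m - Suc j)" using Suc.prems by simp
  have "\<tau> (m - j) \<le> \<tau> m" unfolding \<tau>_def using S(2) by (intro sum_mono2) (auto intro!: less_imp_le)
  moreover have "\<tau> (m - j) = \<tau> (m - Suc j) + v (m - Suc j)" unfolding Suc_eq by (simp add: \<tau>_def)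
  moreover have "0 < v (m - Suc j)" using Suc.prems m by (intro S(2)) auto
  ultimately show ?case using Suc by (simp add: S'_def flip: ennreal_plus)
qed simp

lemma coal_Nhat_eq_nat_path:
  assumes t: "0 \<le> t"
  shows "coal_Nhat (zs ! (m - 1)) Y S t = nat_path (\<lambda>j. zs ! j) (\<lambda>j. if j < m - 1 then ennreal (v (m - 1 - j)) else \<infinity>) t"
proof -
  have *: "nat_path (\<lambda>j. zs ! j) S' t = enat (zs ! j)"
    if "j < m" "\<tau> m - \<tau> (m - j) \<le> t" "j < m - 1 \<Longrightarrow> t < \<tau> m - \<tau> (m - Suc j)" for j
  proof -
    have "jump_time S' j \<le> ennreal t" using that by (subst jump_time_reversed) (auto intro: ennreal_leI)
    moreover have "ennreal t < jump_time S' (Suc j)"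
    proof (cases "j < m - 1")
      case True
      then show ?thesis using that(3)[OF True] t
        by (subst jump_time_reversed) (auto intro!: ennreal_lessI)
    next
      case False
      then show ?thesis by (simp add: S'_def)
    qed
    ultimately show ?thesis by (simp add: nat_path_def jump_path_eq_Some)
  qed
  show ?thesis
  proof (cases "t < coal_T Y S")
    case True
    then obtain k where k: "k < m" "\<tau> k < \<tau> m - t" "\<tau> m - t \<le> \<tau> (Suc k)"
      using partial_sums_cover_left[of \<tau> "\<tau> m - t" m] t by (auto simp: \<tau>_def coal_T_eq)
    have "coal_Nhat (zs ! (m - 1)) Y S t = enat (zs ! (m - 1 - k))"
      using True left_lim_coal_N[OF k] by (simp add: coal_Nhat_def coal_T_eq)
    moreover have "nat_path (\<lambda>j. zs ! j) S' t = enat (zs ! (m - 1 - k))"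
    proof (rule *)
      have 1: "m - (m - 1 - k) = Suc k" and 2: "m - Suc (m - 1 - k) = k" using k by auto
      show "\<tau> m - \<tau> (m - (m - 1 - k)) \<le> t" unfolding 1 using k by simp
      show "t < \<tau> m - \<tau> (m - Suc (m - 1 - k))" unfolding 2 using k by simp
    qed (use m in simp)
    ultimately show ?thesis by (simp add: S'_def[abs_def])
  next
    case False
    then have "coal_Nhat (zs ! (m - 1)) Y S t = enat (zs ! (m - 1))" by (simp add: coal_Nhat_def)
    moreover have "nat_path (\<lambda>j. zs ! j) S' t = enat (zs ! (m - 1))"
    proof (rule *)
      have 1: "m - (m - 1) = 1" using m(2) by simp
      show "\<tau> m - \<tau> (m - (m - 1)) \<le> t" unfolding 1 using False \<tau>_nonneg[of 1] m(2) by (simp add: coal_T_eq)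
    qed (use m in auto)
    ultimately show ?thesis by (simp add: S'_def[abs_def])
  qed
qed

end

section \<open>Construction and coupling of jump chains\<close>

definition sample :: "(nat \<Rightarrow> real) \<Rightarrow> real \<Rightarrow> nat" where
  "sample p u = (LEAST j. u < (\<Sum>i\<le>j. p i))"

lemma sample_eqI:
  assumes "\<And>i. 0 \<le> p i" "(\<Sum>i<j. p i) \<le> u" "u < (\<Sum>i\<le>j. p i)"
  shows "sample p u = j"
  unfolding sample_def
proof (rule Least_equality)
  fix k assume k: "u < (\<Sum>i\<le>k. p i)"
  show "j \<le> k"
  proof (rule ccontr)
    assume "\<not> j \<le> k"
    then have "(\<Sum>i\<le>k. p i) \<le> (\<Sum>i<j. p i)" using assms(1) by (intro sum_mono2) auto
    with k assms(2) show False by simp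
  qed
qed fact

lemma sample_bounds:
  assumes p: "p sums 1" and u: "0 \<le> u" "u < 1"
  shows "(\<Sum>i<sample p u. p i) \<le> u" "u < (\<Sum>i\<le>sample p u. p i)"
proof -
  have "(\<lambda>j. \<Sum>i\<le>j. p i) \<longlonglongrightarrow> 1" using p by (simp add: sums_def_le)
  then have "eventually (\<lambda>j. u < (\<Sum>i\<le>j. p i)) sequentially" using u by (intro order_tendstoD)
  then have ex: "\<exists>j. u < (\<Sum>i\<le>j. p i)" by (auto simp: eventually_sequentially)
  then show "u < (\<Sum>i\<le>sample p u. p i)" unfolding sample_def by (rule LeastI_ex)
  show "(\<Sum>i<sample p u. p i) \<le> u"
  proof (cases "sample p u")
    case (Suc k)
    then have "\<not> u < (\<Sum>i\<le>k. p i)" unfolding sample_def by (intro not_less_Least) simp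
    then show ?thesis by (simp add: Suc lessThan_Suc_atMost)
  qed (use u in simp)
qed

lemma sample_pos:
  assumes "p sums 1" "0 \<le> u" "u < 1"
  shows "0 < p (sample p u)"
  using sample_bounds[OF assms] by (simp flip: lessThan_Suc_atMost)

lemma measurable_sample [measurable]: "sample p \<in> measurable borel (count_space UNIV)"
  unfolding sample_def[abs_def] by measurable

lemma sample_eventually_eq:
  assumes p: "p sums 1" and pn: "\<And>n i. 0 \<le> pn n i" "\<And>i. (\<lambda>n. pn n i) \<longlonglongrightarrow> p i"
    and u: "0 \<le> u" "u < 1" and avoid: "\<And>j. u \<noteq> (\<Sum>i<j. p i)"
  shows "eventually (\<lambda>n. sample (pn n) u = sample p u) sequentially"
proof -
  define j where "j = sample p u"
  have "(\<Sum>i<j. p i) < u" "u < (\<Sum>i\<le>j. p i)"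
    using sample_bounds[OF p u] avoid[of j] by (auto simp: j_def)
  moreover have "(\<lambda>n. \<Sum>i<j. pn n i) \<longlonglongrightarrow> (\<Sum>i<j. p i)" "(\<lambda>n. \<Sum>i\<le>j. pn n i) \<longlonglongrightarrow> (\<Sum>i\<le>j. p i)"
    by (intro tendsto_sum pn(2))+
  ultimately have "eventually (\<lambda>n. (\<Sum>i<j. pn n i) < u) sequentially" "eventually (\<lambda>n. u < (\<Sum>i\<le>j. pn n i)) sequentially"
    by (auto intro: order_tendstoD)
  then show ?thesis
    by eventually_elim (unfold j_def[symmetric], rule sample_eqI, use pn(1) in auto)
qed

text \<open>The even coordinates choose the successive states of a jump chain, the odd ones are its
  standard exponential holding times, to be divided by the current total rate.\<close>

definition clock :: "nat \<Rightarrow> real measure" where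
  "clock k = (if even k then uniform_measure lborel {0..<1} else density lborel (exponential_density 1))"

definition clock_space :: "(nat \<Rightarrow> real) measure" where
  "clock_space = Pi\<^sub>M UNIV clock"

lemma sets_clock [simp, measurable_cong]: "sets (clock k) = sets borel"
  by (simp add: clock_def)

lemma space_clock [simp]: "space (clock k) = UNIV"
  by (simp add: clock_def)

lemma prob_space_clock: "prob_space (clock k)"
  by (auto simp: clock_def intro!: prob_space_uniform_measure prob_space_exponential_density)

interpretation clocks: product_prob_space clock UNIV
  by (auto simp: product_prob_space_def product_prob_space_axioms_def product_sigma_finite_def
      intro: prob_space_clock prob_space_imp_sigma_finite)

lemma prob_space_clock_space: "prob_space clock_space"
  unfolding clock_space_def by (rule prob_space_PiM) (rule prob_space_clock)

lemma space_clock_space [simp]: "space clock_space = UNIV"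
  by (simp add: clock_space_def space_PiM)

lemma measurable_clock_coord [measurable]: "(\<lambda>\<omega>. \<omega> k) \<in> borel_measurable clock_space"
  unfolding clock_space_def using measurable_component_singleton[of k UNIV clock]
  by (simp cong: measurable_cong_sets)

lemma measure_clock_even:
  assumes "even k" "\<And>i. 0 \<le> p i" "p sums 1"
  shows "measure (clock k) {u. sample p u = j} = p j"
proof -
  have [measurable]: "{u. sample p u = j} \<in> sets borel"
    using measurable_sets[OF measurable_sample, of "{j}" p] by (simp add: vimage_def)
  have le1: "(\<Sum>i\<le>j. p i) \<le> 1"
    using assms by (metis sum_le_suminf finite_atMost sums_iff)
  have "{0..<1} \<inter> {u. sample p u = j} = {(\<Sum>i<j. p i)..<(\<Sum>i\<le>j. p i)}"
  proof (intro set_eqI iffI)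
    fix u assume "u \<in> {0..<1} \<inter> {u. sample p u = j}"
    then show "u \<in> {(\<Sum>i<j. p i)..<(\<Sum>i\<le>j. p i)}" using sample_bounds[OF assms(3), of u] by auto
  next
    fix u assume u: "u \<in> {(\<Sum>i<j. p i)..<(\<Sum>i\<le>j. p i)}"
    have "0 \<le> (\<Sum>i<j. p i)" using assms(2) by (intro sum_nonneg) auto
    with u le1 have "u \<in> {0..<1}" by auto
    moreover have "sample p u = j" using u assms(2) by (intro sample_eqI) auto
    ultimately show "u \<in> {0..<1} \<inter> {u. sample p u = j}" by simp
  qed
  then have "measure (clock k) {u. sample p u = j} = measure lborel {(\<Sum>i<j. p i)..<(\<Sum>i\<le>j. p i)}"
    using assms(1) by (simp add: clock_def)
  also have "\<dots> = p j" using assms(2)[of j] by (simp flip: lessThan_Suc_atMost)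
  finally show ?thesis .
qed

lemma measure_clock_odd:
  assumes "odd k" "0 \<le> r" "0 \<le> s"
  shows "measure (clock k) {x. ennreal s < ennreal x / ennreal r} = exp (- r * s)"
proof -
  have D: "distributed (clock k) lborel (\<lambda>x. x) (exponential_density 1)"
    using assms(1) by (auto simp: distributed_def clock_def distr_id2)
  have "ennreal s < ennreal x / ennreal r \<longleftrightarrow> r * s < x" for x
  proof (cases "0 < r")
    case True
    show ?thesis
    proof (cases "0 \<le> x")
      case x: True
      have "ennreal s < ennreal x / ennreal r \<longleftrightarrow> s < x / r"
        using True x assms by (simp add: divide_ennreal ennreal_less_iff)
      then show ?thesis using True by (simp add: field_simps)
    next
      case False
      then have "\<not> r * s < x" using True assms(3) by (auto simp: not_less intro: order_trans[of x 0])
      then show ?thesis using False by (simp add: ennreal_neg)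
    qed
  next
    case False
    then have "r = 0" using assms by simp
    then show ?thesis by (cases "0 < x") (auto simp: ennreal_eq_0_iff)
  qed
  then have "measure (clock k) {x. ennreal s < ennreal x / ennreal r} = measure (clock k) {x \<in> space (clock k). r * s < x}"
    by simp
  also have "\<dots> = exp (- r * s)"
    using prob_space.exponential_distributedD_gt[OF prob_space_clock D, of "r * s"] assms by simp
  finally show ?thesis .
qed

lemma AE_clock_coord: "AE x in clock k. P x \<Longrightarrow> AE \<omega> in clock_space. P (\<omega> k)"
  unfolding clock_space_def by (rule AE_PiM_component) (auto intro: prob_space_clock)

lemma AE_clock_even_not_in:
  assumes "countable A"
  shows "AE \<omega> in clock_space. \<forall>k. \<omega> (2 * k) \<in> {0..<1} - A"
  unfolding AE_all_countable
proof (intro allI AE_clock_coord)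
  fix k :: nat
  have "AE x in lborel. x \<notin> A" using assms by (intro AE_not_in countable_imp_null_set_lborel)
  then have "AE x in uniform_measure lborel {0..<1}. x \<in> {0..<1} - A"
    by (intro AE_uniform_measureI) (auto elim: eventually_mono)
  moreover have "clock (2 * k) = uniform_measure lborel {0..<1}" by (simp add: clock_def)
  ultimately show "AE x in clock (2 * k). x \<in> {0..<1} - A" by (simp only:)
qed

lemma AE_clock_odd_pos: "AE \<omega> in clock_space. \<forall>k. 0 < \<omega> (2 * k + 1)"
  unfolding AE_all_countable
proof (intro allI AE_clock_coord)
  fix k :: nat
  have D: "distributed (clock (2 * k + 1)) lborel (\<lambda>x. x) (exponential_density 1)"
    by (auto simp: distributed_def clock_def distr_id2)
  have "measure (clock (2 * k + 1)) {x \<in> space (clock (2 * k + 1)). 0 < x} = 1"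
    using prob_space.exponential_distributedD_gt[OF prob_space_clock D, of 0] by simp
  then have "AE x in clock (2 * k + 1). x \<in> {x. 0 < x}"
    by (intro clocks.M.AE_prob_1) simp
  then show "AE x in clock (2 * k + 1). 0 < x" by simp
qed

primrec jump_chain :: "(nat \<Rightarrow> real) \<Rightarrow> (nat \<Rightarrow> nat \<Rightarrow> real) \<Rightarrow> (nat \<Rightarrow> real) \<Rightarrow> nat \<Rightarrow> nat" where
  "jump_chain p0 q \<omega> 0 = sample p0 (\<omega> 0)"
| "jump_chain p0 q \<omega> (Suc k) = sample (jump_prob q (jump_chain p0 q \<omega> k)) (\<omega> (2 * Suc k))"

definition holding :: "(nat \<Rightarrow> real) \<Rightarrow> (nat \<Rightarrow> nat \<Rightarrow> real) \<Rightarrow> (nat \<Rightarrow> real) \<Rightarrow> nat \<Rightarrow> ennreal" where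
  "holding p0 q \<omega> k = ennreal (\<omega> (2 * k + 1)) / ennreal (total_rate q (jump_chain p0 q \<omega> k))"

lemma measurable_jump_chain: "(\<lambda>\<omega>. jump_chain p0 q \<omega> k) \<in> measurable clock_space (count_space UNIV)"
proof (induction k)
  case (Suc k)
  have "(\<lambda>\<omega>. sample (jump_prob q y) (\<omega> (2 * Suc k))) \<in> measurable clock_space (count_space UNIV)" for y
    by (rule measurable_compose[OF measurable_clock_coord measurable_sample])
  from measurable_compose_countable[OF this Suc] show ?case by simp
qed (simp add: measurable_compose[OF measurable_clock_coord measurable_sample])

lemma measurable_holding: "(\<lambda>\<omega>. holding p0 q \<omega> k) \<in> borel_measurable clock_space"
proof -
  have [measurable]: "(\<lambda>\<omega>. total_rate q (jump_chain p0 q \<omega> k)) \<in> borel_measurable clock_space"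
    by (rule measurable_compose[OF measurable_jump_chain]) simp
  show ?thesis unfolding holding_def by measurable
qed

locale jump_rates =
  fixes p0 :: "nat \<Rightarrow> real" and q :: "nat \<Rightarrow> nat \<Rightarrow> real"
  assumes p0_nonneg: "\<And>y. 0 \<le> p0 y" and p0_sums: "p0 sums 1"
    and q_nonneg: "\<And>y y'. 0 \<le> q y y'" and q_summable: "\<And>y. q y summable_on {y'. y' \<noteq> y}"
begin

lemma total_rate_nonneg: "0 \<le> total_rate q y"
  unfolding total_rate_def by (rule infsum_nonneg) (rule q_nonneg)

lemma jump_prob_nonneg: "0 \<le> jump_prob q y y'"
  using total_rate_nonneg q_nonneg by (simp add: jump_prob_def)

lemma jump_prob_sums: "jump_prob q y sums 1"
proof (cases "total_rate q y = 0")
  case True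
  then have "jump_prob q y = (\<lambda>y'. if y' = y then 1 else 0)" by (auto simp: jump_prob_def)
  then show ?thesis using sums_single[of y "\<lambda>_. 1::real"] by simp
next
  case False
  have "(q y has_sum total_rate q y) {y'. y' \<noteq> y}"
    unfolding total_rate_def using q_summable by (rule has_sum_infsum)
  then have "((\<lambda>y'. q y y' * (1 / total_rate q y)) has_sum (total_rate q y * (1 / total_rate q y))) {y'. y' \<noteq> y}"
    by (rule has_sum_cmult_left)
  then have "((\<lambda>y'. q y y' / total_rate q y) has_sum 1) {y'. y' \<noteq> y}" using False by simp
  then have "(jump_prob q y has_sum 1) UNIV"
    by (subst has_sum_cong_neutral[where T = "{y'. y' \<noteq> y}" and g = "\<lambda>y'. q y y' / total_rate q y"])
       (use False in \<open>auto simp: jump_prob_def\<close>)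
  then show ?thesis by (rule has_sum_imp_sums)
qed

lemma jump_chain_pos:
  assumes "\<And>k. \<omega> (2 * k) \<in> {0..<1}"
  shows "0 < p0 (jump_chain p0 q \<omega> 0)"
    and "0 < jump_prob q (jump_chain p0 q \<omega> k) (jump_chain p0 q \<omega> (Suc k))"
proof -
  show "0 < p0 (jump_chain p0 q \<omega> 0)"
    using assms[of 0] p0_sums by (simp add: sample_pos)
  show "0 < jump_prob q (jump_chain p0 q \<omega> k) (jump_chain p0 q \<omega> (Suc k))"
    using assms[of "Suc k"] jump_prob_sums by (simp add: sample_pos)
qed

lemma mjp_jump_law_chain: "mjp_jump_law clock_space q p0 (jump_chain p0 q) (holding p0 q)"
  unfolding mjp_jump_law_def
proof (intro conjI allI impI)
  fix m :: nat and ys :: "nat \<Rightarrow> nat" and ss :: "nat \<Rightarrow> real"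
  assume ss: "\<forall>k<m. 0 \<le> ss k"
  define B where "B i = (if i = 0 then {u. sample p0 u = ys 0}
     else if even i then {u. sample (jump_prob q (ys (i div 2 - 1))) u = ys (i div 2)}
     else {x. ennreal (ss (i div 2)) < ennreal x / ennreal (total_rate q (ys (i div 2)))})" for i
  have B_simps: "B 0 = {u. sample p0 u = ys 0}"
    "B (Suc (2 * k)) = {x. ennreal (ss k) < ennreal x / ennreal (total_rate q (ys k))}"
    "B (Suc (Suc (2 * k))) = {u. sample (jump_prob q (ys k)) u = ys (Suc k)}" for k
    by (auto simp: B_def)
  have B_sets: "B i \<in> sets (clock i)" for i
  proof -
    have "{u. sample p u = j} \<in> sets borel" for p j
      using measurable_sets[OF measurable_sample, of "{j}" p] by (simp add: vimage_def)
    moreover have "{x. a < ennreal x / b} \<in> sets borel" for a b by simp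
    ultimately show ?thesis by (simp add: B_def)
  qed
  have upto_Suc: "{..2 * Suc k} = insert (Suc (Suc (2 * k))) (insert (Suc (2 * k)) {..2 * k})" for k :: nat
    by auto
  have event: "(\<forall>k\<le>m. jump_chain p0 q \<omega> k = ys k) \<and> (\<forall>k<m. ennreal (ss k) < holding p0 q \<omega> k)
     \<longleftrightarrow> (\<forall>i\<in>{..2 * m}. \<omega> i \<in> B i)" for \<omega>
  proof (induction m)
    case 0
    then show ?case by (simp add: B_simps)
  next
    case (Suc m)
    have "(\<forall>k\<le>Suc m. jump_chain p0 q \<omega> k = ys k) \<and> (\<forall>k<Suc m. ennreal (ss k) < holding p0 q \<omega> k)
      \<longleftrightarrow> ((\<forall>k\<le>m. jump_chain p0 q \<omega> k = ys k) \<and> (\<forall>k<m. ennreal (ss k) < holding p0 q \<omega> k))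
        \<and> jump_chain p0 q \<omega> (Suc m) = ys (Suc m) \<and> ennreal (ss m) < holding p0 q \<omega> m"
      by (auto simp: le_Suc_eq less_Suc_eq simp del: jump_chain.simps)
    also have "\<dots> \<longleftrightarrow> ((\<forall>k\<le>m. jump_chain p0 q \<omega> k = ys k) \<and> (\<forall>k<m. ennreal (ss k) < holding p0 q \<omega> k))
        \<and> \<omega> (Suc (Suc (2 * m))) \<in> B (Suc (Suc (2 * m))) \<and> \<omega> (Suc (2 * m)) \<in> B (Suc (2 * m))"
      by (auto simp: B_simps holding_def)
    also have "\<dots> \<longleftrightarrow> (\<forall>i\<in>{..2 * Suc m}. \<omega> i \<in> B i)"
      unfolding Suc.IH upto_Suc by auto
    finally show ?case .
  qed
  have "measure clock_space {\<omega> \<in> space clock_space.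
      (\<forall>k\<le>m. jump_chain p0 q \<omega> k = ys k) \<and> (\<forall>k<m. ennreal (ss k) < holding p0 q \<omega> k)}
     = measure clock_space {\<omega> \<in> space clock_space. \<forall>i\<in>{..2 * m}. \<omega> i \<in> B i}"
    by (simp only: event)
  also have "\<dots> = (\<Prod>i\<le>2 * m. measure (clock i) (B i))"
    using clocks.emeasure_PiM_Collect[of "{..2 * m}" B] B_sets
    unfolding clock_space_def clocks.emeasure_eq_measure clocks.M.emeasure_eq_measure
    by (simp add: prod_ennreal prod_nonneg)
  also have "\<dots> = p0 (ys 0) * (\<Prod>k<m. jump_prob q (ys k) (ys (Suc k)) * exp (- total_rate q (ys k) * ss k))"
    using ss
  proof (induction m)
    case 0
    then show ?case by (simp add: B_simps measure_clock_even p0_nonneg p0_sums)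
  next
    case (Suc m)
    have "(\<Prod>i\<le>2 * Suc m. measure (clock i) (B i)) = measure (clock (Suc (Suc (2 * m)))) (B (Suc (Suc (2 * m))))
       * (measure (clock (Suc (2 * m))) (B (Suc (2 * m))) * (\<Prod>i\<le>2 * m. measure (clock i) (B i)))"
      unfolding upto_Suc by simp
    also have "\<dots> = jump_prob q (ys m) (ys (Suc m)) * (exp (- total_rate q (ys m) * ss m) * (\<Prod>i\<le>2 * m. measure (clock i) (B i)))"
      using Suc.prems
      by (simp add: B_simps measure_clock_even measure_clock_odd jump_prob_nonneg jump_prob_sums total_rate_nonneg)
    also have "(\<Prod>i\<le>2 * m. measure (clock i) (B i))
        = p0 (ys 0) * (\<Prod>k<m. jump_prob q (ys k) (ys (Suc k)) * exp (- total_rate q (ys k) * ss k))"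
      by (rule Suc.IH) (use Suc.prems in auto)
    finally show ?case by (simp only: prod.lessThan_Suc mult_ac)
  qed
  finally show "measure clock_space {\<omega> \<in> space clock_space.
      (\<forall>k\<le>m. jump_chain p0 q \<omega> k = ys k) \<and> (\<forall>k<m. ennreal (ss k) < holding p0 q \<omega> k)}
      = p0 (ys 0) * (\<Prod>k<m. jump_prob q (ys k) (ys (Suc k)) * exp (- total_rate q (ys k) * ss k))" .
qed (use prob_space_clock_space measurable_jump_chain measurable_holding in auto)

end

text \<open>Sampling all chains from the same uniform variables by inverse distribution functions couples
  them so that the first \<open>k\<close> jumps of the approximating chains eventually agree with those of the limit.\<close>

lemma (in jump_rates) jump_chain_eventually_eq:
  assumes pn: "\<And>n y. 0 \<le> pn n y" "\<And>y. (\<lambda>n. pn n y) \<longlonglongrightarrow> p0 y"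
    and qn: "\<And>n y y'. 0 \<le> jump_prob (qn n) y y'"
      "\<And>y y'. R y \<Longrightarrow> (\<lambda>n. jump_prob (qn n) y y') \<longlonglongrightarrow> jump_prob q y y'"
      "\<And>y. R y \<Longrightarrow> eventually (\<lambda>n. total_rate (qn n) y = total_rate q y) sequentially"
    and R: "\<And>y. 0 < p0 y \<Longrightarrow> R y" "\<And>y y'. R y \<Longrightarrow> 0 < jump_prob q y y' \<Longrightarrow> R y'"
    and \<omega>: "\<And>k. \<omega> (2 * k) \<in> {0..<1} - (range (\<lambda>j. \<Sum>i<j. p0 i) \<union> (\<Union>y. range (\<lambda>j. \<Sum>i<j. jump_prob q y i)))"
  shows "eventually (\<lambda>n. jump_chain (pn n) (qn n) \<omega> k = jump_chain p0 q \<omega> k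
     \<and> holding (pn n) (qn n) \<omega> k = holding p0 q \<omega> k) sequentially"
proof -
  have R_chain: "R (jump_chain p0 q \<omega> k)" for k
  proof (induction k)
    case 0
    then show ?case using jump_chain_pos(1)[of \<omega>] \<omega> R(1) by auto
  next
    case (Suc k)
    then show ?case using jump_chain_pos(2)[of \<omega> k] \<omega> R(2) by blast
  qed
  have chain: "eventually (\<lambda>n. jump_chain (pn n) (qn n) \<omega> k = jump_chain p0 q \<omega> k) sequentially" for k
  proof (induction k)
    case 0
    have "eventually (\<lambda>n. sample (pn n) (\<omega> 0) = sample p0 (\<omega> 0)) sequentially"
      using \<omega>[of 0] by (intro sample_eventually_eq p0_sums pn) auto
    then show ?case by simp
  next
    case (Suc k)
    have "eventually (\<lambda>n. sample (jump_prob (qn n) (jump_chain p0 q \<omega> k)) (\<omega> (2 * Suc k))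
        = sample (jump_prob q (jump_chain p0 q \<omega> k)) (\<omega> (2 * Suc k))) sequentially"
      using \<omega>[of "Suc k"] by (intro sample_eventually_eq jump_prob_sums qn(1) qn(2) R_chain) auto
    with Suc show ?case by eventually_elim simp
  qed
  show ?thesis
    using chain[of k] qn(3)[OF R_chain[of k]] by eventually_elim (simp add: holding_def)
qed

section \<open>The block-counting process\<close>

lemma sum_PiE_insert:
  assumes "x \<notin> I"
  shows "(\<Sum>ys\<in>PiE (insert x I) A. f ys) = (\<Sum>g\<in>PiE I A. \<Sum>y\<in>A x. f (g(x := y)))"
proof -
  have "(\<Sum>ys\<in>PiE (insert x I) A. f ys) = (\<Sum>(y, g)\<in>A x \<times> PiE I A. f (g(x := y)))"
    unfolding PiE_insert_eq using inj_combinator[OF assms, of A]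
    by (subst sum.reindex) (auto simp: case_prod_beta comp_def)
  also have "\<dots> = (\<Sum>y\<in>A x. \<Sum>g\<in>PiE I A. f (g(x := y)))" by (rule sum.cartesian_product[symmetric])
  also have "\<dots> = (\<Sum>g\<in>PiE I A. \<Sum>y\<in>A x. f (g(x := y)))" by (rule sum.swap)
  finally show ?thesis .
qed

lemma sum_path_weights:
  fixes J :: "nat \<Rightarrow> 's \<Rightarrow> 's \<Rightarrow> real"
  assumes "\<And>k y. k < m \<Longrightarrow> y \<in> A k \<Longrightarrow> (\<Sum>y'\<in>A (Suc k). J k y y') = \<alpha> k"
  shows "(\<Sum>ys\<in>PiE {..m} A. f (ys 0) * (\<Prod>k<m. J k (ys k) (ys (Suc k)))) = (\<Sum>y\<in>A 0. f y) * (\<Prod>k<m. \<alpha> k)"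
  using assms
proof (induction m)
  case 0
  have "(\<Sum>ys\<in>PiE (insert 0 {}) A. f (ys 0)) = (\<Sum>y\<in>A 0. f y)"
    by (subst sum_PiE_insert) auto
  then show ?case by (simp add: atMost_0)
next
  case (Suc m)
  have "(\<Sum>ys\<in>PiE {..Suc m} A. f (ys 0) * (\<Prod>k<Suc m. J k (ys k) (ys (Suc k))))
      = (\<Sum>g\<in>PiE {..m} A. \<Sum>y\<in>A (Suc m). f (g 0) * (\<Prod>k<m. J k (g k) (g (Suc k))) * J m (g m) y)"
    unfolding atMost_Suc by (subst sum_PiE_insert) (auto intro!: sum.cong prod.cong simp: mult.assoc)
  also have "\<dots> = (\<Sum>g\<in>PiE {..m} A. f (g 0) * (\<Prod>k<m. J k (g k) (g (Suc k))) * \<alpha> m)"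
  proof (rule sum.cong)
    fix g assume "g \<in> PiE {..m} A"
    then have "g m \<in> A m" by auto
    then show "(\<Sum>y\<in>A (Suc m). f (g 0) * (\<Prod>k<m. J k (g k) (g (Suc k))) * J m (g m) y)
        = f (g 0) * (\<Prod>k<m. J k (g k) (g (Suc k))) * \<alpha> m"
      using Suc.prems[of m "g m"] by (simp flip: sum_distrib_left)
  qed simp
  also have "\<dots> = (\<Sum>y\<in>A 0. f y) * (\<Prod>k<Suc m. \<alpha> k)"
    using Suc by (simp flip: sum_distrib_right)
  finally show ?case .
qed

lemma mjp_jump_law_sets:
  fixes Y :: "'a \<Rightarrow> nat \<Rightarrow> 's"
  assumes law: "mjp_jump_law M q p0 Y S" and ss: "\<And>k. k < m \<Longrightarrow> 0 \<le> ss k"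
    and A: "\<And>k. k \<le> m \<Longrightarrow> finite (A k)"
  shows "measure M {\<omega> \<in> space M. (\<forall>k\<le>m. Y \<omega> k \<in> A k) \<and> (\<forall>k<m. ennreal (ss k) < S \<omega> k)}
    = (\<Sum>ys\<in>PiE {..m} A. p0 (ys 0) * (\<Prod>k<m. jump_prob q (ys k) (ys (Suc k)) * exp (- total_rate q (ys k) * ss k)))"
proof -
  interpret prob_space M using law by (simp add: mjp_jump_law_def)
  have [measurable]: "(\<lambda>\<omega>. Y \<omega> k) \<in> measurable M (count_space UNIV)" "(\<lambda>\<omega>. S \<omega> k) \<in> borel_measurable M" for k
    using law by (auto simp: mjp_jump_law_def)
  define E where "E ys = {\<omega> \<in> space M. (\<forall>k\<le>m. Y \<omega> k = ys k) \<and> (\<forall>k<m. ennreal (ss k) < S \<omega> k)}" for ys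
  have E_sets: "E ys \<in> sets M" for ys unfolding E_def by measurable
  have "{\<omega> \<in> space M. (\<forall>k\<le>m. Y \<omega> k \<in> A k) \<and> (\<forall>k<m. ennreal (ss k) < S \<omega> k)} = (\<Union>ys\<in>PiE {..m} A. E ys)"
  proof (intro set_eqI iffI)
    fix \<omega> assume "\<omega> \<in> {\<omega> \<in> space M. (\<forall>k\<le>m. Y \<omega> k \<in> A k) \<and> (\<forall>k<m. ennreal (ss k) < S \<omega> k)}"
    then show "\<omega> \<in> (\<Union>ys\<in>PiE {..m} A. E ys)"
      by (intro UN_I[of "restrict (Y \<omega>) {..m}"]) (auto simp: E_def)
  qed (auto simp: E_def)
  also have "measure M \<dots> = (\<Sum>ys\<in>PiE {..m} A. measure M (E ys))"
  proof (rule finite_measure_finite_Union)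
    show "finite (PiE {..m} A)" using A by (intro finite_PiE) auto
    show "disjoint_family_on E (PiE {..m} A)"
      unfolding disjoint_family_on_def
    proof (intro ballI impI)
      fix ys zs assume "ys \<in> PiE {..m} A" "zs \<in> PiE {..m} A" "ys \<noteq> zs"
      then obtain k where "k \<le> m" "ys k \<noteq> zs k" by (metis PiE_ext atMost_iff)
      then show "E ys \<inter> E zs = {}" by (auto simp: E_def)
    qed
  qed (use E_sets in auto)
  also have "\<dots> = (\<Sum>ys\<in>PiE {..m} A. p0 (ys 0) * (\<Prod>k<m. jump_prob q (ys k) (ys (Suc k)) * exp (- total_rate q (ys k) * ss k)))"
    using law ss unfolding mjp_jump_law_def E_def by simp
  finally show ?thesis .
qed

lemma infsum_finite_support:
  fixes f :: "'b \<Rightarrow> real"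
  assumes "finite T" "T \<subseteq> A" "\<And>x. x \<in> A - T \<Longrightarrow> f x = 0"
  shows "infsum f A = sum f T"
proof -
  have "infsum f A = infsum f T"
    by (rule infsum_cong_neutral) (use assms in auto)
  then show ?thesis using assms(1) by simp
qed

definition partitions :: "nat \<Rightarrow> nat set set set" where
  "partitions n = {\<pi>. partition_on {1..n} \<pi>}"

lemma finite_partitions: "finite (partitions n)"
  unfolding partitions_def by (rule finitely_many_partition_on) simp

definition merge_blocks :: "nat set set \<Rightarrow> nat set set \<Rightarrow> nat set set" where
  "merge_blocks \<pi> B = insert (\<Union>B) (\<pi> - B)"

context lambda_coalescent
begin

lemma coal_rate_merge:
  "coal_rate \<Lambda> \<pi> \<pi>' = (\<Sum>B \<in> {B. B \<subseteq> \<pi> \<and> 2 \<le> card B \<and> \<pi>' = merge_blocks \<pi> B}. lam \<Lambda> (card \<pi>) (card B))"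
  by (simp add: coal_rate_def merge_blocks_def)

lemma rho_eq_0: "i \<le> j \<or> j = 0 \<Longrightarrow> \<rho> i j = 0"
  by (auto simp: rho_def)

lemma total_rate_rho: "total_rate (\<rho>) i = \<rho>_tot i"
  unfolding total_rate_def rho_tot_def
  by (rule infsum_finite_support) (auto simp: rho_def)

context
  fixes n :: nat and \<pi> :: "nat set set"
  assumes \<pi>: "\<pi> \<in> partitions n"
begin

private lemma partition_\<pi>: "partition_on {1..n} \<pi>"
  using \<pi> by (simp add: partitions_def)

private lemma finite_\<pi>: "finite \<pi>"
  using partition_\<pi> by (rule finite_elements[rotated]) simp

private lemma merge:
  assumes B: "B \<subseteq> \<pi>" "2 \<le> card B"
  shows "merge_blocks \<pi> B \<in> partitions n" "card (merge_blocks \<pi> B) = card \<pi> - card B + 1"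
proof -
  have ne: "B \<noteq> {}" using B by auto
  have disj: "\<Union>B \<inter> \<Union>(\<pi> - B) = {}"
  proof (rule ccontr)
    assume "\<Union>B \<inter> \<Union>(\<pi> - B) \<noteq> {}"
    then obtain x C D where "C \<in> B" "D \<in> \<pi> - B" "x \<in> C" "x \<in> D" by blast
    then show False using disjointD[OF partition_onD2[OF partition_\<pi>], of C D] B(1) by blast
  qed
  have nonempty: "{} \<notin> \<pi>" using partition_\<pi> by (rule partition_onD3)
  obtain C where C: "C \<in> B" using ne by blast
  then have "C \<noteq> {}" using nonempty B(1) by blast
  then have U: "\<Union>B \<noteq> {}" using C by blast
  have "\<Union>B \<notin> \<pi> - B" using disj U by blast
  moreover have "card (\<pi> - B) = card \<pi> - card B"
    using B(1) finite_\<pi> by (intro card_Diff_subset) (auto intro: finite_subset)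
  ultimately show "card (merge_blocks \<pi> B) = card \<pi> - card B + 1"
    using finite_\<pi> by (simp add: merge_blocks_def)
  have "partition_on {1..n} (insert (\<Union>B) (\<pi> - B))"
  proof (rule partition_onI)
    have "\<Union>(insert (\<Union>B) (\<pi> - B)) = \<Union>\<pi>" using B(1) by blast
    also have "\<dots> = {1..n}" using partition_onD1[OF partition_\<pi>] ..
    finally show "\<Union>(insert (\<Union>B) (\<pi> - B)) = {1..n}" .
    show "{} \<notin> insert (\<Union>B) (\<pi> - B)" using U nonempty by auto
    show "disjnt C D" if "C \<in> insert (\<Union>B) (\<pi> - B)" "D \<in> insert (\<Union>B) (\<pi> - B)" "C \<noteq> D" for C D
      using that disj partition_onD2[OF partition_\<pi>] unfolding disjnt_def disjoint_def by blast
  qed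
  then show "merge_blocks \<pi> B \<in> partitions n" by (simp add: partitions_def merge_blocks_def)
qed

lemma coal_rate_eq_0:
  assumes "\<not> (\<pi>' \<in> partitions n \<and> card \<pi>' < card \<pi>)"
  shows "coal_rate \<Lambda> \<pi> \<pi>' = 0"
proof -
  have "{B. B \<subseteq> \<pi> \<and> 2 \<le> card B \<and> \<pi>' = merge_blocks \<pi> B} = {}"
  proof (rule ccontr)
    assume "{B. B \<subseteq> \<pi> \<and> 2 \<le> card B \<and> \<pi>' = merge_blocks \<pi> B} \<noteq> {}"
    then obtain B where B: "B \<subseteq> \<pi>" "2 \<le> card B" "\<pi>' = merge_blocks \<pi> B" by blast
    have "card B \<le> card \<pi>" using B(1) finite_\<pi> by (rule card_mono[rotated])
    with merge[OF B(1,2)] B assms show False by auto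
  qed
  then show ?thesis unfolding coal_rate_merge by (simp only: sum.empty)
qed

lemma sum_coal_rate: "(\<Sum>\<pi>'\<in>{\<pi>' \<in> partitions n. card \<pi>' = j}. coal_rate \<Lambda> \<pi> \<pi>') = \<rho> (card \<pi>) j"
proof -
  let ?T = "{\<pi>' \<in> partitions n. card \<pi>' = j}"
  let ?b = "card \<pi>"
  define S where "S = {B. B \<subseteq> \<pi> \<and> 2 \<le> card B \<and> ?b - card B + 1 = j}"
  have T: "finite ?T" by (simp add: finite_partitions)
  have S: "finite S" unfolding S_def using finite_\<pi> by simp
  have "(\<Sum>\<pi>'\<in>?T. coal_rate \<Lambda> \<pi> \<pi>') = (\<Sum>\<pi>'\<in>?T. \<Sum>B\<in>{B \<in> S. merge_blocks \<pi> B = \<pi>'}. lam \<Lambda> ?b (card B))"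
    unfolding coal_rate_merge
  proof (intro sum.cong refl)
    fix \<pi>' assume "\<pi>' \<in> ?T"
    then show "{B. B \<subseteq> \<pi> \<and> 2 \<le> card B \<and> \<pi>' = merge_blocks \<pi> B} = {B \<in> S. merge_blocks \<pi> B = \<pi>'}"
      unfolding S_def using merge(2) by auto
  qed
  also have "\<dots> = (\<Sum>B\<in>S. lam \<Lambda> ?b (card B))"
    by (rule sum.group[OF S T]) (use merge in \<open>auto simp: S_def\<close>)
  also have "\<dots> = \<rho> ?b j"
  proof (cases "1 \<le> j \<and> j < ?b")
    case True
    have "S = {B. B \<subseteq> \<pi> \<and> card B = ?b - j + 1}"
    proof (intro set_eqI iffI)
      fix B assume "B \<in> S"
      then show "B \<in> {B. B \<subseteq> \<pi> \<and> card B = ?b - j + 1}"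
        using card_mono[OF finite_\<pi>, of B] by (auto simp: S_def)
    next
      fix B assume "B \<in> {B. B \<subseteq> \<pi> \<and> card B = ?b - j + 1}"
      then show "B \<in> S" using True by (auto simp: S_def)
    qed
    then have "(\<Sum>B\<in>S. lam \<Lambda> ?b (card B)) = real (card {B. B \<subseteq> \<pi> \<and> card B = ?b - j + 1}) * lam \<Lambda> ?b (?b - j + 1)"
      by simp
    also have "\<dots> = \<rho> ?b j" using n_subsets[OF finite_\<pi>, of "?b - j + 1"] True by (simp add: rho_def)
    finally show ?thesis .
  next
    case False
    have "S = {}"
    proof (rule ccontr)
      assume "S \<noteq> {}"
      then obtain B where "B \<subseteq> \<pi>" "2 \<le> card B" "?b - card B + 1 = j" by (auto simp: S_def)
      with card_mono[OF finite_\<pi>, of B] False show False by linarith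
    qed
    then show ?thesis using False by (auto simp: rho_def)
  qed
  finally show ?thesis .
qed

lemma sum_coal_rate_all: "(\<Sum>\<pi>'\<in>partitions n. coal_rate \<Lambda> \<pi> \<pi>') = \<rho>_tot (card \<pi>)"
proof -
  let ?b = "card \<pi>"
  have "(\<Sum>\<pi>'\<in>partitions n. coal_rate \<Lambda> \<pi> \<pi>')
      = (\<Sum>j\<in>card ` partitions n. \<Sum>\<pi>'\<in>{\<pi>' \<in> partitions n. card \<pi>' = j}. coal_rate \<Lambda> \<pi> \<pi>')"
    by (rule sum.group[symmetric]) (auto simp: finite_partitions)
  also have "\<dots> = (\<Sum>j\<in>card ` partitions n. \<rho> ?b j)"
    by (simp only: sum_coal_rate)
  also have "\<dots> = (\<Sum>j\<in>card ` partitions n \<union> {1..<?b}. \<rho> ?b j)"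
  proof (rule sum.mono_neutral_left)
    show "\<forall>j\<in>card ` partitions n \<union> {1..<?b} - card ` partitions n. \<rho> ?b j = 0"
    proof
      fix j assume "j \<in> card ` partitions n \<union> {1..<?b} - card ` partitions n"
      then have "{\<pi>' \<in> partitions n. card \<pi>' = j} = {}" by auto
      then show "\<rho> ?b j = 0" using sum_coal_rate[of j] by (simp only: sum.empty)
    qed
  qed (auto simp: finite_partitions)
  also have "\<dots> = (\<Sum>j\<in>{1..<?b}. \<rho> ?b j)"
    by (rule sum.mono_neutral_right) (auto simp: rho_def finite_partitions)
  finally show ?thesis by (simp add: rho_tot_def)
qed

lemma total_rate_coal: "total_rate (coal_rate \<Lambda>) \<pi> = \<rho>_tot (card \<pi>)"
proof -
  have "total_rate (coal_rate \<Lambda>) \<pi> = (\<Sum>\<pi>'\<in>partitions n - {\<pi>}. coal_rate \<Lambda> \<pi> \<pi>')"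
    unfolding total_rate_def
    by (rule infsum_finite_support) (auto simp: finite_partitions coal_rate_eq_0)
  also have "\<dots> = (\<Sum>\<pi>'\<in>partitions n. coal_rate \<Lambda> \<pi> \<pi>')"
    by (rule sum.mono_neutral_left) (auto simp: finite_partitions coal_rate_eq_0)
  finally show ?thesis by (simp only: sum_coal_rate_all)
qed

lemma jump_prob_coal:
  "jump_prob (coal_rate \<Lambda>) \<pi> \<pi>' = (if \<rho>_tot (card \<pi>) = 0 then (if \<pi>' = \<pi> then 1 else 0)
     else coal_rate \<Lambda> \<pi> \<pi>' / \<rho>_tot (card \<pi>))"
  using coal_rate_eq_0[of \<pi>] by (simp add: jump_prob_def total_rate_coal)

lemma sum_jump_prob_coal:
  "(\<Sum>\<pi>'\<in>{\<pi>' \<in> partitions n. card \<pi>' = j}. jump_prob (coal_rate \<Lambda>) \<pi> \<pi>') = jump_prob (\<rho>) (card \<pi>) j"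
proof (cases "\<rho>_tot (card \<pi>) = 0")
  case True
  then have "(\<Sum>\<pi>'\<in>{\<pi>' \<in> partitions n. card \<pi>' = j}. jump_prob (coal_rate \<Lambda>) \<pi> \<pi>')
      = (\<Sum>\<pi>'\<in>{\<pi>' \<in> partitions n. card \<pi>' = j}. if \<pi>' = \<pi> then 1 else 0)"
    by (simp only: jump_prob_coal if_True simp_thms)
  then show ?thesis using True \<pi> finite_partitions[of n] by (simp add: jump_prob_def total_rate_rho)
next
  case False
  then have "(\<Sum>\<pi>'\<in>{\<pi>' \<in> partitions n. card \<pi>' = j}. jump_prob (coal_rate \<Lambda>) \<pi> \<pi>')
      = (\<Sum>\<pi>'\<in>{\<pi>' \<in> partitions n. card \<pi>' = j}. coal_rate \<Lambda> \<pi> \<pi>' / \<rho>_tot (card \<pi>))"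
    by (simp only: jump_prob_coal if_False)
  also have "\<dots> = \<rho> (card \<pi>) j / \<rho>_tot (card \<pi>)"
    by (simp only: sum_coal_rate sum_divide_distrib[symmetric])
  finally show ?thesis using False by (simp add: rho_eq_0 jump_prob_def total_rate_rho)
qed

lemma sum_jump_prob_coal_all: "(\<Sum>\<pi>'\<in>partitions n. jump_prob (coal_rate \<Lambda>) \<pi> \<pi>') = 1"
proof (cases "\<rho>_tot (card \<pi>) = 0")
  case True
  then have "(\<Sum>\<pi>'\<in>partitions n. jump_prob (coal_rate \<Lambda>) \<pi> \<pi>') = (\<Sum>\<pi>'\<in>partitions n. if \<pi>' = \<pi> then 1 else 0)"
    by (simp only: jump_prob_coal if_True simp_thms)
  then show ?thesis using \<pi> finite_partitions[of n] by simp
next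
  case False
  then have "(\<Sum>\<pi>'\<in>partitions n. jump_prob (coal_rate \<Lambda>) \<pi> \<pi>')
      = (\<Sum>\<pi>'\<in>partitions n. coal_rate \<Lambda> \<pi> \<pi>' / \<rho>_tot (card \<pi>))"
    by (simp only: jump_prob_coal if_False)
  then show ?thesis using False by (simp add: sum_coal_rate_all sum_divide_distrib[symmetric])
qed

end

lemma block_count_jump_law:
  assumes law: "mjp_jump_law M (coal_rate \<Lambda>) (coal_init n) Y S"
  shows "mjp_jump_law M (\<rho>) (\<lambda>i. if i = n then 1 else 0) (\<lambda>\<omega> k. card (Y \<omega> k)) S"
  unfolding mjp_jump_law_def
proof (intro conjI allI impI)
  show "prob_space M" using law by (simp add: mjp_jump_law_def)
  then interpret prob_space M .
  have [measurable]: "(\<lambda>\<omega>. Y \<omega> k) \<in> measurable M (count_space UNIV)" "(\<lambda>\<omega>. S \<omega> k) \<in> borel_measurable M" for k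
    using law by (auto simp: mjp_jump_law_def)
  show S: "(\<lambda>\<omega>. S \<omega> k) \<in> borel_measurable M" for k by simp
  show C [measurable]: "(\<lambda>\<omega>. card (Y \<omega> k)) \<in> measurable M (count_space UNIV)" for k
    by (rule measurable_compose[of "\<lambda>\<omega>. Y \<omega> k" M "count_space UNIV"]) auto
  define P where "P = partitions n"
  have fin: "finite P" unfolding P_def by (rule finite_partitions)
  let ?\<sigma> = "(\<lambda>i. {i}) ` {1..n}"
  have "partition_on {1..n} ?\<sigma>" by (rule partition_onI) (auto simp: disjnt_def)
  then have \<sigma>: "?\<sigma> \<in> P" "card ?\<sigma> = n" by (auto simp: P_def partitions_def card_image)
  fix m :: nat and zs :: "nat \<Rightarrow> nat" and ss :: "nat \<Rightarrow> real"
  assume ss: "\<forall>k<m. 0 \<le> ss k"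
  have "prob {\<omega> \<in> space M. (\<forall>k\<le>m. Y \<omega> k \<in> P) \<and> (\<forall>k<m. ennreal 0 < S \<omega> k)} = 1"
  proof -
    have "prob {\<omega> \<in> space M. (\<forall>k\<le>m. Y \<omega> k \<in> P) \<and> (\<forall>k<m. ennreal 0 < S \<omega> k)}
      = (\<Sum>ys\<in>PiE {..m} (\<lambda>_. P). coal_init n (ys 0) * (\<Prod>k<m. jump_prob (coal_rate \<Lambda>) (ys k) (ys (Suc k))))"
      by (subst mjp_jump_law_sets[OF law, where ss = "\<lambda>_. 0"]) (auto simp: fin)
    also have "\<dots> = (\<Sum>\<pi>\<in>P. coal_init n \<pi>) * (\<Prod>k<m. 1)"
      by (rule sum_path_weights[where J = "\<lambda>_. jump_prob (coal_rate \<Lambda>)"]) (auto simp: P_def sum_jump_prob_coal_all)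
    also have "\<dots> = 1" using \<sigma> fin by (simp add: coal_init_def)
    finally show ?thesis .
  qed
  from AE_prob_1[OF this] have AE_P: "AE \<omega> in M. \<forall>k\<le>m. Y \<omega> k \<in> P" by eventually_elim auto
  define A where "A k = {\<pi> \<in> partitions n. card \<pi> = zs k}" for k
  have finA: "finite (A k)" for k using fin by (rule rev_finite_subset) (auto simp: A_def P_def)
  have "prob {\<omega> \<in> space M. (\<forall>k\<le>m. card (Y \<omega> k) = zs k) \<and> (\<forall>k<m. ennreal (ss k) < S \<omega> k)}
     = prob {\<omega> \<in> space M. (\<forall>k\<le>m. Y \<omega> k \<in> A k) \<and> (\<forall>k<m. ennreal (ss k) < S \<omega> k)}"
  proof (rule finite_measure_eq_AE)
    show "AE \<omega> in M. (\<omega> \<in> {\<omega> \<in> space M. (\<forall>k\<le>m. card (Y \<omega> k) = zs k) \<and> (\<forall>k<m. ennreal (ss k) < S \<omega> k)})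
      \<longleftrightarrow> (\<omega> \<in> {\<omega> \<in> space M. (\<forall>k\<le>m. Y \<omega> k \<in> A k) \<and> (\<forall>k<m. ennreal (ss k) < S \<omega> k)})"
      using AE_P by eventually_elim (auto simp: A_def P_def)
    have [measurable]: "Measurable.pred M (\<lambda>\<omega>. Y \<omega> k \<in> A k)" for k
      by (rule measurable_compose[of "\<lambda>\<omega>. Y \<omega> k" M "count_space UNIV"]) auto
    show "{\<omega> \<in> space M. (\<forall>k\<le>m. Y \<omega> k \<in> A k) \<and> (\<forall>k<m. ennreal (ss k) < S \<omega> k)} \<in> sets M"
      by measurable
    show "{\<omega> \<in> space M. (\<forall>k\<le>m. card (Y \<omega> k) = zs k) \<and> (\<forall>k<m. ennreal (ss k) < S \<omega> k)} \<in> sets M"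
      by measurable
  qed
  also have "\<dots> = (\<Sum>ys\<in>PiE {..m} A. coal_init n (ys 0)
      * (\<Prod>k<m. jump_prob (coal_rate \<Lambda>) (ys k) (ys (Suc k)) * exp (- total_rate (coal_rate \<Lambda>) (ys k) * ss k)))"
    by (rule mjp_jump_law_sets[OF law]) (use ss finA in auto)
  also have "\<dots> = (\<Sum>\<pi>\<in>A 0. coal_init n \<pi>)
      * (\<Prod>k<m. jump_prob (\<rho>) (zs k) (zs (Suc k)) * exp (- total_rate (\<rho>) (zs k) * ss k))"
  proof (rule sum_path_weights[where J = "\<lambda>k \<pi> \<pi>'. jump_prob (coal_rate \<Lambda>) \<pi> \<pi>' * exp (- total_rate (coal_rate \<Lambda>) \<pi> * ss k)"])
    fix k \<pi> assume "\<pi> \<in> A k"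
    then have \<pi>: "\<pi> \<in> partitions n" "card \<pi> = zs k" by (auto simp: A_def)
    show "(\<Sum>\<pi>'\<in>A (Suc k). jump_prob (coal_rate \<Lambda>) \<pi> \<pi>' * exp (- total_rate (coal_rate \<Lambda>) \<pi> * ss k))
      = jump_prob (\<rho>) (zs k) (zs (Suc k)) * exp (- total_rate (\<rho>) (zs k) * ss k)"
      unfolding sum_distrib_right[symmetric] A_def sum_jump_prob_coal[OF \<pi>(1)] total_rate_coal[OF \<pi>(1)]
        total_rate_rho \<pi>(2) ..
  qed
  also have "(\<Sum>\<pi>\<in>A 0. coal_init n \<pi>) = (if zs 0 = n then 1 else 0)"
    using \<sigma> finA[of 0] by (auto simp: coal_init_def A_def P_def)
  finally show "prob {\<omega> \<in> space M. (\<forall>k\<le>m. card (Y \<omega> k) = zs k) \<and> (\<forall>k<m. ennreal (ss k) < S \<omega> k)}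
     = (if zs 0 = n then 1 else 0)
      * (\<Prod>k<m. jump_prob (\<rho>) (zs k) (zs (Suc k)) * exp (- total_rate (\<rho>) (zs k) * ss k))" .
qed

end

section \<open>Laws determined by holding times\<close>

lemma (in finite_measure) integral_partition:
  fixes f :: "'a \<Rightarrow> real"
  assumes I: "finite I" and A: "\<And>i. i \<in> I \<Longrightarrow> A i \<in> sets M" "disjoint_family_on A I"
    and cover: "AE \<omega> in M. \<exists>i\<in>I. \<omega> \<in> A i"
    and f: "f \<in> borel_measurable M" "\<And>\<omega>. \<bar>f \<omega>\<bar> \<le> B"
  shows "(\<integral>\<omega>. f \<omega> \<partial>M) = (\<Sum>i\<in>I. \<integral>\<omega>. indicator (A i) \<omega> * f \<omega> \<partial>M)"
proof -
  have [measurable]: "i \<in> I \<Longrightarrow> A i \<in> sets M" for i by (rule A)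
  note f(1)[measurable]
  have "integrable M (\<lambda>\<omega>. indicator (A i) \<omega> * f \<omega>)" if "i \<in> I" for i
  proof (rule integrable_const_bound[where B = B])
    have "\<bar>indicator (A i) \<omega> * f \<omega>\<bar> \<le> B" for \<omega>
      using f(2)[of \<omega>] by (auto simp: indicator_def)
    then show "AE \<omega> in M. norm (indicator (A i) \<omega> * f \<omega>) \<le> B" by simp
  qed (use that in measurable)
  then have "(\<Sum>i\<in>I. \<integral>\<omega>. indicator (A i) \<omega> * f \<omega> \<partial>M) = (\<integral>\<omega>. (\<Sum>i\<in>I. indicator (A i) \<omega> * f \<omega>) \<partial>M)"
    by (intro Bochner_Integration.integral_sum[symmetric]) auto
  also have "\<dots> = (\<integral>\<omega>. f \<omega> \<partial>M)"
  proof (rule integral_cong_AE)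
    show "AE \<omega> in M. (\<Sum>i\<in>I. indicator (A i) \<omega> * f \<omega>) = f \<omega>"
      using cover
    proof eventually_elim
      case (elim \<omega>)
      then obtain i where i: "i \<in> I" "\<omega> \<in> A i" by blast
      have "(\<Sum>j\<in>I. indicator (A j) \<omega> * f \<omega>) = (\<Sum>j\<in>{i}. indicator (A j) \<omega> * f \<omega>)"
        using i I A(2) by (intro sum.mono_neutral_right) (auto simp: disjoint_family_on_def indicator_def)
      then show ?case using i by simp
    qed
  qed measurable
  finally show ?thesis ..
qed

lemma sets_PiM_greaterThan:
  assumes "finite I"
  shows "sets (PiM I (\<lambda>_. borel :: real measure))
    = sigma_sets (PiE I (\<lambda>_. UNIV)) (range (\<lambda>s. {f \<in> PiE I (\<lambda>_. UNIV). \<forall>i\<in>I. s i < f i}))"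
proof -
  define P where "P = {{f \<in> PiE I (\<lambda>_. UNIV). \<forall>i\<in>j. f i \<in> A i} | A j. j \<in> {I} \<and> A \<in> Pi j (\<lambda>_. range (greaterThan :: real \<Rightarrow> _))}"
  have P_eq: "P = range (\<lambda>s. {f \<in> PiE I (\<lambda>_. UNIV). \<forall>i\<in>I. s i < f i})"
  proof (intro set_eqI iffI)
    fix X assume "X \<in> P"
    then obtain A where X: "X = {f \<in> PiE I (\<lambda>_. UNIV). \<forall>i\<in>I. f i \<in> A i}" and A: "\<And>i. i \<in> I \<Longrightarrow> A i \<in> range greaterThan"
      unfolding P_def by auto
    define s where "s i = (SOME x. A i = {x<..})" for i
    have "A i = {s i<..}" if "i \<in> I" for i
      unfolding s_def by (rule someI_ex) (use A[OF that] in auto)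
    then have "X = {f \<in> PiE I (\<lambda>_. UNIV). \<forall>i\<in>I. s i < f i}" unfolding X by auto
    then show "X \<in> range (\<lambda>s. {f \<in> PiE I (\<lambda>_. UNIV). \<forall>i\<in>I. s i < f i})" by blast
  next
    fix X assume "X \<in> range (\<lambda>s. {f \<in> PiE I (\<lambda>_. UNIV :: real set). \<forall>i\<in>I. s i < f i})"
    then obtain s where "X = {f \<in> PiE I (\<lambda>_. UNIV). \<forall>i\<in>I. s i < f i}" by auto
    then show "X \<in> P" unfolding P_def by (intro CollectI exI[of _ "\<lambda>i. {s i<..}"] exI[of _ I]) auto
  qed
  have "sets (PiM I (\<lambda>_. borel :: real measure)) = sets (\<Pi>\<^sub>M i\<in>I. sigma UNIV (range greaterThan))"
    by (simp only: borel_Ioi)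
  also have "\<dots> = sets (sigma (PiE I (\<lambda>_. UNIV)) P)"
    unfolding P_def
  proof (rule sets_PiM_sigma)
    show "\<exists>S\<subseteq>range greaterThan. countable S \<and> (UNIV :: real set) = \<Union>S"
    proof (intro exI[of _ "range (\<lambda>n::nat. {- real n<..})"] conjI)
      show "(UNIV :: real set) = (\<Union>n::nat. {- real n<..})"
      proof (intro set_eqI iffI UNIV_I)
        fix x :: real
        obtain n :: nat where "- x < real n" using reals_Archimedean2 by blast
        then show "x \<in> (\<Union>n::nat. {- real n<..})" by (intro UN_I[of n]) auto
      qed
    qed auto
  qed (use assms in auto)
  also have "\<dots> = sigma_sets (PiE I (\<lambda>_. UNIV)) P"
    by (rule sets_measure_of) (auto simp: P_def)
  finally show ?thesis unfolding P_eq .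
qed

lemma integral_eq_if_orthants_eq:
  fixes V1 :: "'a \<Rightarrow> nat \<Rightarrow> real" and V2 :: "'b \<Rightarrow> nat \<Rightarrow> real"
  assumes M: "finite_measure M1" "finite_measure M2" and A: "A1 \<in> sets M1" "A2 \<in> sets M2"
    and V: "\<And>j. (\<lambda>\<omega>. V1 \<omega> j) \<in> borel_measurable M1" "\<And>j. (\<lambda>\<omega>. V2 \<omega> j) \<in> borel_measurable M2"
    and pos: "\<And>\<omega> j. \<omega> \<in> A1 \<Longrightarrow> j < m \<Longrightarrow> 0 < V1 \<omega> j" "\<And>\<omega> j. \<omega> \<in> A2 \<Longrightarrow> j < m \<Longrightarrow> 0 < V2 \<omega> j"
    and eq: "\<And>s. (\<And>j. 0 \<le> s j) \<Longrightarrow> measure M1 {\<omega> \<in> A1. \<forall>j<m. s j < V1 \<omega> j} = measure M2 {\<omega> \<in> A2. \<forall>j<m. s j < V2 \<omega> j}"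
    and H: "H \<in> borel_measurable (PiM {..<m} (\<lambda>_. borel :: real measure))"
  shows "(\<integral>\<omega>. indicator A1 \<omega> * H (\<lambda>j\<in>{..<m}. V1 \<omega> j) \<partial>M1) = ((\<integral>\<omega>. indicator A2 \<omega> * H (\<lambda>j\<in>{..<m}. V2 \<omega> j) \<partial>M2) :: real)"
proof -
  let ?P = "PiM {..<m} (\<lambda>_. borel :: real measure)"
  note [measurable] = A V H
  have VM: "(\<lambda>\<omega>. \<lambda>j\<in>{..<m}. V1 \<omega> j) \<in> measurable M1 ?P" "(\<lambda>\<omega>. \<lambda>j\<in>{..<m}. V2 \<omega> j) \<in> measurable M2 ?P"
    by (intro measurable_restrict V)+
  define N1 where "N1 = distr (density M1 (\<lambda>\<omega>. ennreal (indicator A1 \<omega>))) ?P (\<lambda>\<omega>. \<lambda>j\<in>{..<m}. V1 \<omega> j)"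
  define N2 where "N2 = distr (density M2 (\<lambda>\<omega>. ennreal (indicator A2 \<omega>))) ?P (\<lambda>\<omega>. \<lambda>j\<in>{..<m}. V2 \<omega> j)"
  let ?E = "\<lambda>s. {f \<in> PiE {..<m} (\<lambda>_. UNIV :: real set). \<forall>i\<in>{..<m}. s i < f i}"
  have emeasure_N: "emeasure (distr (density M (\<lambda>\<omega>. ennreal (indicator A \<omega>))) ?P (\<lambda>\<omega>. \<lambda>j\<in>{..<m}. V \<omega> j)) (?E s)
      = emeasure M {\<omega> \<in> A. \<forall>j<m. max (s j) 0 < V \<omega> j}"
    if A: "A \<in> sets M" and V: "\<And>j. (\<lambda>\<omega>. V \<omega> j) \<in> borel_measurable M" and pos: "\<And>\<omega> j. \<omega> \<in> A \<Longrightarrow> j < m \<Longrightarrow> 0 < V \<omega> j"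
    for M :: "'c measure" and A V and s :: "nat \<Rightarrow> real"
  proof -
    note [measurable] = A V
    have E: "?E s \<in> sets ?P" unfolding sets_PiM_greaterThan[OF finite_lessThan] by (intro sigma_sets.Basic rangeI)
    have VM: "(\<lambda>\<omega>. \<lambda>j\<in>{..<m}. V \<omega> j) \<in> measurable M ?P" by (intro measurable_restrict V)
    have "emeasure (distr (density M (\<lambda>\<omega>. ennreal (indicator A \<omega>))) ?P (\<lambda>\<omega>. \<lambda>j\<in>{..<m}. V \<omega> j)) (?E s)
       = emeasure (density M (\<lambda>\<omega>. ennreal (indicator A \<omega>))) {\<omega> \<in> space M. \<forall>j<m. s j < V \<omega> j}"
      using VM E by (subst emeasure_distr) (auto intro!: arg_cong2[of _ _ _ _ emeasure])
    also have "\<dots> = (\<integral>\<^sup>+\<omega>. indicator {\<omega> \<in> A. \<forall>j<m. s j < V \<omega> j} \<omega> \<partial>M)"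
    proof (subst emeasure_density)
      show "(\<integral>\<^sup>+\<omega>. ennreal (indicator A \<omega>) * indicator {\<omega> \<in> space M. \<forall>j<m. s j < V \<omega> j} \<omega> \<partial>M)
          = (\<integral>\<^sup>+\<omega>. indicator {\<omega> \<in> A. \<forall>j<m. s j < V \<omega> j} \<omega> \<partial>M)"
        by (rule nn_integral_cong) (auto simp: indicator_def)
    qed measurable
    also have "\<dots> = emeasure M {\<omega> \<in> A. \<forall>j<m. s j < V \<omega> j}"
      by (rule nn_integral_indicator) measurable
    also have "{\<omega> \<in> A. \<forall>j<m. s j < V \<omega> j} = {\<omega> \<in> A. \<forall>j<m. max (s j) 0 < V \<omega> j}"
      using pos by auto
    finally show ?thesis .
  qed
  have "N1 = N2"
  proof (rule measure_eqI_generator_eq)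
    show "Int_stable (range ?E)"
    proof (rule Int_stableI)
      fix a b assume "a \<in> range ?E" "b \<in> range ?E"
      then obtain s t where "a = ?E s" "b = ?E t" by (elim rangeE)
      then have ab: "a \<inter> b = ?E (\<lambda>i. max (s i) (t i))" by (simp only: set_eq_iff Int_iff mem_Collect_eq max_less_iff_conj) blast
      show "a \<inter> b \<in> range ?E" unfolding ab by (rule rangeI)
    qed
    show "range ?E \<subseteq> Pow (PiE {..<m} (\<lambda>_. UNIV))" by auto
    show "sets N1 = sigma_sets (PiE {..<m} (\<lambda>_. UNIV)) (range ?E)"
      "sets N2 = sigma_sets (PiE {..<m} (\<lambda>_. UNIV)) (range ?E)"
      unfolding N1_def N2_def by (simp_all add: sets_PiM_greaterThan)
    show "emeasure N1 X = emeasure N2 X" if "X \<in> range ?E" for X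
    proof -
      from that obtain s where s: "X = ?E s" by (rule rangeE)
      show ?thesis
        unfolding N1_def N2_def s using eq[of "\<lambda>j. max (s j) 0"]
        by (simp add: emeasure_N[OF A(1) V(1) pos(1)] emeasure_N[OF A(2) V(2) pos(2)]
            finite_measure.emeasure_eq_measure[OF M(1)] finite_measure.emeasure_eq_measure[OF M(2)])
    qed
    show "range (\<lambda>n::nat. ?E (\<lambda>_. - real n)) \<subseteq> range ?E" by (rule image_subsetI) (rule rangeI)
    show "(\<Union>n::nat. ?E (\<lambda>_. - real n)) = PiE {..<m} (\<lambda>_. UNIV)"
    proof (intro set_eqI iffI)
      fix f :: "nat \<Rightarrow> real" assume f: "f \<in> PiE {..<m} (\<lambda>_. UNIV)"
      obtain n :: nat where n: "Max (insert 0 ((\<lambda>i. - f i) ` {..<m})) < real n" using reals_Archimedean2 by blast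
      have "- real n < f i" if "i < m" for i
      proof -
        have "- f i \<le> Max (insert 0 ((\<lambda>i. - f i) ` {..<m}))" using that by (intro Max_ge) auto
        then show ?thesis using n by linarith
      qed
      then show "f \<in> (\<Union>n::nat. ?E (\<lambda>_. - real n))" using f by auto
    qed auto
    show "emeasure N1 (?E (\<lambda>_. - real n)) \<noteq> \<infinity>" for n :: nat
      unfolding N1_def using finite_measure.emeasure_finite[OF M(1)] by (simp add: emeasure_N[OF A(1) V(1) pos(1)])
  qed
  then have "integral\<^sup>L N1 H = integral\<^sup>L N2 H" by simp
  then show ?thesis
    unfolding N1_def N2_def using VM
    by (simp add: integral_distr integral_density)
qed

lemma mjp_AE_finite_holding:
  assumes law: "mjp_jump_law M q p0 Y S" and k: "k < m" "0 < total_rate q (ys k)"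
  shows "AE \<omega> in M. (\<forall>k\<le>m. Y \<omega> k = ys k) \<and> (\<forall>k<m. 0 < S \<omega> k) \<longrightarrow> S \<omega> k < \<infinity>"
proof -
  interpret prob_space M using law by (simp add: mjp_jump_law_def)
  have [measurable]: "(\<lambda>\<omega>. Y \<omega> k) \<in> measurable M (count_space UNIV)" "(\<lambda>\<omega>. S \<omega> k) \<in> borel_measurable M" for k
    using law by (auto simp: mjp_jump_law_def)
  define E where "E = {\<omega> \<in> space M. (\<forall>k\<le>m. Y \<omega> k = ys k) \<and> (\<forall>k<m. 0 < S \<omega> k) \<and> S \<omega> k = \<infinity>}"
  have E [measurable]: "E \<in> sets M" unfolding E_def by measurable
  define K where "K = p0 (ys 0) * (\<Prod>i<m. jump_prob q (ys i) (ys (Suc i)))"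
  have "prob E \<le> K * exp (- (total_rate q (ys k)) * real N)" for N :: nat
  proof -
    let ?ss = "\<lambda>i. if i = k then real N else 0"
    have "prob E \<le> prob {\<omega> \<in> space M. (\<forall>k\<le>m. Y \<omega> k = ys k) \<and> (\<forall>k<m. ennreal (?ss k) < S \<omega> k)}"
      by (rule finite_measure_mono) (auto simp: E_def)
    also have "\<dots> = p0 (ys 0) * (\<Prod>i<m. jump_prob q (ys i) (ys (Suc i)) * exp (- total_rate q (ys i) * ?ss i))"
      using law unfolding mjp_jump_law_def by (auto simp del: if_split_eq1)
    also have "\<dots> = K * (\<Prod>i<m. if i = k then exp (- total_rate q (ys i) * real N) else 1)"
    proof -
      have "(\<Prod>i<m. jump_prob q (ys i) (ys (Suc i)) * exp (- total_rate q (ys i) * ?ss i))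
         = (\<Prod>i<m. jump_prob q (ys i) (ys (Suc i))) * (\<Prod>i<m. if i = k then exp (- total_rate q (ys i) * real N) else 1)"
        unfolding prod.distrib[symmetric] by (intro prod.cong) auto
      then show ?thesis by (simp add: K_def mult.assoc)
    qed
    also have "\<dots> = K * exp (- (total_rate q (ys k)) * real N)" using k(1) by simp
    finally show ?thesis .
  qed
  moreover have "(\<lambda>N. K * exp (- (total_rate q (ys k)) * real N)) \<longlonglongrightarrow> K * 0"
  proof (intro tendsto_intros)
    have "(\<lambda>N. exp (- total_rate q (ys k)) ^ N) \<longlonglongrightarrow> 0"
      using k(2) by (intro LIMSEQ_realpow_zero) auto
    then show "(\<lambda>N. exp (- (total_rate q (ys k)) * real N)) \<longlonglongrightarrow> 0"
      by (simp add: exp_of_nat_mult[symmetric] mult.commute)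
  qed
  ultimately have "prob E \<le> K * 0" by (intro LIMSEQ_le_const) auto
  then have "prob E = 0" by (simp add: measure_le_0_iff)
  then have "AE \<omega> in M. \<omega> \<notin> E" by (simp add: prob_eq_0)
  moreover have "AE \<omega> in M. \<omega> \<in> space M" by simp
  ultimately show ?thesis
    by eventually_elim (auto simp: E_def less_top)
qed

section \<open>Time reversal\<close>

context lambda_coalescent
begin

lemma hat_rate_has_sum:
  assumes "((\<lambda>j. g j * \<rho> j i) has_sum r) {i + 1..}"
  shows "(hat_rate \<Lambda> g i has_sum (r / g i)) {j. j \<noteq> i}"
proof -
  have "((\<lambda>j. g j * \<rho> j i * (1 / g i)) has_sum (r * (1 / g i))) {i + 1..}"
    using assms by (rule has_sum_cmult_left)
  then show ?thesis
    by (subst has_sum_cong_neutral[where T = "{i + 1..}" and g = "\<lambda>j. g j * \<rho> j i * (1 / g i)"])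
       (auto simp: hat_rate_def)
qed

lemma total_rate_hat:
  assumes "((\<lambda>j. g j * \<rho> j i) has_sum r) {i + 1..}"
  shows "total_rate (hat_rate \<Lambda> g) i = r / g i"
  unfolding total_rate_def using hat_rate_has_sum[OF assms] by (rule infsumI)

lemma jump_rates_hat:
  assumes g: "\<And>i. 0 \<le> g i" and balance: "\<And>i. \<exists>r. ((\<lambda>j. g j * \<rho> j i) has_sum r) {i + 1..}"
    and exit: "((\<lambda>j. g j * \<rho> j 1) has_sum 1) {2..}"
  shows "jump_rates (hat_init \<Lambda> g) (hat_rate \<Lambda> g)"
proof
  show "0 \<le> hat_init \<Lambda> g y" for y using g by (simp add: hat_init_def)
  show "0 \<le> hat_rate \<Lambda> g y y'" for y y' using g by (simp add: hat_rate_def)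
  have "(hat_init \<Lambda> g has_sum 1) UNIV"
    using exit by (subst has_sum_cong_neutral[where T = "{2..}" and g = "\<lambda>j. g j * \<rho> j 1"]) (auto simp: hat_init_def)
  then show "hat_init \<Lambda> g sums 1" by (rule has_sum_imp_sums)
  show "hat_rate \<Lambda> g y summable_on {y'. y' \<noteq> y}" for y
    using balance[of y] hat_rate_has_sum has_sum_imp_summable by blast
qed

lemma green_inflow_has_sum:
  "((\<lambda>j. G n j * \<rho> j i) has_sum (\<Sum>j\<in>{i<..n}. G n j * \<rho> j i)) {i + 1..}"
proof -
  have "((\<lambda>j. G n j * \<rho> j i) has_sum (\<Sum>j\<in>{i<..n}. G n j * \<rho> j i)) {i<..n}"
    by (rule has_sum_finite) simp
  then show ?thesis
    by (subst has_sum_cong_neutral[where T = "{i<..n}" and g = "\<lambda>j. G n j * \<rho> j i"]) (auto simp: green_eq_0)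
qed

abbreviation "hat_init_n n \<equiv> hat_init \<Lambda> (G n)"
abbreviation "hat_rate_n n \<equiv> hat_rate \<Lambda> (G n)"
abbreviation "rev_chain n \<equiv> jump_chain (hat_init_n n) (hat_rate_n n)"
abbreviation "rev_holding n \<equiv> holding (hat_init_n n) (hat_rate_n n)"

lemma jump_rates_green:
  assumes "2 \<le> n"
  shows "jump_rates (hat_init_n n) (hat_rate_n n)"
proof (rule jump_rates_hat)
  show "\<exists>r. ((\<lambda>j. G n j * \<rho> j i) has_sum r) {i + 1..}" for i
    using green_inflow_has_sum by blast
  have "((\<lambda>j. G n j * \<rho> j 1) has_sum (\<Sum>j\<in>{1<..n}. G n j * \<rho> j 1)) {1 + 1..}"
    by (rule green_inflow_has_sum)
  also have "{1<..n} = {2..n}" by auto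
  finally show "((\<lambda>j. G n j * \<rho> j 1) has_sum 1) {2..}"
    using green_exit[OF assms] by (simp add: numeral_2_eq_2)
qed simp

lemma total_rate_green:
  assumes "i < n" "0 < G n i"
  shows "total_rate (hat_rate_n n) i = \<rho>_tot i"
proof -
  have "2 \<le> i" using assms(2) by (metis green_eq_0 less_irrefl not_le)
  then show ?thesis
    using green_balance[of i n] assms by (simp add: total_rate_hat[OF green_inflow_has_sum] field_simps)
qed

lemma total_rate_green_top: "total_rate (hat_rate_n n) n = 0"
  by (simp add: total_rate_hat[OF green_inflow_has_sum])

lemma jump_prob_green:
  assumes "i < n" "0 < G n i"
  shows "jump_prob (hat_rate_n n) i j = (if i < j then G n j * \<rho> j i / (G n i * \<rho>_tot i) else 0)"
proof -
  have "2 \<le> i" using assms(2) by (metis green_eq_0 less_irrefl not_le)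
  then show ?thesis using rho_tot_pos[of i] assms
    by (simp add: jump_prob_def total_rate_green hat_rate_def)
qed

lemma green_top: "2 \<le> n \<Longrightarrow> G n n = 1 / \<rho>_tot n"
  using green_balance[of n n] rho_tot_pos[of n] by (simp add: field_simps)

definition chains :: "nat \<Rightarrow> nat list set" where
  "chains n = {zs. zs \<noteq> [] \<and> sorted_wrt (<) zs \<and> set zs \<subseteq> {2..n} \<and> last zs = n}"

lemma finite_chains: "finite (chains n)"
proof (rule finite_subset)
  show "chains n \<subseteq> {zs. set zs \<subseteq> {2..n} \<and> distinct zs}"
    by (auto simp: chains_def strict_sorted_iff)
qed (rule finite_subset_distinct, simp)

context
  fixes n :: nat and zs :: "nat list" and l :: nat
  assumes zs: "zs \<in> chains n" and len: "length zs = Suc l"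
begin

lemma chain_less: "j < k \<Longrightarrow> k \<le> l \<Longrightarrow> zs ! j < zs ! k"
  using zs len by (auto simp: chains_def sorted_wrt_iff_nth_less)

lemma chain_last: "zs ! l = n"
  using zs len by (auto simp: chains_def last_conv_nth)

lemma chain_ge: "j \<le> l \<Longrightarrow> 2 \<le> zs ! j"
  using zs len by (auto simp: chains_def subset_iff less_Suc_eq_le in_set_conv_nth)

lemma chain_lt: "j < l \<Longrightarrow> zs ! j < n"
  using chain_less[of j l] chain_last by simp

private definition b :: "nat \<Rightarrow> real" where "b j = \<rho> (zs ! j) (if j = 0 then 1 else zs ! (j - 1))"

lemma reversed_weight:
  assumes "k \<le> l"
  shows "hat_init_n n (zs ! 0) * (\<Prod>j<k. jump_prob (hat_rate_n n) (zs ! j) (zs ! Suc j) * exp (- total_rate (hat_rate_n n) (zs ! j) * s j))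
    = G n (zs ! k) * b k * (\<Prod>j<k. b j / \<rho>_tot (zs ! j) * exp (- \<rho>_tot (zs ! j) * s j))"
  using assms
proof (induction k)
  case 0
  then show ?case using chain_ge[of 0] by (simp add: hat_init_def b_def)
next
  case (Suc k)
  have lt: "zs ! k < n" "zs ! k < zs ! Suc k" "2 \<le> zs ! k" "2 \<le> zs ! Suc k" "zs ! Suc k \<le> n"
    using Suc.prems chain_lt[of k] chain_less[of k "Suc k"] chain_ge[of k] chain_ge[of "Suc k"]
      chain_lt[of "Suc k"] chain_last by (auto simp: Suc_le_eq le_less)
  let ?E = "exp (- \<rho>_tot (zs ! k) * s k)" and ?P = "\<Prod>j<k. b j / \<rho>_tot (zs ! j) * exp (- \<rho>_tot (zs ! j) * s j)"
  have step: "G n (zs ! k) * (jump_prob (hat_rate_n n) (zs ! k) (zs ! Suc k) * exp (- total_rate (hat_rate_n n) (zs ! k) * s k))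
      = G n (zs ! Suc k) * b (Suc k) / \<rho>_tot (zs ! k) * ?E"
  proof (cases "G n (zs ! k) = 0")
    case True
    have "G n (zs ! Suc k) * \<rho> (zs ! Suc k) (zs ! k)
        \<le> (\<Sum>j\<in>{zs ! k<..n}. G n j * \<rho> j (zs ! k))"
      using lt by (intro member_le_sum[where f = "\<lambda>j. G n j * \<rho> j (zs ! k)"]) auto
    also have "\<dots> = 0" using green_balance[of "zs ! k" n] lt True by simp
    finally have "G n (zs ! Suc k) * \<rho> (zs ! Suc k) (zs ! k) = 0"
      by (intro antisym) auto
    then show ?thesis using True by (simp add: b_def)
  next
    case False
    then have pos: "0 < G n (zs ! k)" using green_nonneg[of n "zs ! k"] by linarith
    show ?thesis
      unfolding jump_prob_green[OF lt(1) pos] total_rate_green[OF lt(1) pos]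
      using lt pos by (simp add: b_def)
  qed
  have "hat_init_n n (zs ! 0) * (\<Prod>j<Suc k. jump_prob (hat_rate_n n) (zs ! j) (zs ! Suc j) * exp (- total_rate (hat_rate_n n) (zs ! j) * s j))
     = (G n (zs ! k) * b k * ?P) * (jump_prob (hat_rate_n n) (zs ! k) (zs ! Suc k) * exp (- total_rate (hat_rate_n n) (zs ! k) * s k))"
    using Suc.IH Suc.prems by (simp only: prod.lessThan_Suc mult.assoc[symmetric] Suc_leD)
  also have "\<dots> = b k * ?P * (G n (zs ! k) * (jump_prob (hat_rate_n n) (zs ! k) (zs ! Suc k) * exp (- total_rate (hat_rate_n n) (zs ! k) * s k)))"
    by (simp only: mult_ac)
  also have "\<dots> = G n (zs ! Suc k) * b (Suc k) * (?P * (b k / \<rho>_tot (zs ! k) * ?E))"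
    unfolding step by simp
  finally show ?case by (simp only: prod.lessThan_Suc)
qed

lemma forward_weight:
  fixes c :: "nat \<Rightarrow> nat"
  assumes c: "\<And>k. k \<le> l \<Longrightarrow> c k = zs ! (l - k)" "\<And>k. l < k \<Longrightarrow> c k = 1"
    and ss: "ss 0 = 0" "\<And>j. j < l \<Longrightarrow> ss (l - j) = s j" "ss (Suc l) = 0"
  shows "(\<Prod>k<Suc (Suc l). jump_prob (\<rho>) (c k) (c (Suc k)) * exp (- total_rate (\<rho>) (c k) * ss k))
    = G n (zs ! l) * b l * (\<Prod>j<l. b j / \<rho>_tot (zs ! j) * exp (- \<rho>_tot (zs ! j) * s j))"
proof -
  have one: "\<rho>_tot 1 = 0" by (simp add: rho_tot_def)
  have "(\<Prod>k<Suc (Suc l). jump_prob (\<rho>) (c k) (c (Suc k)) * exp (- total_rate (\<rho>) (c k) * ss k))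
      = (\<Prod>k<Suc l. jump_prob (\<rho>) (c k) (c (Suc k)) * exp (- total_rate (\<rho>) (c k) * ss k))"
    using c(2)[of "Suc l"] c(2)[of "Suc (Suc l)"] ss(3) one
    by (subst prod.lessThan_Suc) (simp add: jump_prob_def total_rate_rho)
  also have "\<dots> = (\<Prod>k<Suc l. b (Suc l - Suc k) / \<rho>_tot (zs ! (Suc l - Suc k)) * exp (- \<rho>_tot (zs ! (Suc l - Suc k)) * ss (l - (Suc l - Suc k))))"
  proof (rule prod.cong)
    fix k assume "k \<in> {..<Suc l}"
    then have k: "k \<le> l" by simp
    have ck: "c k = zs ! (l - k)" using c(1)[OF k] .
    have cS: "c (Suc k) = (if l - k = 0 then 1 else zs ! (l - k - 1))"
      using c(1)[of "Suc k"] c(2)[of "Suc k"] k by (cases "k = l") auto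
    have ne: "c (Suc k) \<noteq> c k"
    proof (cases "k = l")
      case True
      then show ?thesis using chain_ge[of 0] unfolding ck cS by simp
    next
      case False
      then have "l - k - 1 < l - k" using k by simp
      then show ?thesis using chain_less[of "l - k - 1" "l - k"] unfolding ck cS by auto
    qed
    have "\<rho>_tot (c k) \<noteq> 0" using rho_tot_pos[of "c k"] chain_ge[of "l - k"] by (simp add: ck)
    then have "jump_prob (\<rho>) (c k) (c (Suc k)) = b (l - k) / \<rho>_tot (zs ! (l - k))"
      using ne by (simp add: jump_prob_def total_rate_rho b_def ck cS)
    moreover have "l - (l - k) = k" using k by simp
    ultimately show "jump_prob (\<rho>) (c k) (c (Suc k)) * exp (- total_rate (\<rho>) (c k) * ss k)
       = b (Suc l - Suc k) / \<rho>_tot (zs ! (Suc l - Suc k)) * exp (- \<rho>_tot (zs ! (Suc l - Suc k)) * ss (l - (Suc l - Suc k)))"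
      by (simp add: total_rate_rho ck)
  qed simp
  also have "\<dots> = (\<Prod>j<Suc l. b j / \<rho>_tot (zs ! j) * exp (- \<rho>_tot (zs ! j) * ss (l - j)))"
    by (rule prod.nat_diff_reindex)
  also have "\<dots> = (\<Prod>j<l. b j / \<rho>_tot (zs ! j) * exp (- \<rho>_tot (zs ! j) * s j)) * (b l / \<rho>_tot (zs ! l))"
    using ss by (simp add: ss(1))
  also have "\<dots> = G n (zs ! l) * b l * (\<Prod>j<l. b j / \<rho>_tot (zs ! j) * exp (- \<rho>_tot (zs ! j) * s j))"
    using chain_ge[of l] by (simp add: chain_last green_top)
  finally show ?thesis .
qed

end

end

lemma less_enn2real_iff: "0 \<le> s \<Longrightarrow> x < \<infinity> \<Longrightarrow> s < enn2real x \<longleftrightarrow> ennreal s < x"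
  by (cases x) (auto simp: ennreal_less_iff)

context lambda_coalescent
begin

lemma reversed_chain:
  assumes n: "2 \<le> n" and u: "\<And>k. \<omega> (2 * k) \<in> {0..<1}"
  defines "Z \<equiv> rev_chain n \<omega>"
  shows "0 < G n (Z k)" "2 \<le> Z k" "Z k \<le> n" "Z k < n \<Longrightarrow> Z k < Z (Suc k)" "Z k = n \<Longrightarrow> Z (Suc k) = n"
proof -
  interpret jump_rates "hat_init_n n" "hat_rate_n n" by (rule jump_rates_green[OF n])
  note pos = jump_chain_pos[of \<omega>, OF u, folded Z_def]
  have G: "0 < G n (Z k)" for k
  proof (induction k)
    case 0
    have "G n (Z 0) \<noteq> 0" using pos(1) by (auto simp: hat_init_def split: if_splits)
    then show ?case using green_nonneg[of n "Z 0"] by linarith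
  next
    case (Suc k)
    have "G n (Z (Suc k)) \<noteq> 0"
    proof
      assume "G n (Z (Suc k)) = 0"
      with Suc pos(2)[of k] show False by (auto simp: jump_prob_def hat_rate_def split: if_splits)
    qed
    then show ?case using green_nonneg[of n "Z (Suc k)"] by linarith
  qed
  show "0 < G n (Z k)" by (rule G)
  show "2 \<le> Z k" "Z k \<le> n" using G[of k] green_eq_0[of "Z k" n] by (auto simp: not_le[symmetric])
  show "Z k < Z (Suc k)" if "Z k < n"
    using pos(2)[of k] by (simp add: jump_prob_green[OF that G] split: if_splits)
  show "Z (Suc k) = n" if "Z k = n"
    using pos(2)[of k] by (simp add: that jump_prob_def total_rate_green_top split: if_splits)
qed

lemma reversed_holding:
  assumes n: "2 \<le> n" and u: "\<And>k. \<omega> (2 * k) \<in> {0..<1}" and e: "\<And>k. 0 < \<omega> (2 * k + 1)"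
  defines "Z \<equiv> rev_chain n \<omega>" and "S \<equiv> rev_holding n \<omega>"
  shows "Z k < n \<Longrightarrow> 0 < S k \<and> S k < \<infinity>" "Z k = n \<Longrightarrow> S k = \<infinity>"
proof -
  note chain = reversed_chain[of n \<omega>, OF n u, folded Z_def]
  show "0 < S k \<and> S k < \<infinity>" if "Z k < n"
  proof -
    have "0 < \<rho>_tot (Z k)" using chain(2) by (rule rho_tot_pos)
    then show ?thesis
      using e[of k] by (simp add: S_def holding_def Z_def[symmetric] total_rate_green[OF that chain(1)] divide_ennreal)
  qed
  show "S k = \<infinity>" if "Z k = n"
    using e[of k] by (simp add: S_def holding_def Z_def[symmetric] that total_rate_green_top)
qed

definition reversed_event :: "nat \<Rightarrow> nat list \<Rightarrow> (nat \<Rightarrow> real) set" where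
  "reversed_event n zs = {\<omega> \<in> space clock_space.
     (\<forall>k<length zs. rev_chain n \<omega> k = zs ! k)
     \<and> (\<forall>k<length zs - 1. 0 < rev_holding n \<omega> k \<and> rev_holding n \<omega> k < \<infinity>)
     \<and> rev_holding n \<omega> (length zs - 1) = \<infinity>}"

definition forward_event :: "'a measure \<Rightarrow> ('a \<Rightarrow> nat \<Rightarrow> nat set set) \<Rightarrow> ('a \<Rightarrow> nat \<Rightarrow> ennreal) \<Rightarrow> nat list \<Rightarrow> 'a set" where
  "forward_event M Y S zs = {\<omega> \<in> space M.
     (\<forall>k\<le>Suc (length zs). card (Y \<omega> k) = (if k < length zs then zs ! (length zs - 1 - k) else 1))
     \<and> (\<forall>k<Suc (length zs). 0 < S \<omega> k) \<and> (\<forall>k<length zs. S \<omega> k < \<infinity>)}"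

lemma sets_reversed_event: "reversed_event n zs \<in> sets clock_space"
proof -
  note [measurable] = measurable_jump_chain measurable_holding
  show ?thesis unfolding reversed_event_def by measurable
qed

lemma AE_reversed_event:
  assumes n: "2 \<le> n"
  shows "AE \<omega> in clock_space. \<exists>zs\<in>chains n. \<omega> \<in> reversed_event n zs"
  using AE_clock_even_not_in[OF countable_empty] AE_clock_odd_pos
proof eventually_elim
  case (elim \<omega>)
  let ?Z = "rev_chain n \<omega>"
  have u: "\<And>k. \<omega> (2 * k) \<in> {0..<1}" and e: "\<And>k. 0 < \<omega> (2 * k + 1)" using elim by auto
  note chain = reversed_chain[of n \<omega>, OF n u] and hold = reversed_holding[of n \<omega>, OF n u e]
  have "\<exists>l. ?Z l = n"
  proof (rule ccontr)
    assume "\<nexists>l. ?Z l = n"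
    then have "?Z k < n" for k using chain(3)[of k] by (meson le_neq_implies_less)
    then have "strict_mono ?Z" by (intro strict_monoI_Suc) (use chain(4) in auto)
    then have "n \<le> ?Z n" by (rule strict_mono_imp_increasing)
    with \<open>\<And>k. ?Z k < n\<close>[of n] show False by simp
  qed
  define l where "l = (LEAST l. ?Z l = n)"
  have l: "?Z l = n" unfolding l_def using \<open>\<exists>l. ?Z l = n\<close> by (rule LeastI_ex)
  have lt: "?Z k < n" if "k < l" for k
    using chain(3)[of k] not_less_Least[of k "\<lambda>l. ?Z l = n"] that by (auto simp: l_def le_less)
  have incr: "?Z i < ?Z j" if "i < j" "j \<le> l" for i j
    using that
  proof (induction j)
    case (Suc j)
    have "?Z j < ?Z (Suc j)" using Suc.prems by (intro chain(4) lt) simp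
    with Suc show ?case by (cases "i = j") auto
  qed simp
  define zs where "zs = map ?Z [0..<Suc l]"
  have nth: "zs ! k = ?Z k" if "k \<le> l" for k
    unfolding zs_def using that by (subst nth_map) (auto simp del: upt_Suc)
  have len: "length zs = Suc l" by (simp add: zs_def)
  have "zs \<in> chains n"
    unfolding chains_def
  proof (intro CollectI conjI)
    show "zs \<noteq> []" using len by auto
    show "sorted_wrt (<) zs"
      unfolding sorted_wrt_iff_nth_less len using incr nth by auto
    show "set zs \<subseteq> {2..n}" using chain(2,3) by (auto simp: zs_def)
    show "last zs = n" by (simp add: zs_def l)
  qed
  moreover have "\<omega> \<in> reversed_event n zs"
    unfolding reversed_event_def len using nth hold lt l by auto
  ultimately show ?case by blast
qed

lemma disjoint_reversed_event: "disjoint_family_on (reversed_event n) (chains n)"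
  unfolding disjoint_family_on_def
proof (intro ballI impI)
  have *: "length zs' \<le> length zs" if zs: "zs \<in> chains n" "zs' \<in> chains n" and \<omega>: "\<omega> \<in> reversed_event n zs" "\<omega> \<in> reversed_event n zs'" for zs zs' \<omega>
  proof (rule ccontr)
    assume less: "\<not> length zs' \<le> length zs"
    obtain l l' where l: "length zs = Suc l" "length zs' = Suc l'"
      using zs by (auto simp: chains_def neq_Nil_conv)
    have "zs' ! l = zs ! l" using \<omega> l less by (auto simp: reversed_event_def)
    with chain_last[OF zs(1) l(1)] chain_lt[OF zs(2) l(2), of l] less l show False by auto
  qed
  fix zs zs' assume zs: "zs \<in> chains n" "zs' \<in> chains n" "zs \<noteq> zs'"
  show "reversed_event n zs \<inter> reversed_event n zs' = {}"
  proof (rule ccontr)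
    assume "reversed_event n zs \<inter> reversed_event n zs' \<noteq> {}"
    then obtain \<omega> where \<omega>: "\<omega> \<in> reversed_event n zs" "\<omega> \<in> reversed_event n zs'" by blast
    have len: "length zs = length zs'" using *[OF zs(1,2) \<omega>] *[OF zs(2,1) \<omega>(2,1)] by simp
    have "zs = zs'" by (rule nth_equalityI[OF len]) (use \<omega> len in \<open>auto simp: reversed_event_def\<close>)
    with zs(3) show False by simp
  qed
qed

lemma disjoint_forward_event: "disjoint_family_on (forward_event M Y S) (chains n)"
  unfolding disjoint_family_on_def
proof (intro ballI impI)
  have *: "length zs' \<le> length zs"
    if zs: "zs \<in> chains n" "zs' \<in> chains n" and \<omega>: "\<omega> \<in> forward_event M Y S zs" "\<omega> \<in> forward_event M Y S zs'" for zs zs' \<omega>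
  proof (rule ccontr)
    assume less: "\<not> length zs' \<le> length zs"
    obtain l' where l': "length zs' = Suc l'" using less by (cases "length zs'") auto
    have "card (Y \<omega> (length zs)) = 1" using \<omega>(1) by (auto simp: forward_event_def)
    moreover have "card (Y \<omega> (length zs)) = zs' ! (l' - length zs)" using \<omega>(2) less l' by (auto simp: forward_event_def)
    ultimately show False using chain_ge[OF zs(2) l', of "l' - length zs"] by simp
  qed
  fix zs zs' assume zs: "zs \<in> chains n" "zs' \<in> chains n" "zs \<noteq> zs'"
  show "forward_event M Y S zs \<inter> forward_event M Y S zs' = {}"
  proof (rule ccontr)
    assume "forward_event M Y S zs \<inter> forward_event M Y S zs' \<noteq> {}"
    then obtain \<omega> where \<omega>: "\<omega> \<in> forward_event M Y S zs" "\<omega> \<in> forward_event M Y S zs'" by blast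
    have len: "length zs = length zs'" using *[OF zs(1,2) \<omega>] *[OF zs(2,1) \<omega>(2,1)] by simp
    have "zs = zs'"
    proof (rule nth_equalityI[OF len])
      fix i assume i: "i < length zs"
      let ?k = "length zs - 1 - i"
      have k: "?k < length zs" "length zs - 1 - ?k = i" using i by auto
      have "card (Y \<omega> j) = zs ! (length zs - 1 - j)" if "j < length zs" for j
        using \<omega>(1) that unfolding forward_event_def by simp
      moreover have "card (Y \<omega> j) = zs' ! (length zs' - 1 - j)" if "j < length zs'" for j
        using \<omega>(2) that unfolding forward_event_def by simp
      ultimately have "zs ! (length zs - 1 - ?k) = zs' ! (length zs' - 1 - ?k)"
        using k(1) len by metis
      then show "zs ! i = zs' ! i" using k(2) len by simp
    qed
    with zs(3) show False by simp
  qed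
qed

lemma measure_reversed_event:
  assumes n: "2 \<le> n" and zs: "zs \<in> chains n" "length zs = Suc l" and s: "\<And>j. 0 \<le> s j"
  shows "measure clock_space {\<omega> \<in> reversed_event n zs. \<forall>j<l. s j < enn2real (rev_holding n \<omega> j)}
    = hat_init_n n (zs ! 0) * (\<Prod>j<l. jump_prob (hat_rate_n n) (zs ! j) (zs ! Suc j) * exp (- total_rate (hat_rate_n n) (zs ! j) * s j))"
proof -
  interpret jump_rates "hat_init_n n" "hat_rate_n n" by (rule jump_rates_green[OF n])
  interpret prob_space clock_space by (rule prob_space_clock_space)
  let ?Z = "rev_chain n" and ?S = "rev_holding n"
  note [measurable] = measurable_jump_chain measurable_holding sets_reversed_event
  have "prob {\<omega> \<in> reversed_event n zs. \<forall>j<l. s j < enn2real (?S \<omega> j)}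
      = prob {\<omega> \<in> space clock_space. (\<forall>k\<le>l. ?Z \<omega> k = zs ! k) \<and> (\<forall>k<l. ennreal (s k) < ?S \<omega> k)}"
  proof (rule finite_measure_eq_AE)
    show "AE \<omega> in clock_space. (\<omega> \<in> {\<omega> \<in> reversed_event n zs. \<forall>j<l. s j < enn2real (?S \<omega> j)})
      \<longleftrightarrow> (\<omega> \<in> {\<omega> \<in> space clock_space. (\<forall>k\<le>l. ?Z \<omega> k = zs ! k) \<and> (\<forall>k<l. ennreal (s k) < ?S \<omega> k)})"
      using AE_clock_even_not_in[OF countable_empty] AE_clock_odd_pos
    proof eventually_elim
      case (elim \<omega>)
      have u: "\<And>k. \<omega> (2 * k) \<in> {0..<1}" and e: "\<And>k. 0 < \<omega> (2 * k + 1)" using elim by auto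
      note hold = reversed_holding[of n \<omega>, OF n u e]
      show ?case
      proof
        assume "\<omega> \<in> {\<omega> \<in> reversed_event n zs. \<forall>j<l. s j < enn2real (?S \<omega> j)}"
        then show "\<omega> \<in> {\<omega> \<in> space clock_space. (\<forall>k\<le>l. ?Z \<omega> k = zs ! k) \<and> (\<forall>k<l. ennreal (s k) < ?S \<omega> k)}"
          using s by (auto simp: reversed_event_def zs(2) less_Suc_eq_le less_enn2real_iff)
      next
        assume \<omega>: "\<omega> \<in> {\<omega> \<in> space clock_space. (\<forall>k\<le>l. ?Z \<omega> k = zs ! k) \<and> (\<forall>k<l. ennreal (s k) < ?S \<omega> k)}"
        then have "?Z \<omega> k < n" if "k < l" for k using chain_lt[OF zs] that by auto
        then have fin: "0 < ?S \<omega> k \<and> ?S \<omega> k < \<infinity>" if "k < l" for k using hold(1) that by blast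
        have "?S \<omega> l = \<infinity>" using \<omega> chain_last[OF zs] hold(2) by auto
        with \<omega> fin show "\<omega> \<in> {\<omega> \<in> reversed_event n zs. \<forall>j<l. s j < enn2real (?S \<omega> j)}"
          using s by (auto simp: reversed_event_def zs(2) less_Suc_eq_le less_enn2real_iff)
      qed
    qed
  qed measurable
  also have "\<dots> = hat_init_n n (zs ! 0) * (\<Prod>j<l. jump_prob (hat_rate_n n) (zs ! j) (zs ! Suc j) * exp (- total_rate (hat_rate_n n) (zs ! j) * s j))"
    using mjp_jump_law_chain s unfolding mjp_jump_law_def by simp
  finally show ?thesis .
qed

context
  fixes M :: "'a measure" and Y :: "'a \<Rightarrow> nat \<Rightarrow> nat set set" and S :: "'a \<Rightarrow> nat \<Rightarrow> ennreal" and n :: nat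
  assumes n: "2 \<le> n" and law: "mjp_jump_law M (coal_rate \<Lambda>) (coal_init n) Y S"
begin

lemma prob_space_coal: "prob_space M"
  using law by (simp add: mjp_jump_law_def)

lemma measurable_coal_chain:
  "(\<lambda>\<omega>. Y \<omega> k) \<in> measurable M (count_space UNIV)" "(\<lambda>\<omega>. S \<omega> k) \<in> borel_measurable M"
  using law by (auto simp: mjp_jump_law_def)

lemma measurable_card_chain: "(\<lambda>\<omega>. card (Y \<omega> k)) \<in> measurable M (count_space UNIV)"
  by (rule measurable_compose[OF measurable_coal_chain(1)]) simp

lemma sets_forward_event: "forward_event M Y S zs \<in> sets M"
proof -
  note [measurable] = measurable_card_chain measurable_coal_chain(2)
  show ?thesis unfolding forward_event_def by measurable
qed

lemma measure_forward_event:
  assumes zs: "zs \<in> chains n" "length zs = Suc l" and s: "\<And>j. 0 \<le> s j"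
  shows "measure M {\<omega> \<in> forward_event M Y S zs. \<forall>j<l. s j < enn2real (S \<omega> (l - j))}
    = hat_init_n n (zs ! 0) * (\<Prod>j<l. jump_prob (hat_rate_n n) (zs ! j) (zs ! Suc j) * exp (- total_rate (hat_rate_n n) (zs ! j) * s j))"
proof -
  interpret prob_space M by (rule prob_space_coal)
  note [measurable] = measurable_card_chain measurable_coal_chain(2) sets_forward_event
  note law' = block_count_jump_law[OF law]
  define c where "c k = (if k < Suc l then zs ! (l - k) else 1)" for k
  define ss where "ss k = (if 1 \<le> k \<and> k \<le> l then s (l - k) else 0)" for k
  have ss_nonneg: "0 \<le> ss k" for k using s by (simp add: ss_def)
  let ?E = "{\<omega> \<in> space M. (\<forall>k\<le>Suc (Suc l). card (Y \<omega> k) = c k) \<and> (\<forall>k<Suc (Suc l). ennreal (ss k) < S \<omega> k)}"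
  have "AE \<omega> in M. \<forall>k<Suc l. (\<forall>k\<le>Suc (Suc l). card (Y \<omega> k) = c k) \<and> (\<forall>k<Suc (Suc l). 0 < S \<omega> k) \<longrightarrow> S \<omega> k < \<infinity>"
    unfolding AE_all_countable
  proof (intro allI AE_impI)
    fix k assume k: "k < Suc l"
    have "0 < \<rho>_tot (c k)" using chain_ge[OF zs, of "l - k"] k by (intro rho_tot_pos) (simp add: c_def)
    then show "AE \<omega> in M. (\<forall>k\<le>Suc (Suc l). card (Y \<omega> k) = c k) \<and> (\<forall>k<Suc (Suc l). 0 < S \<omega> k) \<longrightarrow> S \<omega> k < \<infinity>"
      using k by (intro mjp_AE_finite_holding[OF law']) (auto simp: total_rate_rho)
  qed
  then have "prob {\<omega> \<in> forward_event M Y S zs. \<forall>j<l. s j < enn2real (S \<omega> (l - j))} = prob ?E"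
  proof (intro finite_measure_eq_AE)
    assume "AE \<omega> in M. \<forall>k<Suc l. (\<forall>k\<le>Suc (Suc l). card (Y \<omega> k) = c k) \<and> (\<forall>k<Suc (Suc l). 0 < S \<omega> k) \<longrightarrow> S \<omega> k < \<infinity>"
    then show "AE \<omega> in M. (\<omega> \<in> {\<omega> \<in> forward_event M Y S zs. \<forall>j<l. s j < enn2real (S \<omega> (l - j))}) \<longleftrightarrow> (\<omega> \<in> ?E)"
    proof eventually_elim
      case (elim \<omega>)
      show ?case
      proof
        assume \<omega>: "\<omega> \<in> {\<omega> \<in> forward_event M Y S zs. \<forall>j<l. s j < enn2real (S \<omega> (l - j))}"
        have "ennreal (ss k) < S \<omega> k" if k: "k < Suc (Suc l)" for k
        proof (cases "1 \<le> k \<and> k \<le> l")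
          case True
          have "l - k < l" using True by simp
          then have "s (l - k) < enn2real (S \<omega> (l - (l - k)))" using \<omega> by blast
          moreover have "S \<omega> k < \<infinity>" using \<omega> True by (auto simp: forward_event_def zs(2))
          moreover have "l - (l - k) = k" using True by simp
          ultimately show ?thesis using True s by (simp add: ss_def less_enn2real_iff)
        next
          case False
          then show ?thesis using \<omega> k by (auto simp: ss_def forward_event_def zs(2))
        qed
        then show "\<omega> \<in> ?E" using \<omega> by (auto simp: forward_event_def zs(2) c_def)
      next
        assume \<omega>: "\<omega> \<in> ?E"
        then have pos: "0 < S \<omega> k" if "k < Suc (Suc l)" for k
          using that by (auto intro: le_less_trans[OF zero_le])
        with \<omega> elim have fin: "S \<omega> k < \<infinity>" if "k < Suc l" for k using that by blast
        have "s j < enn2real (S \<omega> (l - j))" if "j < l" for j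
        proof -
          have "ennreal (ss (l - j)) < S \<omega> (l - j)" using \<omega> that by auto
          moreover have "ss (l - j) = s j" using that by (simp add: ss_def)
          ultimately show ?thesis using fin[of "l - j"] s that by (simp add: less_enn2real_iff)
        qed
        then show "\<omega> \<in> {\<omega> \<in> forward_event M Y S zs. \<forall>j<l. s j < enn2real (S \<omega> (l - j))}"
          using \<omega> pos fin by (auto simp: forward_event_def zs(2) c_def)
      qed
    qed
  qed measurable
  also have "\<dots> = (if c 0 = n then 1 else 0) * (\<Prod>k<Suc (Suc l). jump_prob (\<rho>) (c k) (c (Suc k)) * exp (- total_rate (\<rho>) (c k) * ss k))"
    using law' ss_nonneg unfolding mjp_jump_law_def by blast
  also have "c 0 = n" using chain_last[OF zs] by (simp add: c_def)
  also have "(\<Prod>k<Suc (Suc l). jump_prob (\<rho>) (c k) (c (Suc k)) * exp (- total_rate (\<rho>) (c k) * ss k))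
     = hat_init_n n (zs ! 0) * (\<Prod>j<l. jump_prob (hat_rate_n n) (zs ! j) (zs ! Suc j) * exp (- total_rate (hat_rate_n n) (zs ! j) * s j))"
    unfolding reversed_weight[OF zs order_refl] by (rule forward_weight[OF zs]) (auto simp: c_def ss_def)
  finally show ?thesis by simp
qed

lemma AE_forward_event: "AE \<omega> in M. \<exists>zs\<in>chains n. \<omega> \<in> forward_event M Y S zs"
proof -
  interpret prob_space M by (rule prob_space_coal)
  interpret \<Omega>: prob_space clock_space by (rule prob_space_clock_space)
  have eq: "prob (forward_event M Y S zs) = \<Omega>.prob (reversed_event n zs)" if zs: "zs \<in> chains n" for zs
  proof -
    obtain l where l: "length zs = Suc l" using zs by (cases "length zs") (auto simp: chains_def)
    have "{\<omega> \<in> forward_event M Y S zs. \<forall>j<l. 0 < enn2real (S \<omega> (l - j))} = forward_event M Y S zs"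
      by (auto simp: forward_event_def l enn2real_positive_iff)
    moreover have "{\<omega> \<in> reversed_event n zs. \<forall>j<l. 0 < enn2real (rev_holding n \<omega> j)} = reversed_event n zs"
      by (auto simp: reversed_event_def l enn2real_positive_iff)
    ultimately show ?thesis
      using measure_forward_event[OF zs l, of "\<lambda>_. 0"] measure_reversed_event[OF n zs l, of "\<lambda>_. 0"] by simp
  qed
  have "prob (\<Union>zs\<in>chains n. forward_event M Y S zs) = (\<Sum>zs\<in>chains n. prob (forward_event M Y S zs))"
    by (rule finite_measure_finite_Union) (use finite_chains disjoint_forward_event sets_forward_event in auto)
  also have "\<dots> = (\<Sum>zs\<in>chains n. \<Omega>.prob (reversed_event n zs))" using eq by simp
  also have "\<dots> = \<Omega>.prob (\<Union>zs\<in>chains n. reversed_event n zs)"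
    by (rule \<Omega>.finite_measure_finite_Union[symmetric]) (use finite_chains disjoint_reversed_event sets_reversed_event in auto)
  also have "\<dots> = 1"
    using AE_reversed_event[OF n]
    by (subst \<Omega>.prob_eq_1) (auto intro: sets_reversed_event finite_chains)
  finally have "AE \<omega> in M. \<omega> \<in> (\<Union>zs\<in>chains n. forward_event M Y S zs)" by (rule AE_prob_1)
  then show ?thesis by eventually_elim auto
qed

lemma forward_event_paths:
  assumes zs: "zs \<in> chains n" "length zs = Suc l" and \<omega>: "\<omega> \<in> forward_event M Y S zs"
  shows "0 \<le> t \<Longrightarrow> coal_Nhat n (Y \<omega>) (S \<omega>) t
      = nat_path (\<lambda>j. zs ! j) (\<lambda>j. if j < l then ennreal (enn2real (S \<omega> (l - j))) else \<infinity>) t"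
    and "coal_Nhat n (Y \<omega>) (S \<omega>) 0 = enat (coal_L (Y \<omega>) (S \<omega>))"
proof -
  have ev: "\<And>k. k \<le> Suc (Suc l) \<Longrightarrow> card (Y \<omega> k) = (if k < Suc l then zs ! (Suc l - 1 - k) else 1)"
    "\<And>k. k < Suc (Suc l) \<Longrightarrow> 0 < S \<omega> k" "\<And>k. k < Suc l \<Longrightarrow> S \<omega> k < \<infinity>"
    using \<omega> unfolding forward_event_def zs(2) by blast+
  have a1: "card (Y \<omega> k) = zs ! (Suc l - 1 - k)" if "k < Suc l" for k using ev(1)[of k] that by simp
  have a2: "card (Y \<omega> (Suc l)) = 1" using ev(1)[of "Suc l"] by simp
  have a3: "zs ! k \<noteq> 1" if "k < Suc l" for k using chain_ge[OF zs, of k] that by simp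
  have a4: "S \<omega> k = ennreal (enn2real (S \<omega> k))" if "k < Suc l" for k
    using ev(3)[OF that] by simp
  have a5: "0 < enn2real (S \<omega> k)" if "k < Suc l" for k
    using ev(3)[OF that] ev(2)[of k] that by (simp add: enn2real_positive_iff)
  have a6: "0 < S \<omega> (Suc l)" by (rule ev(2)) simp
  note a = zs(2)[symmetric] zero_less_Suc a1 a2 a3 a4 a5 a6
  show "coal_Nhat n (Y \<omega>) (S \<omega>) 0 = enat (coal_L (Y \<omega>) (S \<omega>))"
    using coal_T_pos[where m = "Suc l" and zs = zs and Y = "Y \<omega>" and S = "S \<omega>" and v = "\<lambda>k. enn2real (S \<omega> k)", OF a]
    by (simp add: coal_Nhat_def coal_L_def)
  assume "0 \<le> t"
  from coal_Nhat_eq_nat_path[where m = "Suc l" and zs = zs and Y = "Y \<omega>" and S = "S \<omega>" and v = "\<lambda>k. enn2real (S \<omega> k)", OF a this] chain_last[OF zs]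
  show "coal_Nhat n (Y \<omega>) (S \<omega>) t = nat_path (\<lambda>j. zs ! j) (\<lambda>j. if j < l then ennreal (enn2real (S \<omega> (l - j))) else \<infinity>) t"
    by (simp only: diff_Suc_1)
qed

lemma AE_cadlag_coal_Nhat: "AE \<omega> in M. cadlag (coal_Nhat n (Y \<omega>) (S \<omega>))"
  using AE_forward_event
proof eventually_elim
  case (elim \<omega>)
  then obtain zs where zs: "zs \<in> chains n" and \<omega>: "\<omega> \<in> forward_event M Y S zs" by blast
  obtain l where l: "length zs = Suc l" using zs by (cases "length zs") (auto simp: chains_def)
  let ?S = "\<lambda>j. if j < l then ennreal (enn2real (S \<omega> (l - j))) else \<infinity>"
  have "cadlag (nat_path (\<lambda>j. zs ! min j l) ?S)"
  proof (rule cadlag_nat_path)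
    show "mono (\<lambda>j. zs ! min j l)"
    proof (rule monoI)
      fix i j :: nat assume "i \<le> j"
      then consider "min i l = min j l" | "min i l < min j l" by linarith
      then show "zs ! min i l \<le> zs ! min j l"
      proof cases
        case 2
        then show ?thesis by (rule less_imp_le[OF chain_less[OF zs l]]) simp
      qed simp
    qed
    show "(\<forall>B. \<exists>k. B \<le> zs ! min k l) \<or> (\<exists>k. ?S k = \<infinity>)" by (intro disjI2 exI[of _ l]) simp
  qed
  moreover have "nat_path (\<lambda>j. zs ! j) ?S t = nat_path (\<lambda>j. zs ! min j l) ?S t" for t
    by (rule nat_path_cong[of "Suc l"]) auto
  ultimately have "cadlag (nat_path (\<lambda>j. zs ! j) ?S)" by (simp add: cadlag_cong)
  then show ?case by (rule cadlag_cong[rotated]) (rule forward_event_paths[OF zs l \<omega>])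
qed

lemma reversed_law:
  fixes F :: "(real \<Rightarrow> enat) \<Rightarrow> real"
  assumes F: "F \<in> borel_measurable path_space" "\<And>x. \<bar>F x\<bar> \<le> B"
  shows "(\<integral>\<omega>. F (\<lambda>t. coal_Nhat n (Y \<omega>) (S \<omega>) (max t 0)) \<partial>M)
    = (\<integral>\<omega>. F (nat_path (rev_chain n \<omega>) (rev_holding n \<omega>)) \<partial>clock_space)"
proof -
  interpret prob_space M by (rule prob_space_coal)
  interpret \<Omega>: prob_space clock_space by (rule prob_space_clock_space)
  let ?Z = "rev_chain n" and ?S = "rev_holding n"
  have m1: "(\<lambda>\<omega>. F (\<lambda>t. coal_Nhat n (Y \<omega>) (S \<omega>) (max t 0))) \<in> borel_measurable M"
    by (rule measurable_compose[OF measurable_coal_Nhat_nonneg[OF measurable_coal_chain] F(1)])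
  have m2: "(\<lambda>\<omega>. F (nat_path (?Z \<omega>) (?S \<omega>))) \<in> borel_measurable clock_space"
    by (rule measurable_compose[OF measurable_nat_path[OF measurable_jump_chain measurable_holding] F(1)])
  have "(\<integral>\<omega>. indicator (forward_event M Y S zs) \<omega> * F (\<lambda>t. coal_Nhat n (Y \<omega>) (S \<omega>) (max t 0)) \<partial>M)
    = (\<integral>\<omega>. indicator (reversed_event n zs) \<omega> * F (nat_path (?Z \<omega>) (?S \<omega>)) \<partial>clock_space)"
    if zs: "zs \<in> chains n" for zs
  proof -
    obtain l where l: "length zs = Suc l" using zs by (cases "length zs") (auto simp: chains_def)
    define S' where "S' v j = (if j < l then ennreal (v j) else \<infinity>)" for v :: "nat \<Rightarrow> real" and j
    define H where "H v = F (nat_path (\<lambda>j. zs ! j) (S' v))" for v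
    have S'_cong: "S' (\<lambda>j\<in>{..<l}. v j) = S' v" for v by (auto simp: S'_def)
    have "(\<lambda>v. S' v j) \<in> borel_measurable (PiM {..<l} (\<lambda>_. borel))" for j
      by (cases "j < l") (auto simp: S'_def intro!: measurable_compose[OF measurable_component_singleton[of j "{..<l}" "\<lambda>_. borel"] measurable_ennreal])
    then have H: "H \<in> borel_measurable (PiM {..<l} (\<lambda>_. borel))"
      unfolding H_def by (intro measurable_compose[OF measurable_nat_path F(1)]) auto
    have f: "indicator (forward_event M Y S zs) \<omega> * F (\<lambda>t. coal_Nhat n (Y \<omega>) (S \<omega>) (max t 0))
       = indicator (forward_event M Y S zs) \<omega> * H (\<lambda>j\<in>{..<l}. enn2real (S \<omega> (l - j)))" for \<omega>
    proof (cases "\<omega> \<in> forward_event M Y S zs")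
      case True
      have "(\<lambda>t. coal_Nhat n (Y \<omega>) (S \<omega>) (max t 0)) = nat_path (\<lambda>j. zs ! j) (S' (\<lambda>j. enn2real (S \<omega> (l - j))))"
        unfolding S'_def
        by (rule ext, subst forward_event_paths(1)[OF zs l True]) (auto simp: nat_path_nonneg_part)
      then show ?thesis by (simp add: H_def S'_cong)
    qed simp
    have r: "indicator (reversed_event n zs) \<omega> * F (nat_path (?Z \<omega>) (?S \<omega>))
       = indicator (reversed_event n zs) \<omega> * H (\<lambda>j\<in>{..<l}. enn2real (?S \<omega> j))" for \<omega>
    proof (cases "\<omega> \<in> reversed_event n zs")
      case True
      have "nat_path (?Z \<omega>) (?S \<omega>) t = nat_path (\<lambda>j. zs ! j) (S' (\<lambda>j. enn2real (?S \<omega> j))) t" for t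
      proof (rule nat_path_cong[of "Suc l"])
        show "?S \<omega> k = S' (\<lambda>j. enn2real (?S \<omega> j)) k" if "k < Suc l" for k
        proof (cases "k < l")
          case k: True
          then have "?S \<omega> k < \<infinity>" using True by (auto simp: reversed_event_def l)
          then show ?thesis using k by (simp add: S'_def)
        next
          case False
          then have "k = l" using that by simp
          then show ?thesis using True by (simp add: S'_def reversed_event_def l)
        qed
      qed (use True in \<open>auto simp: reversed_event_def l\<close>)
      then have "nat_path (?Z \<omega>) (?S \<omega>) = nat_path (\<lambda>j. zs ! j) (S' (\<lambda>j. enn2real (?S \<omega> j)))" by (rule ext)
      then show ?thesis by (simp add: H_def S'_cong)
    qed simp
    show ?thesis
      unfolding f r
    proof (rule integral_eq_if_orthants_eq)
      show "0 < enn2real (S \<omega> (l - j))" if "\<omega> \<in> forward_event M Y S zs" "j < l" for \<omega> j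
        using that by (auto simp: forward_event_def l enn2real_positive_iff)
      show "0 < enn2real (?S \<omega> j)" if "\<omega> \<in> reversed_event n zs" "j < l" for \<omega> j
        using that by (auto simp: reversed_event_def l enn2real_positive_iff)
      show "(\<lambda>\<omega>. enn2real (S \<omega> (l - j))) \<in> borel_measurable M" for j
        by (intro borel_measurable_enn2real measurable_coal_chain(2))
      show "(\<lambda>\<omega>. enn2real (?S \<omega> j)) \<in> borel_measurable clock_space" for j
        by (intro borel_measurable_enn2real measurable_holding)
      show "prob {\<omega> \<in> forward_event M Y S zs. \<forall>j<l. s j < enn2real (S \<omega> (l - j))}
          = \<Omega>.prob {\<omega> \<in> reversed_event n zs. \<forall>j<l. s j < enn2real (?S \<omega> j)}" if "\<And>j. 0 \<le> s j" for s
        by (simp only: measure_forward_event[OF zs l that] measure_reversed_event[OF n zs l that])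
    qed (rule H sets_forward_event sets_reversed_event finite_measure_axioms \<Omega>.finite_measure_axioms)+
  qed
  then have "(\<Sum>zs\<in>chains n. \<integral>\<omega>. indicator (forward_event M Y S zs) \<omega> * F (\<lambda>t. coal_Nhat n (Y \<omega>) (S \<omega>) (max t 0)) \<partial>M)
    = (\<Sum>zs\<in>chains n. \<integral>\<omega>. indicator (reversed_event n zs) \<omega> * F (nat_path (?Z \<omega>) (?S \<omega>)) \<partial>clock_space)"
    by simp
  also have "(\<Sum>zs\<in>chains n. \<integral>\<omega>. indicator (forward_event M Y S zs) \<omega> * F (\<lambda>t. coal_Nhat n (Y \<omega>) (S \<omega>) (max t 0)) \<partial>M)
     = (\<integral>\<omega>. F (\<lambda>t. coal_Nhat n (Y \<omega>) (S \<omega>) (max t 0)) \<partial>M)"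
    by (rule integral_partition[symmetric, OF finite_chains sets_forward_event disjoint_forward_event AE_forward_event m1 F(2)])
  also have "(\<Sum>zs\<in>chains n. \<integral>\<omega>. indicator (reversed_event n zs) \<omega> * F (nat_path (?Z \<omega>) (?S \<omega>)) \<partial>clock_space)
     = (\<integral>\<omega>. F (nat_path (?Z \<omega>) (?S \<omega>)) \<partial>clock_space)"
    by (rule \<Omega>.integral_partition[symmetric, OF finite_chains sets_reversed_event disjoint_reversed_event AE_reversed_event[OF n] m2 F(2)])
  finally show ?thesis .
qed

end

end

section \<open>Convergence\<close>

lemma weak_conv_nat_valued:
  assumes \<nu>: "real_distribution \<nu>" and conv: "weak_conv_m N \<nu>"
  obtains f :: "nat \<Rightarrow> real" and x :: "nat \<Rightarrow> real"
    where "f \<longlonglongrightarrow> 1" "\<And>i. real i < x i \<and> x i < real i + 1" "\<And>i. (\<lambda>n. measure (N n) {..x i}) \<longlonglongrightarrow> f i"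
proof -
  interpret real_distribution \<nu> by fact
  have "\<exists>y. real i < y \<and> y < real i + 1 \<and> isCont (cdf \<nu>) y" for i :: nat
  proof -
    have "mono (cdf \<nu>)" by (simp add: mono_def cdf_nondecreasing)
    then have "countable {y. \<not> isCont (cdf \<nu>) y}" by (rule mono_ctble_discont)
    moreover have "uncountable {real i<..<real i + 1}" by (simp add: uncountable_open_interval)
    ultimately have "\<not> {real i<..<real i + 1} \<subseteq> {y. \<not> isCont (cdf \<nu>) y}" by (meson countable_subset)
    then show ?thesis by auto
  qed
  then obtain x where x: "\<And>i. real i < x i \<and> x i < real i + 1 \<and> isCont (cdf \<nu>) (x i)" by metis
  have "filterlim x at_top sequentially"
    by (rule filterlim_at_top_mono[OF filterlim_real_sequentially]) (use x in \<open>auto intro: always_eventually less_imp_le\<close>)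
  then have "(\<lambda>i. cdf \<nu> (x i)) \<longlonglongrightarrow> 1" by (rule filterlim_compose[OF cdf_lim_at_top_prob])
  moreover have "(\<lambda>n. measure (N n) {..x i}) \<longlonglongrightarrow> cdf \<nu> (x i)" for i
    using conv x[of i] by (simp add: weak_conv_m_def weak_conv_def cdf_def)
  ultimately show ?thesis using x by (intro that[of "\<lambda>i. cdf \<nu> (x i)" x]) auto
qed

context lambda_coalescent
begin

lemma coal_L_distribution:
  assumes n: "2 \<le> n" and law: "mjp_jump_law M (coal_rate \<Lambda>) (coal_init n) Y S"
  shows "measure M {\<omega> \<in> space M. coal_L (Y \<omega>) (S \<omega>) \<le> i} = (\<Sum>j = 2..i. G n j * \<rho> j 1)"
proof -
  interpret prob_space M by (rule prob_space_coal[OF n law])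
  interpret \<Omega>: prob_space clock_space by (rule prob_space_clock_space)
  interpret jump_rates "hat_init_n n" "hat_rate_n n" by (rule jump_rates_green[OF n])
  let ?Z = "rev_chain n" and ?S = "rev_holding n"
  note YS = measurable_coal_chain[OF n law]
  define F :: "(real \<Rightarrow> enat) \<Rightarrow> real" where "F x = (if x 0 \<le> enat i then 1 else 0)" for x
  have "(\<lambda>x. x 0) \<in> measurable path_space (count_space UNIV)"
    unfolding path_space_def by (rule measurable_component_singleton) simp
  then have F: "F \<in> borel_measurable path_space"
    unfolding F_def by (rule measurable_compose) simp
  have bound: "\<bar>F x\<bar> \<le> 1" for x by (simp add: F_def)
  have "measure M {\<omega> \<in> space M. coal_L (Y \<omega>) (S \<omega>) \<le> i} = (\<integral>\<omega>. indicator {\<omega> \<in> space M. coal_L (Y \<omega>) (S \<omega>) \<le> i} \<omega> \<partial>M)"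
    by (simp add: Int_absorb2 Collect_restrict)
  also have "\<dots> = (\<integral>\<omega>. F (\<lambda>t. coal_Nhat n (Y \<omega>) (S \<omega>) (max t 0)) \<partial>M)"
  proof (rule integral_cong_AE)
    note [measurable] = measurable_coal_L[OF YS]
    show "(\<lambda>\<omega>. indicator {\<omega> \<in> space M. coal_L (Y \<omega>) (S \<omega>) \<le> i} \<omega> :: real) \<in> borel_measurable M" by measurable
    show "(\<lambda>\<omega>. F (\<lambda>t. coal_Nhat n (Y \<omega>) (S \<omega>) (max t 0))) \<in> borel_measurable M"
      by (rule measurable_compose[OF measurable_coal_Nhat_nonneg[OF YS] F])
    show "AE \<omega> in M. indicator {\<omega> \<in> space M. coal_L (Y \<omega>) (S \<omega>) \<le> i} \<omega> = F (\<lambda>t. coal_Nhat n (Y \<omega>) (S \<omega>) (max t 0))"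
      using AE_forward_event[OF n law] AE_space
    proof eventually_elim
      case (elim \<omega>)
      then obtain zs where zs: "zs \<in> chains n" "\<omega> \<in> forward_event M Y S zs" by blast
      obtain l where l: "length zs = Suc l" using zs by (cases "length zs") (auto simp: chains_def)
      show ?case using forward_event_paths(2)[OF n law zs(1) l zs(2)] elim by (simp add: F_def indicator_def)
    qed
  qed
  also have "\<dots> = (\<integral>\<omega>. F (nat_path (?Z \<omega>) (?S \<omega>)) \<partial>clock_space)"
    by (rule reversed_law[OF n law F bound])
  also have "\<dots> = (\<integral>\<omega>. indicator {\<omega> \<in> space clock_space. ?Z \<omega> 0 \<in> {..i}} \<omega> \<partial>clock_space)"
  proof (rule integral_cong_AE)
    show "(\<lambda>\<omega>. F (nat_path (?Z \<omega>) (?S \<omega>))) \<in> borel_measurable clock_space"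
      by (rule measurable_compose[OF measurable_nat_path[OF measurable_jump_chain measurable_holding] F])
    show "(\<lambda>\<omega>. indicator {\<omega> \<in> space clock_space. ?Z \<omega> 0 \<in> {..i}} \<omega> :: real) \<in> borel_measurable clock_space"
      using measurable_sets[OF measurable_jump_chain, of "{..i}" "hat_init_n n" "hat_rate_n n" 0]
      by (intro borel_measurable_indicator) (simp add: vimage_def del: jump_chain.simps)
    show "AE \<omega> in clock_space. F (nat_path (?Z \<omega>) (?S \<omega>)) = indicator {\<omega> \<in> space clock_space. ?Z \<omega> 0 \<in> {..i}} \<omega>"
      using AE_clock_even_not_in[OF countable_empty] AE_clock_odd_pos
    proof eventually_elim
      case (elim \<omega>)
      have u: "\<And>k. \<omega> (2 * k) \<in> {0..<1}" and e: "\<And>k. 0 < \<omega> (2 * k + 1)" using elim by auto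
      have "?Z \<omega> 0 \<le> n" by (rule reversed_chain(3)[of n \<omega>, OF n u])
      then consider "?Z \<omega> 0 < n" | "?Z \<omega> 0 = n" by linarith
      then have "0 < ?S \<omega> 0"
        by cases (use reversed_holding[of n \<omega> 0, OF n u e] in auto)
      then have "nat_path (?Z \<omega>) (?S \<omega>) 0 = enat (?Z \<omega> 0)"
        unfolding nat_path_def by (subst jump_path_eq_Some[of _ 0]) auto
      then show ?case by (simp add: F_def indicator_def del: jump_chain.simps)
    qed
  qed
  also have "\<dots> = measure clock_space {\<omega> \<in> space clock_space. (\<forall>k\<le>0::nat. ?Z \<omega> k \<in> {..i}) \<and> (\<forall>k<0::nat. ennreal 0 < ?S \<omega> k)}"
    by simp
  also have "\<dots> = (\<Sum>ys\<in>PiE {..0::nat} (\<lambda>_. {..i}). hat_init_n n (ys 0))"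
    by (subst mjp_jump_law_sets[OF mjp_jump_law_chain, where ss = "\<lambda>_. 0"]) auto
  also have "\<dots> = (\<Sum>j\<le>i. hat_init_n n j)"
    using sum_path_weights[where m = 0 and A = "\<lambda>_. {..i}" and f = "hat_init_n n"] by simp
  also have "\<dots> = (\<Sum>j = 2..i. G n j * \<rho> j 1)"
    by (rule sum.mono_neutral_cong_right) (auto simp: hat_init_def)
  finally show ?thesis .
qed

context
  fixes \<mu> :: "nat \<Rightarrow> real"
  assumes Q: "condQ \<Lambda> \<mu>"
begin

lemma condQ_has_sum: "2 \<le> i \<Longrightarrow> ((\<lambda>j. \<mu> j * \<rho> j i) has_sum (\<mu> i * \<rho>_tot i)) {i + 1..}"
  using Q by (simp add: condQ_def)

lemma condQ_pos_ge: "0 < \<mu> i \<Longrightarrow> 2 \<le> i"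
  using Q unfolding condQ_def by (metis less_irrefl not_le)

lemma jump_rates_condQ: "jump_rates (hat_init \<Lambda> \<mu>) (hat_rate \<Lambda> \<mu>)"
proof (rule jump_rates_hat)
  show "0 \<le> \<mu> i" for i using Q by (simp add: condQ_def)
  show exit: "((\<lambda>j. \<mu> j * \<rho> j 1) has_sum 1) {2..}" using Q by (simp add: condQ_def)
  show "\<exists>r. ((\<lambda>j. \<mu> j * \<rho> j i) has_sum r) {i + 1..}" for i
  proof -
    consider "i = 0" | "i = 1" | "2 \<le> i" by linarith
    then show ?thesis
    proof cases
      case 1
      then show ?thesis by (intro exI[of _ 0]) (simp add: rho_eq_0)
    next
      case 2
      then show ?thesis using exit by (intro exI[of _ 1]) (simp add: numeral_2_eq_2)
    next
      case 3
      then show ?thesis using condQ_has_sum by blast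
    qed
  qed
qed

lemma total_rate_condQ: "0 < \<mu> i \<Longrightarrow> total_rate (hat_rate \<Lambda> \<mu>) i = \<rho>_tot i"
  using total_rate_hat[OF condQ_has_sum, of i] condQ_pos_ge[of i] by simp

lemma jump_prob_condQ:
  assumes "0 < \<mu> i"
  shows "jump_prob (hat_rate \<Lambda> \<mu>) i j = (if i < j then \<mu> j * \<rho> j i / (\<mu> i * \<rho>_tot i) else 0)"
  using rho_tot_pos[OF condQ_pos_ge[OF assms]] assms
  by (simp add: jump_prob_def total_rate_condQ hat_rate_def)

lemma limit_chain:
  assumes u: "\<And>k. \<omega> (2 * k) \<in> {0..<1}"
  defines "Z \<equiv> jump_chain (hat_init \<Lambda> \<mu>) (hat_rate \<Lambda> \<mu>) \<omega>"
  shows "strict_mono Z"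
proof -
  interpret jump_rates "hat_init \<Lambda> \<mu>" "hat_rate \<Lambda> \<mu>" by (rule jump_rates_condQ)
  note pos = jump_chain_pos[of \<omega>, OF u, folded Z_def]
  have nn: "0 \<le> \<mu> i" for i using Q by (simp add: condQ_def)
  have G: "0 < \<mu> (Z k)" for k
  proof (induction k)
    case 0
    have "\<mu> (Z 0) \<noteq> 0" using pos(1) by (auto simp: hat_init_def split: if_splits)
    then show ?case using nn[of "Z 0"] by linarith
  next
    case (Suc k)
    have "\<mu> (Z (Suc k)) \<noteq> 0"
    proof
      assume "\<mu> (Z (Suc k)) = 0"
      with pos(2)[of k] show False by (simp add: jump_prob_condQ[OF Suc] split: if_splits)
    qed
    then show ?case using nn[of "Z (Suc k)"] by linarith
  qed
  show ?thesis
  proof (rule strict_monoI_Suc)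
    show "Z k < Z (Suc k)" for k using pos(2)[of k] by (simp add: jump_prob_condQ[OF G] split: if_splits)
  qed
qed

lemma AE_cadlag_limit:
  "AE \<omega> in clock_space. cadlag (nat_path (jump_chain (hat_init \<Lambda> \<mu>) (hat_rate \<Lambda> \<mu>) \<omega>) (holding (hat_init \<Lambda> \<mu>) (hat_rate \<Lambda> \<mu>) \<omega>))"
  using AE_clock_even_not_in[OF countable_empty]
proof eventually_elim
  case (elim \<omega>)
  then have "strict_mono (jump_chain (hat_init \<Lambda> \<mu>) (hat_rate \<Lambda> \<mu>) \<omega>)" by (intro limit_chain) auto
  then show ?case
    by (intro cadlag_nat_path strict_mono_mono disjI1) (blast intro: strict_mono_imp_increasing)+
qed

lemma AE_reversed_tendsto:
  assumes lim: "\<And>i. (\<lambda>n. G n i) \<longlonglongrightarrow> \<mu> i"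
  defines "X \<equiv> \<lambda>n \<omega>. nat_path (rev_chain n \<omega>) (rev_holding n \<omega>)"
  shows "AE \<omega> in clock_space. (\<forall>n. cadlag (X (n + 2) \<omega>)) \<and> skorohod_tendsto (\<lambda>n. X (n + 2) \<omega>)
     (nat_path (jump_chain (hat_init \<Lambda> \<mu>) (hat_rate \<Lambda> \<mu>) \<omega>) (holding (hat_init \<Lambda> \<mu>) (hat_rate \<Lambda> \<mu>) \<omega>))"
proof -
  interpret jump_rates "hat_init \<Lambda> \<mu>" "hat_rate \<Lambda> \<mu>" by (rule jump_rates_condQ)
  have lim2: "(\<lambda>n. G (n + 2) i) \<longlonglongrightarrow> \<mu> i" for i using lim by (rule LIMSEQ_ignore_initial_segment)
  let ?A = "range (\<lambda>j. \<Sum>i<j. hat_init \<Lambda> \<mu> i) \<union> (\<Union>y. range (\<lambda>j. \<Sum>i<j. jump_prob (hat_rate \<Lambda> \<mu>) y i))"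
  have "countable ?A" by auto
  note AE_clock_even_not_in[OF this]
  moreover have "AE \<omega> in clock_space. \<forall>n. \<exists>zs\<in>chains (n + 2). \<omega> \<in> reversed_event (n + 2) zs"
    unfolding AE_all_countable by (intro allI AE_reversed_event) simp
  ultimately show ?thesis
  proof eventually_elim
    case (elim \<omega>)
    have u: "\<And>k. \<omega> (2 * k) \<in> {0..<1}" using elim by auto
    let ?Z = "jump_chain (hat_init \<Lambda> \<mu>) (hat_rate \<Lambda> \<mu>) \<omega>" and ?S = "holding (hat_init \<Lambda> \<mu>) (hat_rate \<Lambda> \<mu>) \<omega>"
    let ?Zn = "\<lambda>n. rev_chain (n + 2) \<omega>" and ?Sn = "\<lambda>n. rev_holding (n + 2) \<omega>"
    have Z: "strict_mono ?Z" using u by (rule limit_chain)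
    have Zn: "mono (?Zn n)" for n
      unfolding mono_iff_le_Suc
    proof
      fix k
      have "2 \<le> n + 2" by simp
      note chain = reversed_chain[of "n + 2" \<omega>, OF this u]
      show "?Zn n k \<le> ?Zn n (Suc k)" using chain(3,4,5)[of k] by linarith
    qed
    have "cadlag (X (n + 2) \<omega>)" for n
    proof -
      obtain zs where "\<omega> \<in> reversed_event (n + 2) zs" using elim by blast
      then have "?Sn n (length zs - 1) = \<infinity>" by (simp add: reversed_event_def)
      then show ?thesis unfolding X_def by (intro cadlag_nat_path Zn) blast
    qed
    moreover have ev: "eventually (\<lambda>n. ?Zn n k = ?Z k \<and> ?Sn n k = ?S k) sequentially" for k
    proof (rule jump_chain_eventually_eq[where R = "\<lambda>y. 0 < \<mu> y" and \<omega> = \<omega>])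
      show "0 \<le> hat_init_n (n + 2) y" for n y by (simp add: hat_init_def)
      show "(\<lambda>n. hat_init_n (n + 2) y) \<longlonglongrightarrow> hat_init \<Lambda> \<mu> y" for y
        using tendsto_mult_right[OF lim2[of y], of "\<rho> y 1"] by (cases "2 \<le> y") (simp_all add: hat_init_def)
      show "0 \<le> jump_prob (hat_rate_n (n + 2)) y y'" for n y y'
        by (rule jump_rates.jump_prob_nonneg[OF jump_rates_green]) simp
      have pos_ev: "eventually (\<lambda>n. y < n + 2 \<and> 0 < G (n + 2) y) sequentially" if "0 < \<mu> y" for y
        using order_tendstoD(1)[OF lim2[of y] that] eventually_gt_at_top[of y] by eventually_elim auto
      show "(\<lambda>n. jump_prob (hat_rate_n (n + 2)) y y') \<longlonglongrightarrow> jump_prob (hat_rate \<Lambda> \<mu>) y y'" if "0 < \<mu> y" for y y'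
      proof (rule Lim_transform_eventually)
        show "eventually (\<lambda>n. (if y < y' then G (n + 2) y' * \<rho> y' y / (G (n + 2) y * \<rho>_tot y) else 0)
            = jump_prob (hat_rate_n (n + 2)) y y') sequentially"
          using pos_ev[OF that] by eventually_elim (simp only: jump_prob_green)
        have "\<mu> y * \<rho>_tot y \<noteq> 0" using that rho_tot_pos[OF condQ_pos_ge[OF that]] by simp
        then show "(\<lambda>n. if y < y' then G (n + 2) y' * \<rho> y' y / (G (n + 2) y * \<rho>_tot y) else 0)
            \<longlonglongrightarrow> jump_prob (hat_rate \<Lambda> \<mu>) y y'"
          unfolding jump_prob_condQ[OF that] by (cases "y < y'") (auto intro!: tendsto_intros lim2[simplified])
      qed
      show "eventually (\<lambda>n. total_rate (hat_rate_n (n + 2)) y = total_rate (hat_rate \<Lambda> \<mu>) y) sequentially" if "0 < \<mu> y" for y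
        using pos_ev[OF that] by eventually_elim (simp only: total_rate_green total_rate_condQ[OF that])
      have nn: "0 \<le> \<mu> y" for y using Q by (simp add: condQ_def)
      show "0 < \<mu> y" if "0 < hat_init \<Lambda> \<mu> y" for y
        using that nn[of y] by (cases "\<mu> y = 0") (auto simp: hat_init_def split: if_splits)
      show "0 < \<mu> y'" if "0 < \<mu> y" "0 < jump_prob (hat_rate \<Lambda> \<mu>) y y'" for y y'
        using that(2) nn[of y'] unfolding jump_prob_condQ[OF that(1)] by (cases "\<mu> y' = 0") (auto split: if_splits)
      show "\<omega> (2 * k) \<in> {0..<1} - ?A" for k using elim by blast
    qed
    have "skorohod_tendsto (\<lambda>n. X (n + 2) \<omega>) (nat_path ?Z ?S)"
    proof (rule skorohod_tendsto_uniform)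
      fix e :: real assume e: "0 < e"
      obtain m :: nat where m: "1 / e < real m" using reals_Archimedean2 by blast
      have "eventually (\<lambda>n. \<forall>k\<in>{..m}. ?Zn n k = ?Z k \<and> ?Sn n k = ?S k) sequentially"
        by (rule eventually_ball_finite) (use ev in auto)
      then show "eventually (\<lambda>n. \<forall>t\<ge>0. \<bar>phi (X (n + 2) \<omega> t) - phi (nat_path ?Z ?S t)\<bar> \<le> e) sequentially"
      proof eventually_elim
        case (elim n)
        have "\<bar>phi (X (n + 2) \<omega> t) - phi (nat_path ?Z ?S t)\<bar> \<le> e" for t
        proof -
          have "\<bar>phi (X (n + 2) \<omega> t) - phi (nat_path ?Z ?S t)\<bar> \<le> 1 / (real (?Zn n m) + 1)"
            unfolding X_def by (rule phi_nat_path_diff[OF Zn strict_mono_mono[OF Z]]) (use elim in auto)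
          also have "?Zn n m = ?Z m" using elim by simp
          also have "1 / (real (?Z m) + 1) \<le> 1 / (real m + 1)"
            using strict_mono_imp_increasing[OF Z, of m] by (intro divide_left_mono) auto
          also have "\<dots> \<le> e" using m e by (simp add: field_simps)
          finally show ?thesis .
        qed
        then show ?case by blast
      qed
    qed
    ultimately show ?case by blast
  qed
qed

end

end

theorem theorem5:
  fixes \<Lambda> :: "real measure"
    and M :: "nat \<Rightarrow> 'a measure"
    and Y :: "nat \<Rightarrow> 'a \<Rightarrow> nat \<Rightarrow> nat set set"
    and S :: "nat \<Rightarrow> 'a \<Rightarrow> nat \<Rightarrow> ennreal"
  assumes Lam: "Lambda_measure \<Lambda>"
    and coal: "\<forall>n\<ge>1. mjp_jump_law (M n) (coal_rate \<Lambda>) (coal_init n) (Y n) (S n)"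
    and Lconv: "\<exists>\<nu>. real_distribution \<nu> \<and>
                  weak_conv_m (\<lambda>n. distr (M n) borel (\<lambda>\<omega>. real (coal_L (Y n \<omega>) (S n \<omega>)))) \<nu>"
  shows "(\<exists>!\<mu>. condQ \<Lambda> \<mu>) \<and>
    (\<exists>(Minf :: (nat \<Rightarrow> real) measure) Yinf Sinf.
        mjp_jump_law Minf (hat_rate \<Lambda> (THE \<mu>. condQ \<Lambda> \<mu>)) (hat_init \<Lambda> (THE \<mu>. condQ \<Lambda> \<mu>)) Yinf Sinf
      \<and> (AE \<omega> in Minf. cadlag (nat_path (Yinf \<omega>) (Sinf \<omega>)))
      \<and> conv_dist_skorohod M (\<lambda>n \<omega>. coal_Nhat n (Y n \<omega>) (S n \<omega>))
           Minf (\<lambda>\<omega>. nat_path (Yinf \<omega>) (Sinf \<omega>)))"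
proof -
  interpret lambda_coalescent \<Lambda> by unfold_locales (fact Lam)
  interpret \<Omega>: prob_space clock_space by (rule prob_space_clock_space)
  have law: "mjp_jump_law (M n) (coal_rate \<Lambda>) (coal_init n) (Y n) (S n)" if "2 \<le> n" for n
    using coal that by simp
  obtain \<nu> where "real_distribution \<nu>"
    "weak_conv_m (\<lambda>n. distr (M n) borel (\<lambda>\<omega>. real (coal_L (Y n \<omega>) (S n \<omega>)))) \<nu>"
    using Lconv by blast
  then obtain f x where f: "f \<longlonglongrightarrow> 1" and x: "\<And>i. real i < x i \<and> x i < real i + 1"
    and fx: "\<And>i. (\<lambda>n. measure (distr (M n) borel (\<lambda>\<omega>. real (coal_L (Y n \<omega>) (S n \<omega>)))) {..x i}) \<longlonglongrightarrow> f i"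
    by (rule weak_conv_nat_valued) blast
  have exit_lim: "(\<lambda>n. \<Sum>j = 2..i. G n j * \<rho> j 1) \<longlonglongrightarrow> f i" for i
  proof (rule Lim_transform_eventually[OF fx])
    show "eventually (\<lambda>n. measure (distr (M n) borel (\<lambda>\<omega>. real (coal_L (Y n \<omega>) (S n \<omega>)))) {..x i}
        = (\<Sum>j = 2..i. G n j * \<rho> j 1)) sequentially"
      using eventually_ge_at_top[of 2]
    proof eventually_elim
      case (elim n)
      have "(\<lambda>\<omega>. real (coal_L (Y n \<omega>) (S n \<omega>))) \<in> borel_measurable (M n)"
        by (rule measurable_compose[OF measurable_coal_L[OF measurable_coal_chain[OF elim law[OF elim]]]]) simp
      then have "measure (distr (M n) borel (\<lambda>\<omega>. real (coal_L (Y n \<omega>) (S n \<omega>)))) {..x i}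
          = measure (M n) ((\<lambda>\<omega>. real (coal_L (Y n \<omega>) (S n \<omega>))) -` {..x i} \<inter> space (M n))"
        by (rule measure_distr) simp
      also have "(\<lambda>\<omega>. real (coal_L (Y n \<omega>) (S n \<omega>))) -` {..x i} \<inter> space (M n)
          = {\<omega> \<in> space (M n). coal_L (Y n \<omega>) (S n \<omega>) \<le> i}"
      proof -
        have "real k \<le> x i \<longleftrightarrow> k \<le> i" for k :: nat using x[of i] by linarith
        then show ?thesis by auto
      qed
      finally show ?case by (simp only: coal_L_distribution[OF elim law[OF elim]])
    qed
  qed
  define \<mu> where "\<mu> i = lim (\<lambda>n. G n i)" for i
  have lim: "(\<lambda>n. G n i) \<longlonglongrightarrow> \<mu> i" for i
    unfolding \<mu>_def using green_convergent[OF exit_lim] by (simp add: convergent_LIMSEQ_iff)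
  have Q: "condQ \<Lambda> \<mu>" by (rule condQ_limit[OF lim exit_lim f])
  have unique: "\<nu> = \<mu>" if "condQ \<Lambda> \<nu>" for \<nu> by (rule condQ_eq_limit[OF lim that])
  have the: "(THE \<mu>. condQ \<Lambda> \<mu>) = \<mu>" using Q unique by (rule the_equality)
  let ?X = "\<lambda>\<omega>. nat_path (jump_chain (hat_init \<Lambda> \<mu>) (hat_rate \<Lambda> \<mu>) \<omega>) (holding (hat_init \<Lambda> \<mu>) (hat_rate \<Lambda> \<mu>) \<omega>)"
  let ?Xn = "\<lambda>n \<omega>. nat_path (rev_chain n \<omega>) (rev_holding n \<omega>)"
  have conv: "conv_dist_skorohod M (\<lambda>n \<omega>. coal_Nhat n (Y n \<omega>) (S n \<omega>)) clock_space ?X"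
    unfolding conv_dist_skorohod_def
  proof (intro allI impI)
    fix F :: "(real \<Rightarrow> enat) \<Rightarrow> real"
    assume "(\<exists>B. \<forall>x. \<bar>F x\<bar> \<le> B) \<and> F \<in> borel_measurable path_space \<and> skorohod_continuous F"
    then obtain B where B: "\<And>x. \<bar>F x\<bar> \<le> B" and F: "F \<in> borel_measurable path_space" and cont: "skorohod_continuous F"
      by blast
    have eq: "(\<integral>\<omega>. F (coal_Nhat n (Y n \<omega>) (S n \<omega>)) \<partial>(M n)) = (\<integral>\<omega>. F (?Xn n \<omega>) \<partial>clock_space)" if n: "2 \<le> n" for n
    proof -
      note YS = measurable_coal_chain[OF n law[OF n]]
      from measurable_compose[OF measurable_coal_Nhat_nonneg[OF YS] F] measurable_compose[OF measurable_coal_Nhat[OF YS] F]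
      have "(\<integral>\<omega>. F (coal_Nhat n (Y n \<omega>) (S n \<omega>)) \<partial>(M n))
          = (\<integral>\<omega>. F (\<lambda>t. coal_Nhat n (Y n \<omega>) (S n \<omega>) (max t 0)) \<partial>(M n))"
      proof (intro integral_cong_AE)
        show "AE \<omega> in M n. F (coal_Nhat n (Y n \<omega>) (S n \<omega>)) = F (\<lambda>t. coal_Nhat n (Y n \<omega>) (S n \<omega>) (max t 0))"
          using AE_cadlag_coal_Nhat[OF n law[OF n]]
        proof eventually_elim
          case (elim \<omega>)
          moreover have "cadlag (\<lambda>t. coal_Nhat n (Y n \<omega>) (S n \<omega>) (max t 0))"
            by (rule cadlag_cong[OF _ elim]) simp
          ultimately show ?case by (intro skorohod_continuous_cong[OF cont]) auto
        qed
      qed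
      also have "\<dots> = (\<integral>\<omega>. F (?Xn n \<omega>) \<partial>clock_space)" by (rule reversed_law[OF n law[OF n] F B])
      finally show ?thesis .
    qed
    have "(\<lambda>n. \<integral>\<omega>. F (?Xn (n + 2) \<omega>) \<partial>clock_space) \<longlonglongrightarrow> (\<integral>\<omega>. F (?X \<omega>) \<partial>clock_space)"
    proof (rule integral_dominated_convergence[where w = "\<lambda>_. B"])
      show "AE \<omega> in clock_space. (\<lambda>n. F (?Xn (n + 2) \<omega>)) \<longlonglongrightarrow> F (?X \<omega>)"
        using AE_reversed_tendsto[OF Q lim] AE_cadlag_limit[OF Q]
      proof eventually_elim
        case (elim \<omega>)
        then show ?case
          using cont[unfolded skorohod_continuous_def, rule_format, of "?X \<omega>" "\<lambda>n. ?Xn (n + 2) \<omega>"] by blast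
      qed
      show "(\<lambda>\<omega>. F (?X \<omega>)) \<in> borel_measurable clock_space" "(\<lambda>\<omega>. F (?Xn (n + 2) \<omega>)) \<in> borel_measurable clock_space" for n
        by (rule measurable_compose[OF measurable_nat_path[OF measurable_jump_chain measurable_holding] F])+
    qed (use B in auto)
    then have "(\<lambda>n. \<integral>\<omega>. F (coal_Nhat (n + 2) (Y (n + 2) \<omega>) (S (n + 2) \<omega>)) \<partial>(M (n + 2))) \<longlonglongrightarrow> (\<integral>\<omega>. F (?X \<omega>) \<partial>clock_space)"
      by (simp add: eq)
    then show "(\<lambda>n. \<integral>\<omega>. F (coal_Nhat n (Y n \<omega>) (S n \<omega>)) \<partial>(M n)) \<longlonglongrightarrow> (\<integral>\<omega>. F (?X \<omega>) \<partial>clock_space)"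
      by (rule LIMSEQ_offset)
  qed
  have "\<exists>!\<mu>. condQ \<Lambda> \<mu>" using Q unique by (rule ex1I)
  moreover have "mjp_jump_law clock_space (hat_rate \<Lambda> \<mu>) (hat_init \<Lambda> \<mu>)
      (jump_chain (hat_init \<Lambda> \<mu>) (hat_rate \<Lambda> \<mu>)) (holding (hat_init \<Lambda> \<mu>) (hat_rate \<Lambda> \<mu>))"
    by (rule jump_rates.mjp_jump_law_chain[OF jump_rates_condQ[OF Q]])
  ultimately show ?thesis unfolding the using AE_cadlag_limit[OF Q] conv by blast
qed

end
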